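(* Let $f\in\mathbb{F}_p[x_1,\ldots,x_n]$ be of degree at most $n$. If $\prod_i x_i$ is not in $f$'s Newton polytope (i.e. $(1,\ldots,1)$ is not in the Newton polytope), e.g. if $\deg f<n$, then $\mathrm{Tr}(f^{p-1})=0$; hence no scalar multiple of $\mathrm{Tr}(f^{p-1}\bullet)$ is a Frobenius splitting. Hereafter let $\lambda$ be a weighting such that some nonzero $\mathbb{F}_p$-multiple of $\prod_i x_i$ is a term of $\mathrm{init}(f)$. (1) $\mathrm{Tr}(f^{p-1})=\mathrm{Tr}(\mathrm{init}(f)^{p-1})$, so (a multiple of) $\mathrm{Tr}(f^{p-1}\bullet)$ defines a Frobenius splitting if and only if (the same multiple of) $\mathrm{Tr}(\mathrm{init}(f)^{p-1}\bullet)$ does. (2) Assume hereafter that some multiples of $\mathrm{Tr}(f^{p-1}\bullet)$ and $\mathrm{Tr}(\mathrm{init}(f)^{p-1}\bullet)$ do define splittings. Let $I$ be an ideal compatibly split with respect to the first splitting. Then $\mathrm{init}(I)$ is compatibly split with respect to the second splitting. (3) Let $\mathcal{Y}_f$ and $\mathcal{Y}_{\mathrm{init} f}$ denote the posets of irreducible varieties (in $\mathbb{A}^n$) compatibly split by (the splittings that are multiples of) $\mathrm{Tr}(f^{p-1}\bullet)$ and $\mathrm{Tr}(\mathrm{init}(f)^{p-1}\bullet)$ respectively, partially ordered by inclusion. Then the map $$\pi_{f,\mathrm{init}}:\mathcal{Y}_{\mathrm{init} f}\to\mathcal{Y}_f,\qquad Y'\mapsto\text{the unique minimal } Y \text{ such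 that } \mathrm{init}\,Y\supseteq Y'$$ is well-defined, order-preserving, and surjective. Moreover, if $Y_1'\in\mathcal{Y}_{\mathrm{init} f}$, $Y_2\in\mathcal{Y}_f$, and $Y_1=\pi_{f,\mathrm{init}}(Y_1')$, then $$Y_2\supseteq Y_1\iff \exists\, Y_2'\in\mathcal{Y}_{\mathrm{init} f}\ \text{with}\ Y_2'\supseteq Y_1'\ \text{and}\ \pi_{f,\mathrm{init}}(Y_2')=Y_2,$$ so the partial order on $\mathcal{Y}_f$ is determined by that on $\mathcal{Y}_{\mathrm{init} f}$ plus the map $\pi_{f,\mathrm{init}}$. (4) Assume $f$ is homogeneous, and let $\mathcal{Y}^{=\dim}_{\mathrm{init} f}:=\{Y'\in\mathcal{Y}_{\mathrm{init} f}:\dim\pi_{f,\mathrm{init}}(Y')=\dim Y'\}$. Then for any $Y\in\mathcal{Y}_f$, $$\sum_{Y'\in\pi_{f,\mathrm{init}}^{-1}(Y)\,\cap\,\mathcal{Y}^{=\dim}_{\mathrm{init} f}}\deg Y'=\deg Y.$$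
   Context: A near-splitting of a commutative $\mathbb{F}_p$-algebra $R$ is a map $\varphi:R\to R$ with $\varphi(a+b)=\varphi(a)+\varphi(b)$ and $\varphi(a^pb)=a\,\varphi(b)$. It is a (Frobenius) splitting if moreover $\varphi(1)=1$. An ideal $I\le R$ is compatibly split by the splitting $\varphi$ if $\varphi(I)\subseteq I$; a subscheme is compatibly split if its defining ideal is. $\mathrm{Tr}(\bullet)$ denotes the unique near-splitting of $\mathbb{F}_p[x_1,\ldots,x_n]$ whose value on each monomial $m$ is $\sqrt[p]{m\prod_i x_i}\,\big/\prod_i x_i$ if $m\prod_i x_i$ is a $p$th power, and $0$ otherwise. For a polynomial $h$, $\mathrm{Tr}(h\bullet)$ is the near-splitting $g\mapsto\mathrm{Tr}(hg)$. "Multiple" means $\mathbb{F}_p$-scalar multiple. The Newton polytope of $f$ is the convex hull of the exponent vectors of the monomials in $f$. A weighting is a function $\lambda:\{1,\ldots,n\}\to\mathbb{N}$ (with $0\in\mathbb{N}$). The leading form $\mathrm{init}(g)$ of a polynomial $g$ is the sum of the terms $c\prod_i x_i^{e_i}$ of $g$ with maximum $\sum_i\lambda_ie_i$. For an ideal $I$, $\mathrm{init}(I)$ is the linear span of $\{\mathrm{init}(g):g\in I\}$ (an ideal). For a closed subscheme $Y\subseteq\mathbb{A}^n$ with ideal $I$, $\mathrm{init}\,Y$ is the subscheme defined by $\mathrm{init}(I)$. When $f$ is homogeneous, each element of $\mathcal{Y}_f$ and $\mathcal{Y}_{\mathrm{init} f}$ is the affine cone over a projective variety, and its degree is the degree of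 that cone (for the origin, degree $1$). *)

theory Defs
  imports
    "HOL-Analysis.Analysis"
    "HOL-Library.Poly_Mapping"
    "HOL-Library.Extended_Nat"
    "HOL-Algebra.Algebraic_Closure_Type"
    "Berlekamp_Zassenhaus.Finite_Field"
begin

section \<open>Polynomials in finitely many variables\<close>

text \<open>
  The variables are indexed by a finite type \<open>'n\<close>, so the number of variables is \<open>CARD('n)\<close>.
  A monomial is represented by its exponent vector, and the prime field with \<open>CARD('p)\<close> elements
  is \<open>'p mod_ring\<close> with \<open>'p :: prime_card\<close>.
\<close>

type_synonym ('n, 'k) mpoly = "('n \<Rightarrow>\<^sub>0 nat) \<Rightarrow>\<^sub>0 'k"

abbreviation monom_of :: "('n \<Rightarrow>\<^sub>0 nat) \<Rightarrow> 'k \<Rightarrow> ('n, 'k::zero) mpoly" where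
  "monom_of e c \<equiv> Poly_Mapping.single e c"

abbreviation coeff_of :: "('n, 'k::zero) mpoly \<Rightarrow> ('n \<Rightarrow>\<^sub>0 nat) \<Rightarrow> 'k" where
  "coeff_of g e \<equiv> Poly_Mapping.lookup g e"

text \<open>The exponent vector of the product of all variables.\<close>

definition ones :: "'n::finite \<Rightarrow>\<^sub>0 nat" where
  "ones = Abs_poly_mapping (\<lambda>_. 1)"

definition scalar_mult :: "'k::field \<Rightarrow> ('n, 'k) mpoly \<Rightarrow> ('n, 'k) mpoly" where
  "scalar_mult c g = monom_of 0 c * g"

global_interpretation mpoly_vs: vector_space "scalar_mult :: 'k::field \<Rightarrow> ('n, 'k) mpoly \<Rightarrow> _"
  by standard (simp_all add: scalar_mult_def distrib_left distrib_right single_add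
      mult_single flip: mult.assoc)

definition weight :: "('n::finite \<Rightarrow> nat) \<Rightarrow> ('n \<Rightarrow>\<^sub>0 nat) \<Rightarrow> nat" where
  "weight w e = (\<Sum>i\<in>UNIV. w i * Poly_Mapping.lookup e i)"

abbreviation monom_degree :: "('n::finite \<Rightarrow>\<^sub>0 nat) \<Rightarrow> nat" where
  "monom_degree \<equiv> weight (\<lambda>_. 1)"

text \<open>The zero polynomial gets degree \<open>0\<close>; only upper bounds on the degree are ever used.\<close>

definition total_degree :: "('n::finite, 'k::zero) mpoly \<Rightarrow> nat" where
  "total_degree g = Max (insert 0 (monom_degree ` Poly_Mapping.keys g))"

definition homogeneous_of_degree :: "nat \<Rightarrow> ('n::finite, 'k::zero) mpoly \<Rightarrow> bool" where
  "homogeneous_of_degree d g \<longleftrightarrow> (\<forall>e\<in>Poly_Mapping.keys g. monom_degree e = d)"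

definition homogeneous :: "('n::finite, 'k::zero) mpoly \<Rightarrow> bool" where
  "homogeneous g \<longleftrightarrow> (\<exists>d. homogeneous_of_degree d g)"

definition exponent_vector :: "('n::finite \<Rightarrow>\<^sub>0 nat) \<Rightarrow> real ^ 'n" where
  "exponent_vector e = (\<chi> i. real (Poly_Mapping.lookup e i))"

definition newton_polytope :: "('n::finite, 'k::zero) mpoly \<Rightarrow> (real ^ 'n) set" where
  "newton_polytope g = convex hull (exponent_vector ` Poly_Mapping.keys g)"


section \<open>Leading forms\<close>

definition leading_form :: "('n::finite \<Rightarrow> nat) \<Rightarrow> ('n, 'k::comm_monoid_add) mpoly \<Rightarrow> ('n, 'k) mpoly" where
  "leading_form w g =
     (\<Sum>e | e \<in> Poly_Mapping.keys g \<and> (\<forall>e'\<in>Poly_Mapping.keys g. weight w e' \<le> weight w e).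
        monom_of e (coeff_of g e))"

definition init_ideal :: "('n::finite \<Rightarrow> nat) \<Rightarrow> ('n, 'k::field) mpoly set \<Rightarrow> ('n, 'k) mpoly set" where
  "init_ideal w I = mpoly_vs.span (leading_form w ` I)"


section \<open>Frobenius splittings\<close>

text \<open>
  Here \<open>p\<close> is meant to be a prime with \<open>p = 0\<close> in \<open>'r\<close>, i.e. \<open>'r\<close> is an algebra over the
  field with \<open>p\<close> elements.
\<close>

definition near_splitting :: "nat \<Rightarrow> ('r::comm_ring_1 \<Rightarrow> 'r) \<Rightarrow> bool" where
  "near_splitting p \<phi> \<longleftrightarrow>
     (\<forall>a b. \<phi> (a + b) = \<phi> a + \<phi> b) \<and> (\<forall>a b. \<phi> (a ^ p * b) = a * \<phi> b)"

definition frobenius_splitting :: "nat \<Rightarrow> ('r::comm_ring_1 \<Rightarrow> 'r) \<Rightarrow> bool" where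
  "frobenius_splitting p \<phi> \<longleftrightarrow> near_splitting p \<phi> \<and> \<phi> 1 = 1"

definition compatibly_split :: "('r::comm_ring_1 \<Rightarrow> 'r) \<Rightarrow> 'r set \<Rightarrow> bool" where
  "compatibly_split \<phi> I \<longleftrightarrow> ideal I ring_of_type_algebra \<and> \<phi> ` I \<subseteq> I"

text \<open>
  The monomial with exponent vector \<open>e\<close> times the product of all variables is a \<open>p\<close>-th power iff
  \<open>p\<close> divides every \<open>e\<^sub>i + 1\<close>; the root divided by the product of all variables then has exponents
  \<open>(e\<^sub>i + 1) / p - 1\<close>, which are nonnegative.
\<close>

definition trace_monomial :: "nat \<Rightarrow> ('n::finite \<Rightarrow>\<^sub>0 nat) \<Rightarrow> ('n, 'k::comm_ring_1) mpoly" where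
  "trace_monomial p e =
     (if \<forall>i. p dvd Poly_Mapping.lookup e i + 1
      then monom_of (Abs_poly_mapping (\<lambda>i. (Poly_Mapping.lookup e i + 1) div p - 1)) 1
      else 0)"

text \<open>Existence and uniqueness are shown in \<open>ex1_Tr\<close> below.\<close>

definition Tr :: "('n::finite, 'p::prime_card mod_ring) mpoly \<Rightarrow> ('n, 'p mod_ring) mpoly" where
  "Tr = (THE \<phi>. near_splitting CARD('p) \<phi> \<and> (\<forall>e. \<phi> (monom_of e 1) = trace_monomial CARD('p) e))"

definition Tr_multiple ::
  "'p mod_ring \<Rightarrow> ('n::finite, 'p::prime_card mod_ring) mpoly \<Rightarrow> ('n, 'p mod_ring) mpoly
     \<Rightarrow> ('n, 'p mod_ring) mpoly" where
  "Tr_multiple c h = (\<lambda>g. scalar_mult c (Tr (h * g)))"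


section \<open>Closed subschemes of affine space\<close>

text \<open>
  A closed subscheme of affine space is represented by its defining ideal, so inclusion of
  subschemes is reverse inclusion of ideals, and the irreducible varieties (integral closed
  subschemes) correspond to the prime ideals.
\<close>

definition subscheme_le :: "'r set \<Rightarrow> 'r set \<Rightarrow> bool" (infix \<open>\<sqsubseteq>\<^sub>s\<close> 50) where
  "Y \<sqsubseteq>\<^sub>s Z \<longleftrightarrow> Z \<subseteq> Y"

definition irreducible_variety :: "'r::comm_ring_1 set \<Rightarrow> bool" where
  "irreducible_variety Y \<longleftrightarrow> primeideal Y ring_of_type_algebra"

definition split_varieties :: "('r::comm_ring_1 \<Rightarrow> 'r) \<Rightarrow> 'r set set" where
  "split_varieties \<phi> = {Y. irreducible_variety Y \<and> compatibly_split \<phi> Y}"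

definition minimal_degenerating_to ::
  "('n::finite \<Rightarrow> nat) \<Rightarrow> ('n, 'k::field) mpoly set set \<Rightarrow> ('n, 'k) mpoly set \<Rightarrow> ('n, 'k) mpoly set
     \<Rightarrow> bool" where
  "minimal_degenerating_to w \<Y> Y' Y \<longleftrightarrow>
     Y \<in> \<Y> \<and> Y' \<sqsubseteq>\<^sub>s init_ideal w Y \<and>
     (\<forall>Z\<in>\<Y>. Y' \<sqsubseteq>\<^sub>s init_ideal w Z \<and> Z \<sqsubseteq>\<^sub>s Y \<longrightarrow> Z = Y)"

definition degeneration_map ::
  "('n::finite \<Rightarrow> nat) \<Rightarrow> ('n, 'k::field) mpoly set set \<Rightarrow> ('n, 'k) mpoly set
     \<Rightarrow> ('n, 'k) mpoly set" where
  "degeneration_map w \<Y> Y' = (THE Y. minimal_degenerating_to w \<Y> Y' Y)"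


section \<open>Dimension and degree\<close>

text \<open>
  The Krull dimension: the supremum of the lengths of strictly decreasing chains of irreducible
  varieties contained in the given one.
\<close>

definition variety_dim :: "'r::comm_ring_1 set \<Rightarrow> enat" where
  "variety_dim Y =
     (SUP l \<in> {l. \<exists>Z :: nat \<Rightarrow> 'r set. (\<forall>i\<le>l. irreducible_variety (Z i) \<and> Z i \<sqsubseteq>\<^sub>s Y) \<and>
                    (\<forall>i<l. Z (Suc i) \<sqsubseteq>\<^sub>s Z i \<and> Z (Suc i) \<noteq> Z i)}. enat l)"

definition homogeneous_component :: "nat \<Rightarrow> ('n::finite, 'k::comm_monoid_add) mpoly \<Rightarrow> ('n, 'k) mpoly" where
  "homogeneous_component d g =
     (\<Sum>e | e \<in> Poly_Mapping.keys g \<and> monom_degree e = d. monom_of e (coeff_of g e))"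

text \<open>
  A closed subscheme is a cone iff its ideal is homogeneous.
\<close>

definition is_cone :: "('n::finite, 'k::comm_monoid_add) mpoly set \<Rightarrow> bool" where
  "is_cone Y \<longleftrightarrow> (\<forall>g\<in>Y. \<forall>d. homogeneous_component d g \<in> Y)"

text \<open>
  For a cone \<open>Y\<close>, \<open>hilbert_function Y d\<close> is the dimension of the degree \<open>d\<close> part of the
  homogeneous coordinate ring, i.e. of the space of forms of degree \<open>d\<close> modulo those in \<open>Y\<close>.
\<close>

definition hilbert_function :: "('n::finite, 'k::field) mpoly set \<Rightarrow> nat \<Rightarrow> nat" where
  "hilbert_function Y d =
     mpoly_vs.dim {g :: ('n, 'k) mpoly. homogeneous_of_degree d g}
       - mpoly_vs.dim {g \<in> Y. homogeneous_of_degree d g}"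

definition hilbert_poly :: "('n::finite, 'k::field) mpoly set \<Rightarrow> rat poly" where
  "hilbert_poly Y =
     (THE q. \<forall>\<^sub>F d in sequentially. poly q (of_nat d) = of_nat (hilbert_function Y d))"

definition origin :: "('n::finite, 'k::zero) mpoly set" where
  "origin = {g. coeff_of g 0 = 0}"

text \<open>
  The degree of the projective variety whose affine cone is \<open>Y\<close>: if its dimension, i.e. the degree
  of its Hilbert polynomial, is \<open>r\<close>, then it is \<open>r!\<close> times the leading coefficient of the Hilbert
  polynomial. The origin is the cone over the empty variety.
\<close>

definition cone_degree :: "('n::finite, 'k::field) mpoly set \<Rightarrow> rat" where
  "cone_degree Y =
     (if Y = origin then 1
      else fact (Polynomial.degree (hilbert_poly Y)) * Polynomial.lead_coeff (hilbert_poly Y))"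


section \<open>Well-definedness of the trace\<close>

lemma mpoly_eq_sum_monoms:
  "g = (\<Sum>e\<in>Poly_Mapping.keys g. monom_of e (coeff_of g e))"
  by (intro poly_mapping_eqI)
    (auto simp: lookup_sum lookup_single when_def in_keys_iff)

lemma mpoly_induct:
  fixes g :: "('n, 'k::comm_monoid_add) mpoly"
  assumes "P 0" "\<And>e c. P (monom_of e c)" "\<And>g h. P g \<Longrightarrow> P h \<Longrightarrow> P (g + h)"
  shows "P g"
proof -
  have "P (\<Sum>e\<in>A. monom_of e (coeff_of g e))" if "finite A" for A
    using that by induction (auto intro: assms)
  from this[of "Poly_Mapping.keys g"] show ?thesis
    by (simp flip: mpoly_eq_sum_monoms)
qed

lemma CHAR_mpoly: "CHAR(('n, 'p::prime_card mod_ring) mpoly) = CARD('p)"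
proof (rule CHAR_eqI)
  show "of_nat CARD('p) = (0 :: ('n, 'p mod_ring) mpoly)"
    by (intro poly_mapping_eqI) (simp add: lookup_of_nat of_nat_eq_0_iff_char_dvd)
next
  fix m :: nat
  assume "of_nat m = (0 :: ('n, 'p mod_ring) mpoly)"
  then have "coeff_of (of_nat m :: ('n, 'p mod_ring) mpoly) 0 = 0"
    by simp
  then show "CARD('p) dvd m"
    by (simp add: lookup_of_nat of_nat_eq_0_iff_char_dvd)
qed

lemma mpoly_frobenius_add:
  fixes a b :: "('n, 'p::prime_card mod_ring) mpoly"
  shows "(a + b) ^ CARD('p) = a ^ CARD('p) + b ^ CARD('p)"
  by (rule freshmans_dream) (simp_all add: CHAR_mpoly prime_card)

lemma mod_ring_power_card: "(c :: 'p::prime_card mod_ring) ^ CARD('p) = c"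
  using finite_field_power_card_eq_same[of c] by simp

lemma monom_of_power:
  "monom_of e c ^ m = monom_of (\<Sum>_\<in>{..<m}. e) ((c::'k::comm_ring_1) ^ m)"
  by (induction m) (simp_all add: mult_single add.commute flip: single_one)

lemma trace_monomial_shift:
  assumes "p > 0"
  shows "trace_monomial p ((\<Sum>_\<in>{..<p}. u) + v) =
           monom_of u (1::'k::comm_ring_1) * trace_monomial p v"
proof -
  have lookup: "Poly_Mapping.lookup ((\<Sum>_\<in>{..<p}. u) + v) i =
      p * Poly_Mapping.lookup u i + Poly_Mapping.lookup v i" for i
    by (simp add: lookup_add lookup_sum)
  have dvd: "p dvd p * Poly_Mapping.lookup u i + Poly_Mapping.lookup v i + 1 \<longleftrightarrow>
      p dvd Poly_Mapping.lookup v i + 1" for i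
    by (metis add.assoc dvd_add_right_iff dvd_triv_left)
  show ?thesis
  proof (cases "\<forall>i. p dvd Poly_Mapping.lookup v i + 1")
    case True
    have div: "(p * Poly_Mapping.lookup u i + Poly_Mapping.lookup v i + 1) div p - 1 =
        Poly_Mapping.lookup u i + ((Poly_Mapping.lookup v i + 1) div p - 1)" for i
    proof -
      obtain q where q: "Poly_Mapping.lookup v i + 1 = p * q"
        using True by (meson dvdE)
      then have "q > 0" by (cases q) auto
      moreover have "p * Poly_Mapping.lookup u i + Poly_Mapping.lookup v i + 1 =
          p * (Poly_Mapping.lookup u i + q)"
        using q by (simp add: algebra_simps)
      ultimately show ?thesis
        using q assms by (simp del: add_Suc_right)
    qed
    have "Abs_poly_mapping (\<lambda>i. (p * Poly_Mapping.lookup u i + Poly_Mapping.lookup v i + 1) div p - 1)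
        = u + Abs_poly_mapping (\<lambda>i. (Poly_Mapping.lookup v i + 1) div p - 1)"
      unfolding div by (intro poly_mapping_eqI) (simp add: lookup_add)
    then show ?thesis
      using True unfolding trace_monomial_def lookup dvd by (simp add: mult_single)
  next
    case False
    then show ?thesis
      unfolding trace_monomial_def lookup dvd if_not_P[OF False] by simp
  qed
qed

lemma ex1_Tr:
  "\<exists>!\<phi> :: ('n::finite, 'p::prime_card mod_ring) mpoly \<Rightarrow> ('n, 'p mod_ring) mpoly.
     near_splitting CARD('p) \<phi> \<and> (\<forall>e. \<phi> (monom_of e 1) = trace_monomial CARD('p) e)"
proof -
  define T :: "('n, 'p mod_ring) mpoly \<Rightarrow> ('n, 'p mod_ring) mpoly" where
    "T g = (\<Sum>e\<in>Poly_Mapping.keys g. scalar_mult (coeff_of g e) (trace_monomial CARD('p) e))" for g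
  have T_superset: "T g = (\<Sum>e\<in>A. scalar_mult (coeff_of g e) (trace_monomial CARD('p) e))"
    if "finite A" "Poly_Mapping.keys g \<subseteq> A" for g A
    unfolding T_def using that
    by (intro sum.mono_neutral_left) (auto simp: in_keys_iff)
  have T_add: "T (g + h) = T g + T h" for g h
  proof -
    let ?A = "Poly_Mapping.keys g \<union> Poly_Mapping.keys h"
    have "Poly_Mapping.keys (g + h) \<subseteq> ?A"
      by (rule Poly_Mapping.keys_add)
    then show ?thesis
      by (simp add: T_superset[of ?A] lookup_add mpoly_vs.scale_left_distrib sum.distrib)
  qed
  have T_0: "T 0 = 0"
    by (simp add: T_def)
  have T_monom: "T (monom_of e c) = scalar_mult c (trace_monomial CARD('p) e)" for e c
    by (simp add: T_superset[of "{e}"])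
  have T_near: "T (a ^ CARD('p) * b) = a * T b" for a b
  proof (induction a rule: mpoly_induct)
    case 1
    have "CARD('p) > 0"
      using prime_card prime_gt_0_nat by blast
    then show ?case by (simp add: T_0 zero_power)
  next
    case (2 u c)
    show ?case
    proof (induction b rule: mpoly_induct)
      case 1
      show ?case by (simp add: T_0)
    next
      case (2 v d)
      show ?case
        by (simp add: monom_of_power mult_single T_monom trace_monomial_shift scalar_mult_def
            mod_ring_power_card flip: mult.assoc)
    next
      case (3 g h)
      then show ?case by (simp add: T_add distrib_left)
    qed
  next
    case (3 g h)
    then show ?case by (simp add: mpoly_frobenius_add distrib_right T_add)
  qed
  have unique: "\<phi> = T"
    if near: "near_splitting CARD('p) \<phi>"
      and mon: "\<forall>e. \<phi> (monom_of e 1) = trace_monomial CARD('p) e" for \<phi>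
  proof
    fix g
    have add: "\<phi> (a + b) = \<phi> a + \<phi> b" and mult: "\<phi> (a ^ CARD('p) * b) = a * \<phi> b" for a b
      using near by (simp_all add: near_splitting_def)
    show "\<phi> g = T g"
    proof (induction g rule: mpoly_induct)
      case 1
      have "\<phi> (0 + 0) = \<phi> 0 + \<phi> 0"
        by (rule add)
      then show ?case by (simp add: T_0)
    next
      case (2 e c)
      have "monom_of e c = monom_of 0 c ^ CARD('p) * monom_of e 1"
        by (simp add: monom_of_power mult_single mod_ring_power_card)
      then have "\<phi> (monom_of e c) = monom_of 0 c * trace_monomial CARD('p) e"
        using mon by (simp only: mult)
      then show ?case by (simp add: T_monom scalar_mult_def)
    next
      case (3 g h)
      then show ?case by (simp add: add T_add)
    qed
  qed
  show ?thesis
    by (rule ex1I[of _ T])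
      (auto simp: near_splitting_def T_add T_near T_monom unique)
qed

end

theory Submission
  imports Defs
begin

text \<open>
  \<^bold>\<open>The trace.\<close> On coefficients \<open>Tr\<close> is very explicit
  (\<open>coeff_Tr\<close>): the coefficient of \<open>Tr g\<close> at \<open>u\<close> is the coefficient of
  \<open>g\<close> at \<open>p u + (p - 1) (1, \<dots>, 1)\<close>. If \<open>deg f \<le> n\<close>, then
  \<open>\<phi> = Tr (f\<^bsup>p-1\<^esup> \<bullet>)\<close> therefore divides degree bounds by
  \<open>p\<close>, and if \<open>(1, \<dots>, 1)\<close> is a term of the leading form of \<open>f\<close>,
  it divides weight bounds by \<open>p\<close> as well, its effect on the top weight being that of
  \<open>\<phi>' = Tr (init f\<^bsup>p-1\<^esup> \<bullet>)\<close>. In particular \<open>Tr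
  (f\<^bsup>p-1\<^esup>)\<close> is a constant, namely one coefficient of \<open>f\<^bsup>p-1\<^esup>\<close>;
  it vanishes if \<open>(1, \<dots>, 1)\<close> is not in the Newton polytope, and it agrees with that of
  \<open>init f\<close>. All that is used afterwards are the properties collected in the locale
  \<open>degeneration\<close>.

  \<^bold>\<open>Degenerating compatibly split ideals.\<close> The identity \<open>\<phi>' (init g) \<in> {0,
  init (\<phi> g)}\<close> shows that \<open>init\<close> maps compatibly split ideals to compatibly split
  ideals. These are radical, which forces \<open>init (I \<inter> J) = init I \<inter> init J\<close> and from
  this, by cancelling leading forms, that an ideal containing \<open>init I\<close> and \<open>init J\<close>
  contains \<open>init (I + J)\<close> as well (\<open>init_plus_subset\<close>). Hence for a prime
  \<open>P'\<close> there is a largest compatibly split ideal \<open>lift P'\<close> whose initial ideal lies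
  in \<open>P'\<close>. It is prime, because for an ideal quotient \<open>B = (K : a)\<close> of a compatibly
  split \<open>K\<close> and \<open>A = (K : B)\<close> one has \<open>A \<inter> B = K\<close>. So
  \<open>lift\<close> is the map \<open>\<pi>\<close> of the theorem.

  \<^bold>\<open>Surjectivity and the order.\<close> Since \<open>\<phi>\<close> contracts degrees, a
  compatibly split ideal is determined by its elements of degree at most \<open>n\<close>; there are only
  finitely many such ideals, and primes can be produced as maximal elements
  (\<open>prime_avoiding_exists\<close>). Given a compatibly split prime \<open>Y\<close> with \<open>init Y
  \<subseteq> P'\<close>, a prime \<open>Q\<close> between \<open>init Y\<close> and \<open>P'\<close> with
  \<open>lift Q = Y\<close> is a maximal compatibly split ideal that contains no \<open>init J \<inter>
  L\<close> with \<open>J\<close> strictly larger than \<open>Y\<close> and \<open>L\<close> not contained in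
  \<open>P'\<close>. What has to be excluded is \<open>init J \<inter> L \<subseteq> init Y\<close>.
  Geometrically, the families degenerating \<open>J\<close> and \<open>Y\<close> would then have the same
  special fibre near the generic point of \<open>P'\<close>, so by Nakayama's lemma and flatness they would
  agree there, whereas \<open>Y\<close> is prime. The algebraic version is \<open>leading_annihilator\<close>,
  whose finiteness input is the ascending chain condition. That condition comes from taking initial ideals for
  all coordinates in turn, which reduces it to monomial ideals and Dickson's lemma.

  \<^bold>\<open>Degrees.\<close> If \<open>f\<close> is homogeneous, then \<open>\<phi>\<close> and
  \<open>\<phi>'\<close> are graded, and compatibly split ideals are then homogeneous
  (\<open>graded_compatibly_split\<close>). Over a finite field dimensions can be computed by counting
  elements. Noetherian induction gives Hilbert polynomials and shows that the Krull dimension of a homogeneous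
  prime is one more than the degree of its Hilbert polynomial, the zero polynomial having degree
  \<open>-1\<close> (\<open>variety_dim_cone\<close>). An ideal \<open>Y\<close> and \<open>init Y\<close>
  have the same Hilbert function, and \<open>init Y\<close> is the intersection of its minimal primes, so the
  degree of \<open>Y\<close> is the sum of the degrees of the minimal primes \<open>Q\<close> of \<open>init
  Y\<close> of full dimension. These are exactly the \<open>Q\<close> with \<open>lift Q = Y\<close> and
  \<open>dim Q = dim Y\<close>: if \<open>lift Q\<close> were strictly larger than \<open>Y\<close>, its
  dimension, and hence that of its initial ideal, would be smaller than the dimension of \<open>Q\<close>,
  which contains that initial ideal.
\<close>

section \<open>Ideals\<close>

text \<open>
  Element-wise forms of the ideals and prime ideals of the ring given by a type; see
  \<open>ideal_iff_is_ideal\<close> and \<open>primeideal_iff_is_prime\<close> for the locale versions.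
\<close>

definition is_ideal :: "'r::comm_ring_1 set \<Rightarrow> bool" where
  "is_ideal I \<longleftrightarrow> 0 \<in> I \<and> (\<forall>a\<in>I. \<forall>b\<in>I. a + b \<in> I) \<and> (\<forall>a\<in>I. \<forall>r. r * a \<in> I)"

definition is_prime :: "'r::comm_ring_1 set \<Rightarrow> bool" where
  "is_prime P \<longleftrightarrow> is_ideal P \<and> 1 \<notin> P \<and> (\<forall>a b. a * b \<in> P \<longrightarrow> a \<in> P \<or> b \<in> P)"

lemma is_idealI:
  assumes "0 \<in> I" "\<And>a b. a \<in> I \<Longrightarrow> b \<in> I \<Longrightarrow> a + b \<in> I" "\<And>a r. a \<in> I \<Longrightarrow> r * a \<in> I"
  shows "is_ideal I"
  using assms by (auto simp: is_ideal_def)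

lemma ideal_zero: "is_ideal I \<Longrightarrow> 0 \<in> I"
  and ideal_add: "is_ideal I \<Longrightarrow> a \<in> I \<Longrightarrow> b \<in> I \<Longrightarrow> a + b \<in> I"
  and ideal_mult: "is_ideal I \<Longrightarrow> a \<in> I \<Longrightarrow> r * a \<in> I"
  and ideal_mult_right: "is_ideal I \<Longrightarrow> a \<in> I \<Longrightarrow> a * r \<in> I"
  by (auto simp: is_ideal_def mult.commute)

lemma ideal_uminus: "is_ideal I \<Longrightarrow> a \<in> I \<Longrightarrow> - a \<in> I"
  using ideal_mult[of I a "-1"] by simp

lemma ideal_diff: "is_ideal I \<Longrightarrow> a \<in> I \<Longrightarrow> b \<in> I \<Longrightarrow> a - b \<in> I"
  using ideal_add[of I a "-b"] ideal_uminus[of I b] by simp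

lemma ideal_sum: "is_ideal I \<Longrightarrow> (\<And>x. x \<in> A \<Longrightarrow> g x \<in> I) \<Longrightarrow> sum g A \<in> I"
  by (induction A rule: infinite_finite_induct) (auto intro: ideal_zero ideal_add)

lemma ideal_one: "is_ideal I \<Longrightarrow> 1 \<in> I \<Longrightarrow> I = UNIV"
  using ideal_mult[of I 1] by auto

lemma ideal_UNIV: "is_ideal UNIV"
  by (simp add: is_ideal_def)

lemma ideal_Int: "is_ideal I \<Longrightarrow> is_ideal J \<Longrightarrow> is_ideal (I \<inter> J)"
  by (auto simp: is_ideal_def)

lemma prime_ideal: "is_prime P \<Longrightarrow> is_ideal P"
  and prime_one: "is_prime P \<Longrightarrow> 1 \<notin> P"
  and prime_mult: "is_prime P \<Longrightarrow> a * b \<in> P \<Longrightarrow> a \<in> P \<or> b \<in> P"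
  by (auto simp: is_prime_def)

lemma prime_power: "is_prime P \<Longrightarrow> a ^ k \<in> P \<Longrightarrow> a \<in> P"
  by (induction k) (auto dest: prime_one prime_mult)

lemma prime_Int_subset:
  assumes "is_prime P" "is_ideal I" "is_ideal J" "I \<inter> J \<subseteq> P"
  shows "I \<subseteq> P \<or> J \<subseteq> P"
proof (rule ccontr)
  assume "\<not> ?thesis"
  then obtain a b where "a \<in> I" "a \<notin> P" "b \<in> J" "b \<notin> P" by auto
  moreover from this have "a * b \<in> I \<inter> J"
    using assms ideal_mult ideal_mult_right by blast
  ultimately show False using assms prime_mult by blast
qed

lemma prime_Inter_subset:
  assumes "is_prime P" "finite \<Q>" "\<And>Q. Q \<in> \<Q> \<Longrightarrow> is_ideal Q" "\<Inter>\<Q> \<subseteq> P"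
  shows "\<exists>Q\<in>\<Q>. Q \<subseteq> P"
  using assms(2,3,4)
proof (induction \<Q>)
  case empty
  then show ?case using prime_one[OF assms(1)] by auto
next
  case (insert Q \<Q>)
  have "is_ideal (\<Inter>\<Q>)"
    using insert.prems(1) by (auto simp: is_ideal_def)
  then have "Q \<subseteq> P \<or> \<Inter>\<Q> \<subseteq> P"
    using prime_Int_subset[OF assms(1), of Q "\<Inter>\<Q>"] insert.prems by auto
  then show ?case using insert by auto
qed

lemma ideal_iff_is_ideal: "ideal I ring_of_type_algebra \<longleftrightarrow> is_ideal I"
proof
  assume "ideal I ring_of_type_algebra"
  then interpret ideal I ring_of_type_algebra .
  show "is_ideal I"
    using additive_subgroup.zero_closed[OF is_additive_subgroup]
      additive_subgroup.a_closed[OF is_additive_subgroup] I_l_closed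
    by (auto simp: is_ideal_def ring_of_type_algebra_def)
next
  assume I: "is_ideal I"
  interpret cring "ring_of_type_algebra :: 'a ring"
    by (rule cring_from_type_algebra)
  show "ideal I ring_of_type_algebra"
  proof (rule idealI)
    show "subgroup I (add_monoid (ring_of_type_algebra :: 'a ring))"
    proof (rule group.subgroupI)
      show "group (add_monoid (ring_of_type_algebra :: 'a ring))"
        by (rule add.is_group)
      fix a :: 'a assume "a \<in> I"
      moreover have "\<ominus>\<^bsub>ring_of_type_algebra\<^esub> a = - a"
        by (rule sum_zero_eq_neg[symmetric]) (auto simp: ring_of_type_algebra_def)
      ultimately show "inv\<^bsub>add_monoid ring_of_type_algebra\<^esub> a \<in> I"
        unfolding a_inv_def using ideal_uminus[OF I] by metis
      fix b assume "b \<in> I"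
      with \<open>a \<in> I\<close> show "a \<otimes>\<^bsub>add_monoid ring_of_type_algebra\<^esub> b \<in> I"
        using ideal_add[OF I] by (simp add: ring_of_type_algebra_def)
    qed (use ideal_zero[OF I] in \<open>auto simp: ring_of_type_algebra_def\<close>)
  qed (use I ring_from_type_algebra in \<open>auto simp: is_ideal_def ring_of_type_algebra_def mult.commute\<close>)
qed

lemma primeideal_iff_is_prime: "primeideal P ring_of_type_algebra \<longleftrightarrow> is_prime P"
proof
  assume "primeideal P ring_of_type_algebra"
  then interpret primeideal P ring_of_type_algebra .
  have I: "is_ideal P" using is_ideal ideal_iff_is_ideal by blast
  moreover have "1 \<notin> P"
    using I_notcarr ideal_one[OF I] by (auto simp: ring_of_type_algebra_def)
  ultimately show "is_prime P"
    using I_prime by (auto simp: is_prime_def ring_of_type_algebra_def)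
next
  assume P: "is_prime P"
  then have "ideal P ring_of_type_algebra"
    using prime_ideal ideal_iff_is_ideal by blast
  moreover have "cring (ring_of_type_algebra :: 'a ring)"
    by (rule cring_from_type_algebra)
  ultimately show "primeideal P ring_of_type_algebra"
    using P by (intro primeidealI) (auto simp: is_prime_def ring_of_type_algebra_def)
qed

definition ideal_plus :: "'r::comm_ring_1 set \<Rightarrow> 'r set \<Rightarrow> 'r set" where
  "ideal_plus I J = {a + b |a b. a \<in> I \<and> b \<in> J}"

text \<open>
  The ideal quotient \<open>(I : S)\<close>. Its importance here is that it inherits compatible splitting from
  \<open>I\<close>, which makes it possible to detect primes without leaving the compatibly split ideals.
\<close>

definition colon :: "'r::comm_ring_1 set \<Rightarrow> 'r set \<Rightarrow> 'r set" where
  "colon I S = {x. \<forall>s\<in>S. x * s \<in> I}"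

lemma ideal_ideal_plus:
  assumes "is_ideal I" "is_ideal J"
  shows "is_ideal (ideal_plus I J)"
proof (rule is_idealI)
  show "0 \<in> ideal_plus I J"
    using assms by (auto simp: ideal_plus_def intro!: exI[of _ 0] ideal_zero)
next
  fix x y assume "x \<in> ideal_plus I J" "y \<in> ideal_plus I J"
  then obtain a b c d where "x = a + b" "y = c + d" "a \<in> I" "b \<in> J" "c \<in> I" "d \<in> J"
    by (auto simp: ideal_plus_def)
  then have "x + y = (a + c) + (b + d)" "a + c \<in> I" "b + d \<in> J"
    using assms by (auto intro: ideal_add)
  then show "x + y \<in> ideal_plus I J" unfolding ideal_plus_def by blast
next
  fix x r assume "x \<in> ideal_plus I J"
  then show "r * x \<in> ideal_plus I J"
    using assms by (fastforce simp: ideal_plus_def distrib_left intro: ideal_mult)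
qed

lemma ideal_plus_left: "is_ideal J \<Longrightarrow> I \<subseteq> ideal_plus I J"
  and ideal_plus_right: "is_ideal I \<Longrightarrow> J \<subseteq> ideal_plus I J"
  unfolding ideal_plus_def using ideal_zero by (force, force)

lemma ideal_colon: "is_ideal I \<Longrightarrow> is_ideal (colon I S)"
  by (auto simp: is_ideal_def colon_def distrib_right mult.assoc)

lemma colon_superset: "is_ideal I \<Longrightarrow> I \<subseteq> colon I S"
  by (auto simp: colon_def ideal_mult_right)

definition principal_ideal :: "'r::comm_ring_1 \<Rightarrow> 'r set" where
  "principal_ideal a = range (\<lambda>r. r * a)"

lemma ideal_principal: "is_ideal (principal_ideal a)"
proof (rule is_idealI)
  show "0 \<in> principal_ideal a" unfolding principal_ideal_def by (rule range_eqI[of _ _ 0]) simp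
next
  fix x y assume "x \<in> principal_ideal a" "y \<in> principal_ideal a"
  then obtain r s where "x = r * a" "y = s * a" by (auto simp: principal_ideal_def)
  then have "x + y = (r + s) * a" by (simp add: distrib_right)
  then show "x + y \<in> principal_ideal a" by (auto simp: principal_ideal_def)
next
  fix x r assume "x \<in> principal_ideal a"
  then show "r * x \<in> principal_ideal a" by (auto simp: principal_ideal_def simp flip: mult.assoc)
qed

lemma principal_self: "a \<in> principal_ideal a"
  unfolding principal_ideal_def by (rule range_eqI[of _ _ 1]) simp

section \<open>Weights\<close>

lemma weight_zero [simp]: "weight w 0 = 0"
  by (simp add: weight_def)

lemma weight_add [simp]: "weight w (e + e') = weight w e + weight w e'"
  by (simp add: weight_def lookup_add distrib_left sum.distrib)

definition component ::
  "('n::finite \<Rightarrow> nat) \<Rightarrow> nat \<Rightarrow> ('n, 'k::comm_monoid_add) mpoly \<Rightarrow> ('n, 'k) mpoly" where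
  "component w d g = (\<Sum>e | e \<in> Poly_Mapping.keys g \<and> weight w e = d. monom_of e (coeff_of g e))"

definition weight_le :: "('n::finite \<Rightarrow> nat) \<Rightarrow> nat \<Rightarrow> ('n, 'k::zero) mpoly \<Rightarrow> bool" where
  "weight_le w c g \<longleftrightarrow> (\<forall>e\<in>Poly_Mapping.keys g. weight w e \<le> c)"

definition weight_homogeneous :: "('n::finite \<Rightarrow> nat) \<Rightarrow> nat \<Rightarrow> ('n, 'k::zero) mpoly \<Rightarrow> bool" where
  "weight_homogeneous w c g \<longleftrightarrow> (\<forall>e\<in>Poly_Mapping.keys g. weight w e = c)"

lemma homogeneous_component_eq: "homogeneous_component d g = component (\<lambda>_. 1) d g"
  by (simp add: homogeneous_component_def component_def)

lemma homogeneous_of_degree_eq: "homogeneous_of_degree d g = weight_homogeneous (\<lambda>_. 1) d g"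
  by (simp add: homogeneous_of_degree_def weight_homogeneous_def)

lemma coeff_sum_monoms:
  "finite A \<Longrightarrow> coeff_of (\<Sum>e\<in>A. monom_of e (c e)) u = (if u \<in> A then c u else 0)"
  by (simp add: lookup_sum lookup_single when_def)

lemma coeff_component: "coeff_of (component w d g) e = (if weight w e = d then coeff_of g e else 0)"
  unfolding component_def by (subst coeff_sum_monoms) (auto simp: in_keys_iff)

lemma keys_component: "Poly_Mapping.keys (component w d g) = {e\<in>Poly_Mapping.keys g. weight w e = d}"
  by (auto simp: in_keys_iff coeff_component split: if_splits)

lemma component_add: "component w d (g + h) = component w d g + component w d h"
  by (intro poly_mapping_eqI) (simp add: coeff_component lookup_add)

lemma component_zero [simp]: "component w d 0 = 0"
  by (intro poly_mapping_eqI) (simp add: coeff_component)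

lemma component_diff: "component w d (g - h) = component w d g - component w d (h :: ('n::finite, 'k::ab_group_add) mpoly)"
  by (intro poly_mapping_eqI) (simp add: coeff_component lookup_minus)

lemma component_sum: "component w d (sum g A) = (\<Sum>x\<in>A. component w d (g x))"
  by (induction A rule: infinite_finite_induct) (auto simp: component_add)

lemma component_monom:
  "component w d (monom_of e c) = (if weight w e = d then monom_of e c else 0)"
  by (intro poly_mapping_eqI) (auto simp: coeff_component lookup_single when_def)

lemma component_component:
  "component w d (component v d' g) = component v d' (component w d g)"
  by (intro poly_mapping_eqI) (simp add: coeff_component)

lemma component_same: "component w d (component w d' g) = (if d = d' then component w d g else 0)"
  by (intro poly_mapping_eqI) (auto simp: coeff_component)

lemma weight_le_mono: "weight_le w c g \<Longrightarrow> c \<le> d \<Longrightarrow> weight_le w d g"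
  by (force simp: weight_le_def)

lemma weight_le_exists: "\<exists>c. weight_le w c g"
proof
  show "weight_le w (Max (insert 0 (weight w ` Poly_Mapping.keys g))) g"
    by (auto simp: weight_le_def)
qed

lemma weight_le_zero [simp]: "weight_le w c 0"
  by (simp add: weight_le_def)

lemma weight_le_one [simp]: "weight_le w c (1 :: ('n::finite, 'k::comm_ring_1) mpoly)"
  by (simp add: weight_le_def)

lemma weight_le_add: "weight_le w c g \<Longrightarrow> weight_le w c h \<Longrightarrow> weight_le w c (g + h)"
  using Poly_Mapping.keys_add[of g h] by (auto simp: weight_le_def)

lemma weight_le_uminus: "weight_le w c g \<Longrightarrow> weight_le w c (- (g :: ('n::finite, 'k::ab_group_add) mpoly))"
  by (auto simp: weight_le_def in_keys_iff)

lemma weight_le_diff: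
  "weight_le w c g \<Longrightarrow> weight_le w c h \<Longrightarrow> weight_le w c (g - (h :: ('n::finite, 'k::ab_group_add) mpoly))"
  using weight_le_add[of w c g "- h"] weight_le_uminus[of w c h] by simp

lemma weight_le_sum: "(\<And>x. x \<in> A \<Longrightarrow> weight_le w c (g x)) \<Longrightarrow> weight_le w c (sum g A)"
  by (induction A rule: infinite_finite_induct) (auto intro: weight_le_add)

lemma weight_le_mult:
  assumes "weight_le w c g" "weight_le w d h"
  shows "weight_le w (c + d) (g * h)"
  unfolding weight_le_def
proof
  fix e assume "e \<in> Poly_Mapping.keys (g * h)"
  then obtain a b where "e = a + b" "a \<in> Poly_Mapping.keys g" "b \<in> Poly_Mapping.keys h"
    using keys_mult[of g h] by auto
  then show "weight w e \<le> c + d" using assms by (auto simp: weight_le_def intro: add_mono)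
qed

lemma weight_le_power:
  "weight_le w c (g :: ('n::finite, 'k::comm_ring_1) mpoly) \<Longrightarrow> weight_le w (k * c) (g ^ k)"
  by (induction k) (auto intro: weight_le_mult)

lemma weight_homogeneous_iff: "weight_homogeneous w d g \<longleftrightarrow> component w d g = g"
proof
  assume "weight_homogeneous w d g"
  then show "component w d g = g"
    by (intro poly_mapping_eqI) (auto simp: coeff_component weight_homogeneous_def in_keys_iff)
next
  assume "component w d g = g"
  then have "Poly_Mapping.keys g = {e\<in>Poly_Mapping.keys g. weight w e = d}"
    using keys_component[of w d g] by simp
  then show "weight_homogeneous w d g" by (auto simp: weight_homogeneous_def)
qed

lemma weight_homogeneous_component [simp]: "weight_homogeneous w d (component w d g)"
  by (simp add: weight_homogeneous_def keys_component)

lemma weight_homogeneous_le: "weight_homogeneous w d g \<Longrightarrow> weight_le w d g"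
  by (simp add: weight_homogeneous_def weight_le_def)

lemma weight_le_component: "weight_le w d (component w d g)"
  by (simp add: weight_homogeneous_le)

lemma weight_le_component': "weight_le v c g \<Longrightarrow> weight_le v c (component w d g)"
  by (auto simp: weight_le_def keys_component)

lemma weight_homogeneous_mult:
  assumes "weight_homogeneous w c g" "weight_homogeneous w d h"
  shows "weight_homogeneous w (c + d) (g * h)"
  unfolding weight_homogeneous_def
proof
  fix e assume "e \<in> Poly_Mapping.keys (g * h)"
  then obtain a b where "e = a + b" "a \<in> Poly_Mapping.keys g" "b \<in> Poly_Mapping.keys h"
    using keys_mult[of g h] by auto
  then show "weight w e = c + d" using assms by (auto simp: weight_homogeneous_def)
qed

lemma weight_homogeneous_power:
  "weight_homogeneous w c (g :: ('n::finite, 'k::comm_ring_1) mpoly) \<Longrightarrow> weight_homogeneous w (k * c) (g ^ k)"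
  by (induction k) (auto intro: weight_homogeneous_mult simp: weight_homogeneous_def[of w 0])

lemma component_other: "weight_homogeneous w d g \<Longrightarrow> component w d' g = (if d = d' then g else 0)"
  by (auto simp: weight_homogeneous_def coeff_component in_keys_iff intro!: poly_mapping_eqI)

lemma sum_components:
  assumes "weight_le w c g"
  shows "g = (\<Sum>d\<le>c. component w d g)"
proof (rule poly_mapping_eqI)
  fix e
  show "coeff_of g e = coeff_of (\<Sum>d\<le>c. component w d g) e"
    using assms by (auto simp: lookup_sum coeff_component weight_le_def in_keys_iff)
qed

lemma component_eq_0: "weight_le w c g \<Longrightarrow> d > c \<Longrightarrow> component w d g = 0"
  by (intro poly_mapping_eqI) (force simp: coeff_component weight_le_def in_keys_iff)

lemma weight_le_pred:
  assumes "weight_le w (Suc c) g" "component w (Suc c) g = 0"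
  shows "weight_le w c g"
  unfolding weight_le_def
proof
  fix e assume e: "e \<in> Poly_Mapping.keys g"
  have "weight w e \<noteq> Suc c"
    using e assms(2) keys_component[of w "Suc c" g] by auto
  with e assms(1) show "weight w e \<le> c" by (force simp: weight_le_def)
qed

lemma component_mult:
  fixes g h :: "('n::finite, 'k::comm_ring_1) mpoly"
  shows "component w d (g * h) = (\<Sum>i\<le>d. component w i g * component w (d - i) h)"
proof (induction g rule: mpoly_induct)
  case 1 then show ?case by simp
next
  case (2 e c)
  show ?case
  proof (induction h rule: mpoly_induct)
    case 1 then show ?case by simp
  next
    case (2 e' c')
    have "(\<Sum>i\<le>d. component w i (monom_of e c) * component w (d - i) (monom_of e' c'))
       = (\<Sum>i\<le>d. if i = weight w e then monom_of e c * component w (d - i) (monom_of e' c') else 0)"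
      by (intro sum.cong) (auto simp: component_monom)
    also have "\<dots> = (if weight w e \<le> d then monom_of e c * component w (d - weight w e) (monom_of e' c') else 0)"
      by simp
    also have "\<dots> = component w d (monom_of e c * monom_of e' c')"
      by (auto simp: component_monom mult_single)
    finally show ?case by simp
  next
    case (3 h h')
    then show ?case by (simp add: distrib_left component_add sum.distrib)
  qed
next
  case (3 g g')
  then show ?case by (simp add: distrib_right component_add sum.distrib)
qed

lemma component_mult_homogeneous:
  fixes g h :: "('n::finite, 'k::comm_ring_1) mpoly"
  assumes "weight_homogeneous w a g"
  shows "component w (a + b) (g * h) = g * component w b h"
proof -
  have "component w (a + b) (g * h) = (\<Sum>i\<le>a+b. if i = a then g * component w (a + b - i) h else 0)"
    unfolding component_mult by (intro sum.cong) (auto simp: component_other[OF assms])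
  then show ?thesis by simp
qed

text \<open>
  This replaces the multiplicativity of leading forms: naming the weight in which the top component
  is taken avoids all case distinctions about components that vanish.
\<close>

lemma component_mult_top:
  fixes g h :: "('n::finite, 'k::comm_ring_1) mpoly"
  assumes "weight_le w a g" "weight_le w b h"
  shows "component w (a + b) (g * h) = component w a g * component w b h"
proof -
  have "component w (a + b) (g * h) =
      (\<Sum>i\<le>a+b. if i = a then component w a g * component w b h else 0)"
    unfolding component_mult
  proof (intro sum.cong refl)
    fix i assume "i \<in> {..a+b}"
    then consider "i = a" | "i > a" | "a + b - i > b" by force
    then show "component w i g * component w (a + b - i) h =
        (if i = a then component w a g * component w b h else 0)"
      by cases (use component_eq_0[OF assms(1)] component_eq_0[OF assms(2)] in auto)
  qed
  then show ?thesis by simp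
qed

lemma component_power_top:
  fixes g :: "('n::finite, 'k::comm_ring_1) mpoly"
  assumes "weight_le w a g"
  shows "component w (k * a) (g ^ k) = component w a g ^ k"
proof (induction k)
  case 0
  have "weight_homogeneous w 0 (1 :: ('n, 'k) mpoly)" by (simp add: weight_homogeneous_def)
  then show ?case by (simp add: weight_homogeneous_iff)
next
  case (Suc k)
  then show ?case
    using component_mult_top[OF assms weight_le_power[OF assms, of k]] by simp
qed

definition graded :: "('n::finite \<Rightarrow> nat) \<Rightarrow> ('n, 'k::comm_monoid_add) mpoly set \<Rightarrow> bool" where
  "graded w I \<longleftrightarrow> (\<forall>g\<in>I. \<forall>d. component w d g \<in> I)"

lemma is_cone_iff_graded: "is_cone I \<longleftrightarrow> graded (\<lambda>_. 1) I"
  by (simp add: is_cone_def graded_def homogeneous_component_eq)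

lemma graded_not_subset:
  assumes "graded w I" "is_ideal J" "\<not> I \<subseteq> J"
  shows "\<exists>s\<in>I. \<exists>d. weight_homogeneous w d s \<and> s \<notin> J"
proof -
  obtain g where g: "g \<in> I" "g \<notin> J" using assms(3) by auto
  obtain c where c: "weight_le w c g" using weight_le_exists by blast
  have "\<exists>d. component w d g \<notin> J"
    using sum_components[OF c] g(2) ideal_sum[OF assms(2), of "{..c}" "\<lambda>d. component w d g"] by auto
  then show ?thesis using g(1) assms(1) weight_homogeneous_component unfolding graded_def by blast
qed

section \<open>Initial ideals\<close>

lemma leading_form_eq_component:
  fixes g :: "('n::finite, 'k::comm_monoid_add) mpoly"
  assumes "weight_le w d g" "component w d g \<noteq> 0"
  shows "leading_form w g = component w d g"
proof -
  have "Poly_Mapping.keys (component w d g) \<noteq> {}"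
    using assms(2) by simp
  then obtain e0 where "e0 \<in> Poly_Mapping.keys g" "weight w e0 = d"
    by (auto simp: keys_component)
  then have "{e \<in> Poly_Mapping.keys g. \<forall>e'\<in>Poly_Mapping.keys g. weight w e' \<le> weight w e} =
      {e \<in> Poly_Mapping.keys g. weight w e = d}"
    using assms(1) by (force simp: weight_le_def)
  then show ?thesis by (simp add: leading_form_def component_def)
qed

lemma leading_form_component:
  fixes g :: "('n::finite, 'k::comm_monoid_add) mpoly"
  obtains d where "weight_le w d g" "leading_form w g = component w d g"
proof (cases "g = 0")
  case True
  then show ?thesis using that[of 0] by (simp add: leading_form_def)
next
  case False
  define d where "d = Max (weight w ` Poly_Mapping.keys g)"
  have "weight_le w d g" by (auto simp: weight_le_def d_def)
  moreover have "d \<in> weight w ` Poly_Mapping.keys g"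
    unfolding d_def using False by (intro Max_in) auto
  then have "Poly_Mapping.keys (component w d g) \<noteq> {}" by (auto simp: keys_component)
  then have "component w d g \<noteq> 0" by auto
  ultimately show ?thesis using that leading_form_eq_component by blast
qed

lemma ideal_scalar_mult: "is_ideal I \<Longrightarrow> x \<in> I \<Longrightarrow> scalar_mult c x \<in> I"
  by (simp add: scalar_mult_def ideal_mult)

lemma component_scalar_mult:
  "component w d (scalar_mult c (g :: ('n::finite, 'k::field) mpoly)) = scalar_mult c (component w d g)"
  using component_mult_homogeneous[of w 0 "monom_of 0 c" d g]
  by (simp add: scalar_mult_def weight_homogeneous_def)

lemma weight_le_scalar_mult:
  "weight_le w d (g :: ('n::finite, 'k::field) mpoly) \<Longrightarrow> weight_le w d (scalar_mult c g)"
  using weight_le_mult[of w 0 "monom_of 0 c" d g] by (simp add: scalar_mult_def weight_le_def)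

text \<open>
  The working description of initial ideals. A sum of leading forms of different weights is handled
  one weight at a time, and within one weight the leading forms, together with \<open>0\<close>, are closed under
  sums. Allowing \<open>component w d g = 0\<close> is what makes each weight a subspace.
\<close>

lemma mem_init_ideal:
  fixes I :: "('n::finite, 'k::field) mpoly set"
  assumes I: "is_ideal I"
  shows "x \<in> init_ideal w I \<longleftrightarrow>
    (\<forall>d. \<exists>g\<in>I. weight_le w d g \<and> component w d g = component w d x)"
proof
  define S where "S = {x. \<forall>d. \<exists>g\<in>I. weight_le w d g \<and> component w d g = component w d x}"
  have "mpoly_vs.subspace S"
    unfolding mpoly_vs.subspace_def
  proof (intro conjI ballI allI)
    show "0 \<in> S" unfolding S_def using ideal_zero[OF I] by (auto intro!: bexI[of _ 0])
  next
    fix x y assume x: "x \<in> S" and y: "y \<in> S"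
    show "x + y \<in> S" unfolding S_def
    proof (intro CollectI allI)
      fix d
      obtain g h where "g \<in> I" "weight_le w d g" "component w d g = component w d x"
        "h \<in> I" "weight_le w d h" "component w d h = component w d y"
        using x y unfolding S_def by blast
      then show "\<exists>g\<in>I. weight_le w d g \<and> component w d g = component w d (x + y)"
        by (intro bexI[of _ "g + h"]) (auto simp: component_add weight_le_add ideal_add[OF I])
    qed
  next
    fix c x assume x: "x \<in> S"
    show "scalar_mult c x \<in> S" unfolding S_def
    proof (intro CollectI allI)
      fix d
      obtain g where "g \<in> I" "weight_le w d g" "component w d g = component w d x"
        using x unfolding S_def by blast
      then show "\<exists>g\<in>I. weight_le w d g \<and> component w d g = component w d (scalar_mult c x)"
        by (intro bexI[of _ "scalar_mult c g"])
          (auto simp: component_scalar_mult weight_le_scalar_mult ideal_scalar_mult[OF I])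
    qed
  qed
  moreover have "leading_form w ` I \<subseteq> S"
  proof
    fix x assume "x \<in> leading_form w ` I"
    then obtain g where g: "g \<in> I" "x = leading_form w g" by auto
    then obtain c where c: "weight_le w c g" "x = component w c g"
      using leading_form_component by metis
    show "x \<in> S" unfolding S_def
    proof (intro CollectI allI)
      fix d
      show "\<exists>g\<in>I. weight_le w d g \<and> component w d g = component w d x"
        unfolding c(2) using g(1) c(1) ideal_zero[OF I]
        by (cases "d = c") (auto simp: component_same intro: bexI[of _ g] bexI[of _ 0])
    qed
  qed
  ultimately have "init_ideal w I \<subseteq> S"
    unfolding init_ideal_def by (rule mpoly_vs.span_minimal[rotated])
  then show "x \<in> init_ideal w I \<Longrightarrow>
      (\<forall>d. \<exists>g\<in>I. weight_le w d g \<and> component w d g = component w d x)"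
    by (auto simp: S_def)
next
  assume x: "\<forall>d. \<exists>g\<in>I. weight_le w d g \<and> component w d g = component w d x"
  obtain c where c: "weight_le w c x" using weight_le_exists by blast
  have "component w d x \<in> init_ideal w I" for d
  proof (cases "component w d x = 0")
    case True
    then show ?thesis by (simp add: init_ideal_def mpoly_vs.span_zero)
  next
    case False
    obtain g where "g \<in> I" "weight_le w d g" "component w d g = component w d x"
      using x by blast
    moreover from this have "leading_form w g = component w d x"
      using False leading_form_eq_component by metis
    ultimately show ?thesis
      unfolding init_ideal_def by (metis imageI mpoly_vs.span_base)
  qed
  then show "x \<in> init_ideal w I"
    by (subst sum_components[OF c]) (auto simp: init_ideal_def intro: mpoly_vs.span_sum)
qed

lemma component_in_init:
  fixes I :: "('n::finite, 'k::field) mpoly set"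
  assumes "is_ideal I" "g \<in> I" "weight_le w d g"
  shows "component w d g \<in> init_ideal w I"
  unfolding mem_init_ideal[OF assms(1)]
proof
  fix d'
  show "\<exists>h\<in>I. weight_le w d' h \<and> component w d' h = component w d' (component w d g)"
    using assms ideal_zero[OF assms(1)]
    by (cases "d' = d") (auto simp: component_same intro: bexI[of _ g] bexI[of _ 0])
qed

lemma init_homogeneous_obtains:
  fixes I :: "('n::finite, 'k::field) mpoly set"
  assumes "is_ideal I" "x \<in> init_ideal w I" "weight_homogeneous w d x"
  obtains g where "g \<in> I" "weight_le w d g" "component w d g = x"
  using assms mem_init_ideal[OF assms(1)] by (metis weight_homogeneous_iff)

lemma init_ideal_mono: "I \<subseteq> J \<Longrightarrow> init_ideal w I \<subseteq> init_ideal w J"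
  unfolding init_ideal_def by (intro mpoly_vs.span_mono image_mono)

text \<open>
  The components of a product \<open>r x\<close> are sums of products of components of \<open>r\<close> and \<open>x\<close>, and
  multiplying by a homogeneous \<open>r\<close> commutes with taking top components. The family \<open>C\<close> may depend on
  the weight, which covers initial ideals as well as the symbols of a filtered chain below.
\<close>

lemma ideal_leading_components:
  fixes C :: "nat \<Rightarrow> ('n::finite, 'k::field) mpoly set"
  assumes zero: "\<And>c. 0 \<in> C c" and add: "\<And>c x y. x \<in> C c \<Longrightarrow> y \<in> C c \<Longrightarrow> x + y \<in> C c"
    and mult: "\<And>b c r x. x \<in> C c \<Longrightarrow> weight_le w b r \<Longrightarrow> r * x \<in> C (b + c)"
  shows "is_ideal {x. \<forall>c. \<exists>y\<in>C c. weight_le w c y \<and> component w c y = component w c x}"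
    (is "is_ideal ?S")
proof (rule is_idealI)
  show "0 \<in> ?S" by (auto intro!: bexI[of _ 0] zero)
next
  fix x x' assume x: "x \<in> ?S" and x': "x' \<in> ?S"
  show "x + x' \<in> ?S"
  proof (intro CollectI allI)
    fix c
    obtain y where y: "y \<in> C c" "weight_le w c y" "component w c y = component w c x"
      using x by blast
    obtain y' where y': "y' \<in> C c" "weight_le w c y'" "component w c y' = component w c x'"
      using x' by blast
    show "\<exists>y\<in>C c. weight_le w c y \<and> component w c y = component w c (x + x')"
      using y y' by (intro bexI[of _ "y + y'"]) (auto simp: component_add weight_le_add add)
  qed
next
  fix x r assume x: "x \<in> ?S"
  show "r * x \<in> ?S"
  proof (intro CollectI allI)
    fix c
    have "\<forall>i. \<exists>y. y \<in> C i \<and> weight_le w i y \<and> component w i y = component w i x"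
      using x by blast
    from choice[OF this] obtain z where
      z': "\<forall>i. z i \<in> C i \<and> weight_le w i (z i) \<and> component w i (z i) = component w i x" ..
    then have z: "z i \<in> C i" "weight_le w i (z i)" "component w i (z i) = component w i x" for i
      by simp_all
    define y where "y = (\<Sum>i\<le>c. component w i r * z (c - i))"
    have sum_mem: "sum g A \<in> C c" if "finite A" "\<And>i. i \<in> A \<Longrightarrow> g i \<in> C c" for g and A :: "nat set"
      using that by (induction A) (simp_all add: zero add)
    have "component w i r * z (c - i) \<in> C c" if "i \<le> c" for i
      using mult[OF z(1)[of "c - i"] weight_le_component[of w i r]] that by simp
    then have "y \<in> C c" unfolding y_def by (intro sum_mem) simp_all
    moreover have "weight_le w c y"
      unfolding y_def
    proof (rule weight_le_sum)
      fix i assume "i \<in> {..c}"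
      then show "weight_le w c (component w i r * z (c - i))"
        using weight_le_mult[OF weight_le_component[of w i r] z(2)[of "c - i"]] by simp
    qed
    moreover have "component w c y = component w c (r * x)"
    proof -
      have "component w c (component w i r * z (c - i)) = component w i r * component w (c - i) x"
        if "i \<le> c" for i
        using component_mult_homogeneous[OF weight_homogeneous_component, of w i "c - i" r "z (c - i)"]
          that z(3) by simp
      then show ?thesis
        unfolding y_def component_sum component_mult[of w c r x] by (intro sum.cong) auto
    qed
    ultimately show "\<exists>y\<in>C c. weight_le w c y \<and> component w c y = component w c (r * x)" by blast
  qed
qed

lemma ideal_init_ideal:
  fixes I :: "('n::finite, 'k::field) mpoly set"
  assumes I: "is_ideal I"
  shows "is_ideal (init_ideal w I)"
proof -
  have "init_ideal w I = {x. \<forall>c. \<exists>g\<in>I. weight_le w c g \<and> component w c g = component w c x}"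
    using mem_init_ideal[OF I] by blast
  then show ?thesis
    using ideal_leading_components[of "\<lambda>_. I" w] ideal_zero[OF I] ideal_add[OF I] ideal_mult[OF I] by simp
qed

lemma graded_init_ideal:
  fixes I :: "('n::finite, 'k::field) mpoly set"
  assumes "is_ideal I"
  shows "graded w (init_ideal w I)"
  unfolding graded_def
proof (intro ballI allI)
  fix x d assume "x \<in> init_ideal w I"
  then obtain g where "g \<in> I" "weight_le w d g" "component w d g = component w d x"
    using mem_init_ideal[OF assms] by blast
  then show "component w d x \<in> init_ideal w I"
    using component_in_init[OF assms, of g w d] by simp
qed

lemma graded_init_ideal_other:
  fixes I :: "('n::finite, 'k::field) mpoly set"
  assumes I: "is_ideal I" and v: "graded v I"
  shows "graded v (init_ideal w I)"
  unfolding graded_def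
proof (intro ballI allI)
  fix x c assume x: "x \<in> init_ideal w I"
  show "component v c x \<in> init_ideal w I"
    unfolding mem_init_ideal[OF I]
  proof
    fix d
    obtain g where "g \<in> I" "weight_le w d g" "component w d g = component w d x"
      using x mem_init_ideal[OF I] by blast
    then show "\<exists>g\<in>I. weight_le w d g \<and> component w d g = component w d (component v c x)"
      using v by (intro bexI[of _ "component v c g"])
        (auto simp: graded_def weight_le_component' component_component)
  qed
qed

text \<open>
  Cancel the leading form of an element of the larger ideal by an element of the smaller one: the
  weight drops at each step, so the element ends up in the smaller ideal.
\<close>

lemma init_ideal_reflects_subset:
  fixes I J :: "('n::finite, 'k::field) mpoly set"
  assumes I: "is_ideal I" and J: "is_ideal J" and "I \<subseteq> J"
    and init: "init_ideal w J \<subseteq> init_ideal w I"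
  shows "J \<subseteq> I"
proof -
  have reduce: "\<exists>h\<in>I. weight_le w c h \<and> component w c h = component w c g"
    if "g \<in> J" "weight_le w c g" for g c
  proof -
    have "component w c g \<in> init_ideal w I"
      using component_in_init[OF J that] init by (rule subsetD[rotated])
    then obtain h where "h \<in> I" "weight_le w c h" "component w c h = component w c g"
      using weight_homogeneous_component by (rule init_homogeneous_obtains[OF I])
    then show ?thesis by auto
  qed
  have drop: "weight_le w c g \<Longrightarrow> g \<in> J \<Longrightarrow> g \<in> I" for c g
  proof (induction c arbitrary: g)
    case 0
    obtain h where h: "h \<in> I" "weight_le w 0 h" "component w 0 h = component w 0 g"
      using reduce[OF 0(2,1)] by blast
    have "g = component w 0 g" by (rule trans[OF sum_components[OF 0(1)]]) simp
    also have "\<dots> = h" unfolding h(3)[symmetric]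
      by (rule sym, rule trans[OF sum_components[OF h(2)]]) simp
    finally show ?case by (simp only: h(1))
  next
    case (Suc c)
    obtain h where h: "h \<in> I" "weight_le w (Suc c) h" "component w (Suc c) h = component w (Suc c) g"
      using reduce[OF Suc.prems(2,1)] by blast
    have "weight_le w c (g - h)"
      using weight_le_diff[OF Suc.prems(1) h(2)] by (rule weight_le_pred) (simp add: component_diff h(3))
    moreover have "g - h \<in> J" using h(1) \<open>I \<subseteq> J\<close> by (intro ideal_diff[OF J Suc.prems(2)]) auto
    ultimately have "g - h \<in> I" by (rule Suc.IH)
    from ideal_add[OF I h(1) this] show ?case by simp
  qed
  show ?thesis
  proof
    fix g assume "g \<in> J"
    obtain c where "weight_le w c g" using weight_le_exists by blast
    from drop[OF this \<open>g \<in> J\<close>] show "g \<in> I" .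
  qed
qed

lemma one_in_init:
  assumes "is_ideal I" "1 \<in> I"
  shows "1 \<in> init_ideal w (I :: ('n::finite, 'k::field) mpoly set)"
proof -
  have "component w 0 (1 :: ('n, 'k) mpoly) = 1"
    using weight_homogeneous_iff[of w 0 "1 :: ('n, 'k) mpoly"] by (simp add: weight_homogeneous_def)
  then show ?thesis using component_in_init[of I 1 w 0] assms by simp
qed

section \<open>The ascending chain condition\<close>

text \<open>
  Pass to subsequences that are monotone in one coordinate after the other.
\<close>

lemma dickson:
  fixes e :: "nat \<Rightarrow> ('n::finite \<Rightarrow>\<^sub>0 nat)"
  shows "\<exists>i j. i < j \<and> (\<forall>x. Poly_Mapping.lookup (e i) x \<le> Poly_Mapping.lookup (e j) x)"
proof -
  have "\<exists>s :: nat \<Rightarrow> nat. strict_mono s \<and>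
      (\<forall>x\<in>A. incseq (\<lambda>i. Poly_Mapping.lookup (e (s i)) x))" if "finite A" for A :: "'n set"
    using that
  proof (induction A)
    case empty
    then show ?case by (auto intro: exI[of _ id] strict_monoI)
  next
    case (insert x A)
    then obtain s :: "nat \<Rightarrow> nat" where s: "strict_mono s" "\<forall>x\<in>A. incseq (\<lambda>i. Poly_Mapping.lookup (e (s i)) x)"
      by blast
    \<comment> \<open>A sequence of natural numbers has a monotone subsequence; if it is decreasing, it is
      eventually constant.\<close>
    obtain t :: "nat \<Rightarrow> nat" where t: "strict_mono t" "monoseq (\<lambda>i. Poly_Mapping.lookup (e (s (t i))) x)"
      using seq_monosub[of "\<lambda>i. Poly_Mapping.lookup (e (s i)) x"] by (auto simp: o_def)
    define a where "a i = Poly_Mapping.lookup (e (s (t i))) x" for i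
    have "\<exists>N. incseq (\<lambda>i. a (i + N))"
    proof (cases "incseq a")
      case True
      then show ?thesis by (auto intro: exI[of _ 0])
    next
      case False
      moreover have "monoseq a" using t(2) unfolding a_def .
      ultimately have dec: "decseq a" by (simp add: monoseq_iff)
      obtain N where N: "\<And>i. a N \<le> a i"
        using ex_has_least_nat[of "\<lambda>_. True" 0 a] by auto
      have "a (i + N) = a N" for i
        using N[of "i + N"] decseqD[OF dec, of N "i + N"] by simp
      then show ?thesis by (auto simp: incseq_def intro: exI[of _ N])
    qed
    then obtain N where N: "incseq (\<lambda>i. a (i + N))" by blast
    define r where "r i = s (t (i + N))" for i
    have mono: "strict_mono (\<lambda>i. t (i + N))"
      using t(1) by (auto simp: strict_mono_def)
    have "strict_mono r"
      using s(1) mono by (auto simp: strict_mono_def r_def)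
    moreover have "incseq (\<lambda>i. Poly_Mapping.lookup (e (r i)) y)" if "y \<in> insert x A" for y
    proof (cases "y = x")
      case True
      then show ?thesis using N by (simp add: r_def a_def)
    next
      case False
      then have "incseq (\<lambda>i. Poly_Mapping.lookup (e (s i)) y)" using that s(2) by auto
      then show ?thesis using strict_mono_less_eq[OF t(1)] by (simp add: r_def incseq_def)
    qed
    ultimately show ?case by blast
  qed
  from this[of UNIV] obtain s :: "nat \<Rightarrow> nat"
    where "strict_mono s" "\<And>x. incseq (\<lambda>i. Poly_Mapping.lookup (e (s i)) x)"
    by auto
  then show ?thesis
    by (intro exI[of _ "s 0"] exI[of _ "s 1"]) (auto simp: incseq_def strict_mono_def)
qed

definition coordinate :: "'n \<Rightarrow> 'n \<Rightarrow> nat" where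
  "coordinate i = (\<lambda>j. if j = i then 1 else 0)"

lemma weight_coordinate: "weight (coordinate i) e = Poly_Mapping.lookup e (i::'n::finite)"
proof -
  have "weight (coordinate i) e = (\<Sum>j\<in>UNIV. if j = i then Poly_Mapping.lookup e j else 0)"
    unfolding weight_def coordinate_def by (intro sum.cong) auto
  then show ?thesis by simp
qed

text \<open>
  An ideal that is graded for every coordinate is a monomial ideal: cutting an element of the
  difference down to a component for each coordinate in turn leaves a single term.
\<close>

lemma monomial_ideal_difference:
  fixes I J :: "('n::finite, 'k::field) mpoly set"
  assumes J: "is_ideal J" and grI: "\<And>i. graded (coordinate i) I" and "\<not> I \<subseteq> J"
  shows "\<exists>e c. monom_of e c \<in> I - J"
proof -
  have "\<exists>x\<in>I - J. \<exists>u. \<forall>i\<in>A. \<forall>e\<in>Poly_Mapping.keys x. Poly_Mapping.lookup e i = u i"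
    if "finite A" for A :: "'n set"
    using that
  proof (induction A)
    case empty
    then show ?case using \<open>\<not> I \<subseteq> J\<close> by auto
  next
    case (insert i A)
    then obtain x u where x: "x \<in> I - J"
      "\<forall>i\<in>A. \<forall>e\<in>Poly_Mapping.keys x. Poly_Mapping.lookup e i = u i" by blast
    obtain c where c: "weight_le (coordinate i) c x" using weight_le_exists by blast
    have "\<exists>d. component (coordinate i) d x \<notin> J"
    proof (rule ccontr)
      assume "\<not> ?thesis"
      then have "(\<Sum>d\<le>c. component (coordinate i) d x) \<in> J" by (intro ideal_sum[OF J]) auto
      with sum_components[OF c] x(1) show False by auto
    qed
    then obtain d where d: "component (coordinate i) d x \<notin> J" by blast
    have "component (coordinate i) d x \<in> I" using grI x(1) by (auto simp: graded_def)
    moreover have "\<forall>j\<in>insert i A. \<forall>e\<in>Poly_Mapping.keys (component (coordinate i) d x).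
        Poly_Mapping.lookup e j = (u(i := d)) j"
      using x(2) by (auto simp: keys_component weight_coordinate)
    ultimately show ?case using d by blast
  qed
  from this[of UNIV] obtain x u where x: "x \<in> I" "x \<notin> J"
    "\<And>i e. e \<in> Poly_Mapping.keys x \<Longrightarrow> Poly_Mapping.lookup e i = u i" by auto
  have "x \<noteq> 0" using x(2) ideal_zero[OF J] by auto
  then obtain e where e: "e \<in> Poly_Mapping.keys x" by (metis all_not_in_conv keys_eq_empty)
  have single: "e' = e" if "e' \<in> Poly_Mapping.keys x" for e'
    using x(3)[OF that] x(3)[OF e] by (intro poly_mapping_eqI) simp
  have "x = monom_of e (coeff_of x e)"
  proof (rule poly_mapping_eqI)
    fix e'
    show "coeff_of x e' = coeff_of (monom_of e (coeff_of x e)) e'"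
      using single[of e'] by (cases "e' = e") (auto simp: lookup_single in_keys_iff)
  qed
  then have "monom_of e (coeff_of x e) \<in> I - J" using x by simp
  then show ?thesis by blast
qed

text \<open>
  Hilbert's basis theorem. Passing to initial ideals keeps a chain strict
  (\<open>init_ideal_reflects_subset\<close>) and keeps the gradings obtained so far, so after all coordinates
  have been used a strict chain consists of monomial ideals, which contradicts Dickson's lemma.
\<close>

lemma ideal_acc:
  fixes I :: "nat \<Rightarrow> ('n::finite, 'k::field) mpoly set"
  assumes ideal: "\<And>k. is_ideal (I k)" and chain: "\<And>k. I k \<subseteq> I (Suc k)"
  shows "\<exists>k. I (Suc k) = I k"
proof (rule ccontr)
  assume "\<not> ?thesis"
  then have strict: "\<And>k. \<not> I (Suc k) \<subseteq> I k" using chain by blast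
  define strict_chain :: "(nat \<Rightarrow> ('n, 'k) mpoly set) \<Rightarrow> bool" where
    "strict_chain M \<longleftrightarrow> (\<forall>k. is_ideal (M k) \<and> M k \<subseteq> M (Suc k) \<and> \<not> M (Suc k) \<subseteq> M k)" for M
  have "\<exists>M. strict_chain M \<and> (\<forall>i\<in>A. \<forall>k. graded (coordinate i) (M k))" if "finite A" for A
    using that
  proof (induction A)
    case empty
    have "strict_chain I" unfolding strict_chain_def using ideal chain strict by simp
    then show ?case by (intro exI[of _ I]) simp
  next
    case (insert i A)
    then obtain M where chain_M: "strict_chain M" and graded: "\<And>j k. j \<in> A \<Longrightarrow> graded (coordinate j) (M k)"
      by metis
    then have M: "is_ideal (M k)" "M k \<subseteq> M (Suc k)" "\<not> M (Suc k) \<subseteq> M k" for k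
      by (simp_all add: strict_chain_def)
    let ?N = "\<lambda>k. init_ideal (coordinate i) (M k)"
    have "strict_chain ?N"
      unfolding strict_chain_def
    proof (intro allI conjI notI)
      fix k
      show "is_ideal (?N k)" by (rule ideal_init_ideal[OF M(1)])
      show "?N k \<subseteq> ?N (Suc k)" by (rule init_ideal_mono[OF M(2)])
      assume "?N (Suc k) \<subseteq> ?N k"
      with init_ideal_reflects_subset[OF M(1) M(1) M(2)] M(3) show False by simp
    qed
    moreover have "graded (coordinate j) (?N k)" if "j \<in> insert i A" for j k
    proof (cases "j = i")
      case True
      then show ?thesis using graded_init_ideal[OF M(1)] by simp
    next
      case False
      then show ?thesis using that graded_init_ideal_other[OF M(1) graded] by simp
    qed
    ultimately show ?case by (intro exI[of _ ?N]) simp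
  qed
  from this[OF finite[of UNIV]] obtain M where "strict_chain M"
    and "\<forall>j\<in>UNIV. \<forall>k. graded (coordinate j) (M k)" by metis
  then have M: "is_ideal (M k)" "M k \<subseteq> M (Suc k)" "\<not> M (Suc k) \<subseteq> M k"
    and graded: "graded (coordinate j) (M k)" for j k
    by (simp_all add: strict_chain_def)
  have "\<exists>e c. monom_of e c \<in> M (Suc k) - M k" for k
    by (rule monomial_ideal_difference[OF M(1) graded M(3)])
  then have "\<forall>k. \<exists>u. monom_of (fst u) (snd u) \<in> M (Suc k) - M k" by simp
  then obtain u where u: "\<And>k. monom_of (fst (u k)) (snd (u k)) \<in> M (Suc k) - M k" by metis
  define e where "e k = fst (u k)" for k
  define c where "c k = snd (u k)" for k
  have e: "monom_of (e k) (c k) \<in> M (Suc k) - M k" for k using u by (simp add: e_def c_def)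
  obtain i j where ij: "i < j" "\<And>x. Poly_Mapping.lookup (e i) x \<le> Poly_Mapping.lookup (e j) x"
    using dickson[of e] by blast
  have "e i + (e j - e i) = e j"
    using ij(2) by (intro poly_mapping_eqI) (simp add: lookup_add lookup_minus)
  moreover have "c i \<noteq> 0" using e[of i] ideal_zero[OF M(1)] by auto
  ultimately have "monom_of (e j) (c j) = monom_of (e j - e i) (c j / c i) * monom_of (e i) (c i)"
    by (simp add: mult_single add.commute)
  also have "\<dots> \<in> M (Suc i)" using e by (intro ideal_mult[OF M(1)]) blast
  also have "M (Suc i) \<subseteq> M j"
    using ij(1) by (intro lift_Suc_mono_le[of M, OF M(2)]) simp
  finally show False using e[of j] by blast
qed

lemma ideal_acc_stable:
  fixes I :: "nat \<Rightarrow> ('n::finite, 'k::field) mpoly set"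
  assumes ideal: "\<And>k. is_ideal (I k)" and chain: "\<And>k. I k \<subseteq> I (Suc k)"
  shows "\<exists>m. \<forall>k\<ge>m. I k = I m"
proof (rule ccontr)
  assume "\<not> ?thesis"
  then have "\<forall>m. \<exists>k\<ge>m. I k \<noteq> I m" by blast
  then obtain s where s: "\<And>m. s m \<ge> m" "\<And>m. I (s m) \<noteq> I m" by metis
  define t where "t = rec_nat 0 (\<lambda>_. s)"
  have t: "t (Suc k) = s (t k)" for k by (simp add: t_def)
  have "\<exists>k. I (t (Suc k)) = I (t k)"
  proof (rule ideal_acc)
    show "is_ideal (I (t k))" for k by (rule ideal)
    show "I (t k) \<subseteq> I (t (Suc k))" for k
      unfolding t by (rule lift_Suc_mono_le[of I, OF chain s(1)])
  qed
  then show False using s(2) by (auto simp: t)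
qed

text \<open>
  Noetherian induction, in the form of a maximal element above a given ideal.
\<close>

lemma maximal_ideal_exists:
  fixes Q :: "('n::finite, 'k::field) mpoly set \<Rightarrow> bool"
  assumes "is_ideal I" "Q I"
  shows "\<exists>M. is_ideal M \<and> Q M \<and> I \<subseteq> M \<and> (\<forall>J. is_ideal J \<longrightarrow> Q J \<longrightarrow> M \<subseteq> J \<longrightarrow> J = M)"
proof (rule ccontr)
  assume no_max: "\<not> ?thesis"
  define S where "S = {M. is_ideal M \<and> Q M \<and> I \<subseteq> M}"
  have "\<forall>M\<in>S. \<exists>J. J \<in> S \<and> M \<subset> J"
  proof
    fix M assume "M \<in> S"
    then have M: "is_ideal M" "Q M" "I \<subseteq> M" by (simp_all add: S_def)
    have "\<not> (\<forall>J. is_ideal J \<longrightarrow> Q J \<longrightarrow> M \<subseteq> J \<longrightarrow> J = M)"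
      using no_max M by metis
    then obtain J where J: "is_ideal J" "Q J" "M \<subseteq> J" "J \<noteq> M" by metis
    have "J \<in> S" using J M by (simp add: S_def)
    moreover have "M \<subset> J" using J by auto
    ultimately show "\<exists>J. J \<in> S \<and> M \<subset> J" by (intro exI[of _ J] conjI)
  qed
  from bchoice[OF this] obtain s where s: "\<forall>M\<in>S. s M \<in> S \<and> M \<subset> s M" ..
  define t where "t = rec_nat I (\<lambda>_. s)"
  have t: "t k \<in> S" for k
    using assms s by (induction k) (simp_all add: t_def S_def)
  have "\<exists>k. t (Suc k) = t k"
  proof (rule ideal_acc)
    show "is_ideal (t k)" for k using t[of k] by (simp add: S_def)
    show "t k \<subseteq> t (Suc k)" for k using bspec[OF s t[of k]] by (auto simp: t_def)
  qed
  then obtain k where "s (t k) = t k" by (auto simp: t_def)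
  with bspec[OF s t[of k]] show False by simp
qed

section \<open>Compatibly split ideals\<close>

lemma compatibly_split_iff: "compatibly_split \<phi> I \<longleftrightarrow> is_ideal I \<and> (\<forall>x\<in>I. \<phi> x \<in> I)"
  by (auto simp: compatibly_split_def ideal_iff_is_ideal)

lemma compatibly_split_ideal: "compatibly_split \<phi> I \<Longrightarrow> is_ideal I"
  and compatibly_split_mem: "compatibly_split \<phi> I \<Longrightarrow> x \<in> I \<Longrightarrow> \<phi> x \<in> I"
  and compatibly_splitI: "is_ideal I \<Longrightarrow> (\<And>x. x \<in> I \<Longrightarrow> \<phi> x \<in> I) \<Longrightarrow> compatibly_split \<phi> I"
  by (simp_all add: compatibly_split_iff)

lemma compatibly_split_funpow: "compatibly_split \<phi> I \<Longrightarrow> x \<in> I \<Longrightarrow> (\<phi> ^^ N) x \<in> I"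
  by (induction N) (auto simp: compatibly_split_mem)

lemma compatibly_split_UNIV: "compatibly_split \<phi> UNIV"
  by (simp add: compatibly_split_iff ideal_UNIV)

lemma compatibly_split_Int:
  "compatibly_split \<phi> I \<Longrightarrow> compatibly_split \<phi> J \<Longrightarrow> compatibly_split \<phi> (I \<inter> J)"
  by (simp add: compatibly_split_iff ideal_Int)

locale splitting =
  fixes p :: nat and \<phi> :: "'r::comm_ring_1 \<Rightarrow> 'r"
  assumes p: "p \<ge> 2" and splitting: "frobenius_splitting p \<phi>"
begin

lemma add: "\<phi> (a + b) = \<phi> a + \<phi> b"
  and pull_out: "\<phi> (a ^ p * b) = a * \<phi> b"
  and one: "\<phi> 1 = 1"
  using splitting by (simp_all add: frobenius_splitting_def near_splitting_def)

lemma zero [simp]: "\<phi> 0 = 0"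
  using add[of 0 0] by simp

lemma root: "\<phi> (a ^ p) = a"
  using pull_out[of a 1] by (simp add: one)

lemma funpow_add: "(\<phi> ^^ N) (a + b) = (\<phi> ^^ N) a + (\<phi> ^^ N) b"
  by (induction N) (simp_all add: add)

lemma funpow_zero [simp]: "(\<phi> ^^ N) 0 = 0"
  by (induction N) simp_all

lemma funpow_sum: "(\<phi> ^^ N) (sum g A) = (\<Sum>x\<in>A. (\<phi> ^^ N) (g x))"
  by (induction A rule: infinite_finite_induct) (auto simp: funpow_add)

lemma funpow_pull_out: "(\<phi> ^^ N) (a ^ (p ^ N) * b) = a * (\<phi> ^^ N) b"
proof (induction N arbitrary: b)
  case (Suc N)
  have "(\<phi> ^^ Suc N) (a ^ (p ^ Suc N) * b) = (\<phi> ^^ N) (\<phi> ((a ^ p ^ N) ^ p * b))"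
    by (simp add: funpow_swap1 power_mult mult.commute[of p])
  also have "\<dots> = a * (\<phi> ^^ Suc N) b"
    by (simp only: pull_out Suc.IH) (simp add: funpow_swap1)
  finally show ?case .
qed simp

lemma funpow_root: "(\<phi> ^^ N) (a ^ (p ^ N)) = a"
proof -
  have "(\<phi> ^^ N) 1 = 1" by (induction N) (simp_all add: one)
  then show ?thesis using funpow_pull_out[of N a 1] by simp
qed

text \<open>
  Compatibly split ideals are radical, because \<open>x = \<phi> (x\<^bsup>p\<^esup>)\<close>.
\<close>

lemma square_mem:
  assumes "compatibly_split \<phi> I" "x * x \<in> I"
  shows "x \<in> I"
proof -
  have "x ^ p = x ^ (p - 2) * (x * x)"
    using p by (metis le_add_diff_inverse2 power2_eq_square power_add)
  then have "x ^ p \<in> I" using assms by (simp add: compatibly_split_iff ideal_mult)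
  then show ?thesis using assms compatibly_split_mem root by metis
qed

lemma compatibly_split_plus:
  assumes "compatibly_split \<phi> I" "compatibly_split \<phi> J"
  shows "compatibly_split \<phi> (ideal_plus I J)"
proof (rule compatibly_splitI)
  show "is_ideal (ideal_plus I J)"
    using assms by (intro ideal_ideal_plus compatibly_split_ideal)
  fix x assume "x \<in> ideal_plus I J"
  then obtain a b where "x = a + b" "a \<in> I" "b \<in> J" by (auto simp: ideal_plus_def)
  then show "\<phi> x \<in> ideal_plus I J"
    using assms by (auto simp: ideal_plus_def add compatibly_split_iff)
qed

text \<open>
  If \<open>x s \<in> I\<close>, then \<open>s \<phi> x = \<phi> (s\<^bsup>p\<^esup> x) \<in> I\<close>.
\<close>

lemma compatibly_split_colon:
  assumes "compatibly_split \<phi> I"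
  shows "compatibly_split \<phi> (colon I S)"
proof (rule compatibly_splitI)
  have I: "is_ideal I" using assms by (rule compatibly_split_ideal)
  then show "is_ideal (colon I S)" by (rule ideal_colon)
  fix x assume x: "x \<in> colon I S"
  show "\<phi> x \<in> colon I S" unfolding colon_def
  proof (intro CollectI ballI)
    fix s assume "s \<in> S"
    then have "x * s \<in> I" using x by (simp add: colon_def)
    then have "s ^ (p - 1) * (x * s) \<in> I" by (rule ideal_mult[OF I])
    moreover have "s ^ (p - 1) * (x * s) = s ^ p * x"
      using p by (cases p) (auto simp: mult_ac)
    ultimately have "\<phi> (s ^ p * x) \<in> I"
      using compatibly_split_mem[OF assms] by metis
    then show "\<phi> x * s \<in> I" by (simp only: pull_out mult.commute[of "\<phi> x"])
  qed
qed

text \<open>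
  An ideal \<open>Q\<close> that is maximal among the compatibly split ideals containing \<open>I\<close> and no member of
  \<open>\<F>\<close> is prime. If \<open>a b \<in> Q\<close> with \<open>a, b \<notin> Q\<close>, then the quotients \<open>B = (Q : a)\<close> and \<open>A = (Q : B)\<close>
  are strictly larger, so each contains a member of \<open>\<F>\<close>; the intersection of these two members lies in
  \<open>A \<inter> B\<close>, which is \<open>Q\<close> because \<open>Q\<close> is radical.
\<close>

lemma prime_avoiding_exists:
  assumes fin: "finite {I. compatibly_split \<phi> I}" and I: "compatibly_split \<phi> I"
    and UNIV: "UNIV \<in> \<F>" and \<F>: "\<And>J. J \<in> \<F> \<Longrightarrow> compatibly_split \<phi> J"
    and Int: "\<And>J K. J \<in> \<F> \<Longrightarrow> K \<in> \<F> \<Longrightarrow> J \<inter> K \<in> \<F>"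
    and avoid: "\<And>J. J \<in> \<F> \<Longrightarrow> \<not> J \<subseteq> I"
  obtains Q where "is_prime Q" "compatibly_split \<phi> Q" "I \<subseteq> Q" "\<And>J. J \<in> \<F> \<Longrightarrow> \<not> J \<subseteq> Q"
proof -
  define S where "S = {Q. compatibly_split \<phi> Q \<and> I \<subseteq> Q \<and> (\<forall>J\<in>\<F>. \<not> J \<subseteq> Q)}"
  have "finite S" using fin by (rule finite_subset[rotated]) (auto simp: S_def)
  moreover have "S \<noteq> {}" using I avoid by (auto simp: S_def)
  ultimately obtain Q where Q: "Q \<in> S" and max: "\<forall>B\<in>S. Q \<subseteq> B \<longrightarrow> Q = B"
    by (metis finite_has_maximal)
  have split_Q: "compatibly_split \<phi> Q" and ideal_Q: "is_ideal Q" and avoid_Q: "\<And>J. J \<in> \<F> \<Longrightarrow> \<not> J \<subseteq> Q"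
    using Q compatibly_split_ideal by (auto simp: S_def)
  have bigger: "\<exists>J\<in>\<F>. J \<subseteq> B" if "compatibly_split \<phi> B" "Q \<subseteq> B" "x \<in> B" "x \<notin> Q" for B x
  proof (rule ccontr)
    assume "\<not> ?thesis"
    then have "B \<in> S" using that Q by (auto simp: S_def)
    then show False using max that by auto
  qed
  have "is_prime Q"
    unfolding is_prime_def
  proof (intro conjI allI impI)
    show "is_ideal Q" by (rule ideal_Q)
    show "1 \<notin> Q" using ideal_one[OF ideal_Q] avoid_Q[OF UNIV] by auto
    fix a b assume ab: "a * b \<in> Q"
    show "a \<in> Q \<or> b \<in> Q"
    proof (rule ccontr)
      assume "\<not> ?thesis"
      then have "a \<notin> Q" "b \<notin> Q" by auto
      define B where "B = colon Q {a}"
      define A where "A = colon Q B"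
      have "b \<in> B" using ab by (simp add: B_def colon_def mult.commute)
      have "a \<in> A" by (auto simp: A_def B_def colon_def mult.commute)
      obtain J where J: "J \<in> \<F>" "J \<subseteq> B"
        using bigger[of B b] compatibly_split_colon[OF split_Q] colon_superset[OF ideal_Q]
          \<open>b \<in> B\<close> \<open>b \<notin> Q\<close> unfolding B_def by blast
      obtain K where K: "K \<in> \<F>" "K \<subseteq> A"
        using bigger[of A a] compatibly_split_colon[OF split_Q] colon_superset[OF ideal_Q]
          \<open>a \<in> A\<close> \<open>a \<notin> Q\<close> unfolding A_def by blast
      have "J \<inter> K \<subseteq> Q"
      proof
        fix x assume "x \<in> J \<inter> K"
        then have "x \<in> A" "x \<in> B" using J K by auto
        then have "x * x \<in> Q" by (simp add: A_def colon_def)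
        then show "x \<in> Q" by (rule square_mem[OF split_Q])
      qed
      then show False using avoid_Q[OF Int[OF J(1) K(1)]] by simp
    qed
  qed
  then show thesis using that split_Q avoid_Q Q by (auto simp: S_def)
qed

text \<open>
  So a compatibly split ideal is the intersection of compatibly split primes.
\<close>

lemma prime_separating_exists:
  assumes fin: "finite {I. compatibly_split \<phi> I}" and I: "compatibly_split \<phi> I" and x: "x \<notin> I"
  obtains Q where "is_prime Q" "compatibly_split \<phi> Q" "I \<subseteq> Q" "x \<notin> Q"
proof (rule prime_avoiding_exists[OF fin I, of "{J. compatibly_split \<phi> J \<and> x \<in> J}"])
  fix Q assume Q: "is_prime Q" "compatibly_split \<phi> Q" "I \<subseteq> Q"
    and "\<And>J. J \<in> {J. compatibly_split \<phi> J \<and> x \<in> J} \<Longrightarrow> \<not> J \<subseteq> Q"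
  from this(4)[of Q] Q have "x \<notin> Q" by auto
  with Q show thesis by (rule that)
qed (use x in \<open>auto simp: compatibly_split_UNIV compatibly_split_Int\<close>)

end

section \<open>Splittings of the polynomial ring and gradings\<close>

text \<open>
  Dividing weights by \<open>p\<close>; homogeneous elements whose weight is not divisible by \<open>p\<close> are killed.
\<close>

definition graded_map ::
  "nat \<Rightarrow> ('n::finite \<Rightarrow> nat) \<Rightarrow> (('n, 'k::comm_monoid_add) mpoly \<Rightarrow> ('n, 'k) mpoly) \<Rightarrow> bool" where
  "graded_map p w \<phi> \<longleftrightarrow> (\<forall>g d. component w d (\<phi> g) = \<phi> (component w (p * d) g))"

locale mpoly_splitting = splitting p \<phi>
  for p and \<phi> :: "('n::finite, 'k::field) mpoly \<Rightarrow> ('n, 'k) mpoly" +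
  assumes frobenius_scalar: "\<And>c :: 'k. c ^ p = c"
begin

lemma frobenius_scalar_funpow: "(c :: 'k) ^ (p ^ N) = c"
  by (induction N) (simp_all add: power_mult frobenius_scalar)

text \<open>
  For \<open>p\<^sup>N\<close> larger than all weights in sight, the weight \<open>d\<close> component \<open>a\<close> of \<open>g\<close> equals
  \<open>\<phi>\<^sup>N (a\<^bsup>p\<^sup>N - 1\<^esup> g)\<close>: all other components of \<open>g\<close> contribute weights that are not divisible
  by \<open>p\<^sup>N\<close>, so they are killed.
\<close>

lemma graded_compatibly_split:
  assumes graded: "graded_map p w \<phi>" and I: "compatibly_split \<phi> I"
  shows "graded w I"
  unfolding graded_def
proof (intro ballI allI)
  fix g d assume g: "g \<in> I"
  obtain c where c: "weight_le w c g" using weight_le_exists by blast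
  show "component w d g \<in> I"
  proof (cases "d \<le> c")
    case False
    then show ?thesis
      using component_eq_0[OF c, of d] ideal_zero[OF compatibly_split_ideal[OF I]] by simp
  next
    case True
    define N where "N = c"
    have "c < 2 ^ c" by (rule less_exp)
    also have "\<dots> \<le> p ^ N" unfolding N_def using p by (intro power_mono) auto
    finally have N: "c < p ^ N" .
    define a where "a = component w d g"
    have weights: "component w d ((\<phi> ^^ M) h) = (\<phi> ^^ M) (component w (p ^ M * d) h)" for d M h
      using graded by (induction M arbitrary: d) (auto simp: graded_map_def mult_ac)
    have vanish: "(\<phi> ^^ N) (a ^ (p ^ N - 1) * component w d' g) = 0" if "d' \<le> c" "d' \<noteq> d" for d'
    proof -
      let ?h = "a ^ (p ^ N - 1) * component w d' g"
      define D where "D = (p ^ N - 1) * d + d'"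
      have h: "weight_homogeneous w D ?h"
        unfolding a_def D_def by (intro weight_homogeneous_mult weight_homogeneous_power) auto
      have "component w e ((\<phi> ^^ N) ?h) = 0" for e
      proof -
        have "p ^ N * e \<noteq> D"
        proof
          assume "p ^ N * e = D"
          moreover have "D + d = p ^ N * d + d'"
          proof -
            have "d \<le> p ^ N * d" using N by (cases "p ^ N") auto
            moreover have "D = p ^ N * d - d + d'" by (simp add: D_def diff_mult_distrib)
            ultimately show ?thesis by linarith
          qed
          ultimately have "p ^ N * e + d = p ^ N * d + d'" by simp
          then have "(p ^ N * e + d) mod p ^ N = (p ^ N * d + d') mod p ^ N" by simp
          then show False using that \<open>d \<le> c\<close> N by simp
        qed
        then show ?thesis unfolding weights component_other[OF h] by simp
      qed
      moreover obtain b where "weight_le w b ((\<phi> ^^ N) ?h)" using weight_le_exists by blast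
      ultimately show ?thesis using sum_components by (metis (no_types, lifting) sum.neutral)
    qed
    have "a ^ (p ^ N - 1) * g = (\<Sum>d'\<le>c. a ^ (p ^ N - 1) * component w d' g)"
      unfolding sum_distrib_left[symmetric] using sum_components[OF c] by simp
    then have "(\<phi> ^^ N) (a ^ (p ^ N - 1) * g) =
        (\<Sum>d'\<le>c. (\<phi> ^^ N) (a ^ (p ^ N - 1) * component w d' g))"
      by (simp add: funpow_sum)
    also have "\<dots> = (\<Sum>d'\<le>c. if d' = d then (\<phi> ^^ N) (a ^ (p ^ N - 1) * a) else 0)"
      by (intro sum.cong) (auto simp: vanish simp flip: a_def simp del: One_nat_def)
    also have "\<dots> = (\<phi> ^^ N) (a ^ (p ^ N - 1) * a)"
      using True by simp
    also have "a ^ (p ^ N - 1) * a = a ^ (p ^ N)"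
      using p by (metis One_nat_def Suc_pred mult.commute not_gr_zero not_numeral_le_zero power_Suc power_eq_0_iff)
    finally have "(\<phi> ^^ N) (a ^ (p ^ N - 1) * g) = a" by (simp add: funpow_root)
    moreover have "(\<phi> ^^ N) (a ^ (p ^ N - 1) * g) \<in> I"
      by (intro compatibly_split_funpow[OF I] ideal_mult[OF compatibly_split_ideal[OF I]] g)
    ultimately show ?thesis by (simp add: a_def)
  qed
qed

text \<open>
  Write \<open>g = \<phi>\<^sup>N (g\<^bsup>p\<^sup>N - 1\<^esup> g)\<close> and expand the first factor into monomials with exponents
  \<open>p\<^sup>N u + v\<close>, the entries of \<open>v\<close> being below \<open>p\<^sup>N\<close>. This expresses \<open>g\<close> as a combination of the
  elements \<open>\<phi>\<^sup>N (x\<^sup>v g)\<close> of \<open>I\<close>. As \<open>\<phi>\<close> divides degrees by \<open>p\<close>, their degrees are at most \<open>n\<close> for large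
  \<open>N\<close>.
\<close>

lemma compatibly_split_determined:
  assumes degree: "\<And>g c e. weight_le (\<lambda>_. 1) c g \<Longrightarrow> e \<in> Poly_Mapping.keys (\<phi> g) \<Longrightarrow> p * monom_degree e \<le> c"
    and I: "compatibly_split \<phi> I" and J: "compatibly_split \<phi> J"
    and low: "\<And>g. g \<in> I \<Longrightarrow> weight_le (\<lambda>_. 1) CARD('n) g \<Longrightarrow> g \<in> J"
  shows "I \<subseteq> J"
proof
  fix g assume g: "g \<in> I"
  obtain c where c: "weight_le (\<lambda>_. 1) c g" using weight_le_exists by blast
  have "c < 2 ^ c" by (rule less_exp)
  also have "\<dots> \<le> p ^ c" using p by (intro power_mono) auto
  finally have N: "c < p ^ c" .
  have idI: "is_ideal I" and idJ: "is_ideal J" using I J by (auto intro: compatibly_split_ideal)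
  have degrees: "p ^ M * monom_degree e \<le> b"
    if "weight_le (\<lambda>_. 1) b h" "e \<in> Poly_Mapping.keys ((\<phi> ^^ M) h)" for M b h e
    using that(2)
  proof (induction M arbitrary: e)
    case 0
    then show ?case using that(1) by (auto simp: weight_le_def)
  next
    case (Suc M)
    have "weight_le (\<lambda>_. 1) (b div p ^ M) ((\<phi> ^^ M) h)"
      unfolding weight_le_def using Suc.IH p by (auto simp: less_eq_div_iff_mult_less_eq mult.commute)
    then have "p * monom_degree e \<le> b div p ^ M"
      using Suc.prems by (intro degree) simp_all
    then have "p ^ M * (p * monom_degree e) \<le> p ^ M * (b div p ^ M)" by (rule mult_le_mono2)
    also have "\<dots> \<le> b" by simp
    finally show ?case by (simp add: mult_ac)
  qed
  have "(\<phi> ^^ c) (h * g) \<in> J" for h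
  proof (induction h rule: mpoly_induct)
    case 1
    then show ?case using ideal_zero[OF idJ] by simp
  next
    case (2 m a)
    \<comment> \<open>Division with remainder of the exponents by \<open>p\<^sup>N\<close>, where \<open>N = c\<close>.\<close>
    define u where "u = Abs_poly_mapping (\<lambda>i. Poly_Mapping.lookup m i div p ^ c)"
    define v where "v = Abs_poly_mapping (\<lambda>i. Poly_Mapping.lookup m i mod p ^ c)"
    have lookup_v: "Poly_Mapping.lookup v i = Poly_Mapping.lookup m i mod p ^ c" for i
      by (simp add: v_def)
    have "m = (\<Sum>_\<in>{..<p ^ c}. u) + v"
      by (intro poly_mapping_eqI) (simp add: lookup_add lookup_sum u_def v_def)
    then have split: "monom_of m a * g = monom_of u a ^ (p ^ c) * (monom_of v 1 * g)"
      by (simp add: monom_of_power mult_single frobenius_scalar_funpow flip: mult.assoc)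
    have "monom_degree v \<le> CARD('n) * (p ^ c - 1)"
    proof -
      have "x mod p ^ c \<le> p ^ c - 1" for x
      proof -
        have "x mod p ^ c < p ^ c" by (intro mod_less_divisor) (use N in linarith)
        then show ?thesis by linarith
      qed
      then have "monom_degree v \<le> (\<Sum>i\<in>(UNIV::'n set). p ^ c - 1)"
        unfolding weight_def by (intro sum_mono) (simp add: lookup_v)
      then show ?thesis by simp
    qed
    then have v: "weight_le (\<lambda>_. 1) (CARD('n) * (p ^ c - 1)) (monom_of v (1::'k))"
      by (simp add: weight_le_def)
    have low_degree: "weight_le (\<lambda>_. 1) CARD('n) ((\<phi> ^^ c) (monom_of v 1 * g))"
      unfolding weight_le_def
    proof
      fix e assume "e \<in> Poly_Mapping.keys ((\<phi> ^^ c) (monom_of v 1 * g))"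
      from degrees[OF weight_le_mult[OF v c] this]
      have "p ^ c * monom_degree e \<le> CARD('n) * (p ^ c - 1) + c" .
      also have "\<dots> < CARD('n) * p ^ c + p ^ c"
        using N by (simp add: diff_mult_distrib2 add_le_less_mono)
      also have "\<dots> = p ^ c * Suc CARD('n)" by simp
      finally have "monom_degree e < Suc CARD('n)" by (rule mult_less_cancel1[THEN iffD1, THEN conjunct2])
      then show "monom_degree e \<le> CARD('n)" by simp
    qed
    have "(\<phi> ^^ c) (monom_of v 1 * g) \<in> J"
      by (intro low low_degree compatibly_split_funpow[OF I] ideal_mult[OF idI] g)
    then show ?case unfolding split funpow_pull_out by (rule ideal_mult[OF idJ])
  next
    case (3 h h')
    then show ?case by (simp add: distrib_right funpow_add ideal_add[OF idJ])
  qed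
  then have "(\<phi> ^^ c) (g ^ (p ^ c - 1) * g) \<in> J" .
  moreover have "g ^ (p ^ c - 1) * g = g ^ (p ^ c)"
    using N by (cases "p ^ c") (auto simp: mult.commute)
  ultimately show "g \<in> J" by (simp add: funpow_root)
qed

end

lemma finite_exponents: "finite {e :: 'n::finite \<Rightarrow>\<^sub>0 nat. monom_degree e \<le> d}"
proof -
  have "Poly_Mapping.lookup e i \<le> monom_degree e" for e :: "'n \<Rightarrow>\<^sub>0 nat" and i
    unfolding weight_def by (simp, rule member_le_sum) auto
  then have "Poly_Mapping.lookup ` {e :: 'n \<Rightarrow>\<^sub>0 nat. monom_degree e \<le> d} \<subseteq> Pi\<^sub>E UNIV (\<lambda>_. {..d})"
    by (intro image_subsetI PiE_I) (auto intro: order_trans)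
  moreover have "finite (Pi\<^sub>E (UNIV :: 'n set) (\<lambda>_. {..d}))" by (intro finite_PiE) auto
  ultimately have "finite (Poly_Mapping.lookup ` {e :: 'n \<Rightarrow>\<^sub>0 nat. monom_degree e \<le> d})"
    by (rule finite_subset)
  moreover have "inj_on Poly_Mapping.lookup {e :: 'n \<Rightarrow>\<^sub>0 nat. monom_degree e \<le> d}"
  proof (rule inj_onI)
    fix e e' :: "'n \<Rightarrow>\<^sub>0 nat" assume "Poly_Mapping.lookup e = Poly_Mapping.lookup e'"
    then show "e = e'" by (simp only: lookup_inject)
  qed
  ultimately show ?thesis by (rule finite_imageD)
qed

lemma finite_bounded_degree:
  "finite {g :: ('n::finite, 'k::{finite, zero}) mpoly. weight_le (\<lambda>_. 1) d g}"
proof -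
  let ?E = "{e :: 'n \<Rightarrow>\<^sub>0 nat. monom_degree e \<le> d}"
  let ?S = "{g :: ('n, 'k) mpoly. weight_le (\<lambda>_. 1) d g}"
  have "inj_on (\<lambda>g. restrict (Poly_Mapping.lookup g) ?E) ?S"
  proof (rule inj_onI)
    fix g h assume gh: "g \<in> ?S" "h \<in> ?S" and eq: "restrict (coeff_of g) ?E = restrict (coeff_of h) ?E"
    show "g = h"
    proof (rule poly_mapping_eqI)
      fix e
      show "coeff_of g e = coeff_of h e"
      proof (cases "e \<in> ?E")
        case True
        then show ?thesis using fun_cong[OF eq, of e] by simp
      next
        case False
        then have "e \<notin> Poly_Mapping.keys g" "e \<notin> Poly_Mapping.keys h"
          using gh unfolding weight_le_def by blast+
        then show ?thesis by (simp add: in_keys_iff)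
      qed
    qed
  qed
  moreover have "(\<lambda>g. restrict (Poly_Mapping.lookup g) ?E) ` ?S \<subseteq> Pi\<^sub>E ?E (\<lambda>_. UNIV)"
    by (intro image_subsetI PiE_I) auto
  moreover have "finite (Pi\<^sub>E ?E (\<lambda>_. UNIV :: 'k set))"
    by (intro finite_PiE finite_exponents) auto
  ultimately show ?thesis by (rule inj_on_finite)
qed

lemma (in mpoly_splitting) finite_compatibly_split:
  assumes degree: "\<And>g c e. weight_le (\<lambda>_. 1) c g \<Longrightarrow> e \<in> Poly_Mapping.keys (\<phi> g) \<Longrightarrow> p * monom_degree e \<le> c"
    and finite: "finite {g :: ('n, 'k) mpoly. weight_le (\<lambda>_. 1) CARD('n) g}"
  shows "finite {I. compatibly_split \<phi> I}"
proof (rule inj_on_finite)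
  let ?V = "{g :: ('n, 'k) mpoly. weight_le (\<lambda>_. 1) CARD('n) g}"
  show "inj_on (\<lambda>I. I \<inter> ?V) {I. compatibly_split \<phi> I}"
  proof (rule inj_onI)
    fix I J assume IJ: "I \<in> {I. compatibly_split \<phi> I}" "J \<in> {I. compatibly_split \<phi> I}"
      and eq: "I \<inter> ?V = J \<inter> ?V"
    have mem: "g \<in> I \<longleftrightarrow> g \<in> J" if "weight_le (\<lambda>_. 1) CARD('n) g" for g
      using eq that by blast
    show "I = J"
    proof
      show "I \<subseteq> J" by (rule compatibly_split_determined[OF degree]) (use IJ mem in simp_all)
      show "J \<subseteq> I" by (rule compatibly_split_determined[OF degree]) (use IJ mem in simp_all)
    qed
  qed
  show "(\<lambda>I. I \<inter> ?V) ` {I. compatibly_split \<phi> I} \<subseteq> Pow ?V" by auto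
  show "finite (Pow ?V)" using finite by simp
qed

section \<open>Annihilators modulo initial ideals\<close>

text \<open>
  One step of division: multiplying by \<open>s\<close> raises the weight by \<open>d\<close>, but modulo \<open>P\<close> the top
  component can be removed, so the weight grows by at most \<open>d - 1\<close>. The bound is written as a sum to
  avoid subtraction; it forces \<open>x = 0\<close> when the bound becomes negative.
\<close>

lemma leading_reduction_step:
  fixes J P :: "('n::finite, 'k::field) mpoly set"
  assumes J: "is_ideal J" and P: "is_ideal P" and PJ: "P \<subseteq> J"
    and s: "weight_homogeneous w d s" and sJ: "\<And>x. x \<in> init_ideal w J \<Longrightarrow> s * x \<in> init_ideal w P"
    and x: "x \<in> J" "\<And>e. e \<in> Poly_Mapping.keys x \<Longrightarrow> weight w e + m \<le> a + m * d"
  shows "\<exists>y\<in>J. s * x - y \<in> P \<and> (\<forall>e\<in>Poly_Mapping.keys y. weight w e + Suc m \<le> a + Suc m * d)"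
proof (cases "a + m * d < m")
  case True
  then have "Poly_Mapping.keys x = {}" using x(2) by force
  then have "x = 0" by simp
  then show ?thesis using ideal_zero[OF J] ideal_zero[OF P] by (intro bexI[of _ 0]) auto
next
  case False
  define b where "b = a + m * d - m"
  have "weight_le w b x" using x(2) False unfolding weight_le_def b_def by fastforce
  then have lead: "component w b x \<in> init_ideal w J" by (rule component_in_init[OF J x(1)])
  have "weight_homogeneous w (d + b) (s * component w b x)"
    using s by (intro weight_homogeneous_mult) auto
  then obtain h where h: "h \<in> P" "weight_le w (d + b) h" "component w (d + b) h = s * component w b x"
    by (rule init_homogeneous_obtains[OF P sJ[OF lead]])
  define y where "y = s * x - h"
  have "y \<in> J" unfolding y_def using h(1) PJ by (intro ideal_diff[OF J] ideal_mult[OF J] x) auto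
  moreover have "s * x - y \<in> P" using h(1) by (simp add: y_def)
  moreover have "weight w e + Suc m \<le> a + Suc m * d" if e: "e \<in> Poly_Mapping.keys y" for e
  proof -
    have "weight_le w (d + b) y"
      unfolding y_def using weight_le_mult[OF weight_homogeneous_le[OF s] \<open>weight_le w b x\<close>] h(2)
      by (rule weight_le_diff)
    then have "weight w e \<le> d + b" using e by (simp add: weight_le_def)
    moreover have "component w (d + b) y = 0"
      by (simp add: y_def component_diff h(3) component_mult_homogeneous[OF s])
    then have "weight w e \<noteq> d + b" using e keys_component[of w "d + b" y] by auto
    ultimately show ?thesis using False by (simp add: b_def)
  qed
  ultimately show ?thesis by blast
qed

text \<open>
  Weight-filtered ideals correspond to homogeneous ideals of the polynomial ring in one more
  variable, the parameter of the degeneration. The locale describes an ascending chain, indexed by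
  \<open>m\<close>, of such ideals, \<open>C m c\<close> being the piece of weight at most \<open>c\<close>; its purpose is the ascending
  chain condition \<open>chain_stable\<close> for them.
\<close>

locale filtered_chain =
  fixes C :: "nat \<Rightarrow> nat \<Rightarrow> ('n::finite, 'k::field) mpoly set" and w :: "'n \<Rightarrow> nat"
  assumes zero: "0 \<in> C m c" and add: "x \<in> C m c \<Longrightarrow> y \<in> C m c \<Longrightarrow> x + y \<in> C m c"
    and mult: "x \<in> C m c \<Longrightarrow> weight_le w b r \<Longrightarrow> r * x \<in> C m (b + c)"
    and weight: "x \<in> C m c \<Longrightarrow> weight_le w c x"
    and incl: "x \<in> C m c \<Longrightarrow> x \<in> C m (Suc c)" and chain: "x \<in> C m c \<Longrightarrow> x \<in> C (Suc m) c"
begin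

lemma incl_le: "c \<le> c' \<Longrightarrow> x \<in> C m c \<Longrightarrow> x \<in> C m c'"
  by (induction c' rule: dec_induct) (auto intro: incl)

lemma chain_le: "m \<le> m' \<Longrightarrow> x \<in> C m c \<Longrightarrow> x \<in> C m' c"
  by (induction m' rule: dec_induct) (auto intro: chain)

lemma uminus: "x \<in> C m c \<Longrightarrow> - x \<in> C m c"
  using mult[of x m c 0 "-1"] by (simp add: weight_le_uminus)

text \<open>
  The top components in weight \<open>c\<close> of those elements of the piece \<open>c + k\<close> that have weight at
  most \<open>c\<close>: the coefficient of the \<open>k\<close>-th power of the parameter.
\<close>

definition symbols :: "nat \<Rightarrow> nat \<Rightarrow> ('n, 'k) mpoly set" where
  "symbols m k = {x. \<forall>c. \<exists>y\<in>C m (c + k). weight_le w c y \<and> component w c y = component w c x}"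

lemma ideal_symbols: "is_ideal (symbols m k)"
  unfolding symbols_def
proof (rule ideal_leading_components)
  show "r * x \<in> C m (b + c + k)" if "x \<in> C m (c + k)" "weight_le w b r" for b c r x
    using mult[OF that] by (simp add: add.assoc)
qed (simp_all add: zero add)

lemma symbols_mono: "m \<le> m' \<Longrightarrow> k \<le> k' \<Longrightarrow> symbols m k \<subseteq> symbols m' k'"
proof
  fix x assume le: "m \<le> m'" "k \<le> k'" and x: "x \<in> symbols m k"
  show "x \<in> symbols m' k'" unfolding symbols_def
  proof (intro CollectI allI)
    fix c
    obtain y where y: "y \<in> C m (c + k)" "weight_le w c y" "component w c y = component w c x"
      using x unfolding symbols_def by blast
    have "y \<in> C m' (c + k')" using incl_le[of "c + k" "c + k'"] chain_le[OF le(1)] y(1) le(2) by simp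
    then show "\<exists>y\<in>C m' (c + k'). weight_le w c y \<and> component w c y = component w c x"
      using y by blast
  qed
qed

text \<open>
  The ideals \<open>symbols m k\<close> increase in both indices. Once the diagonal is stationary at \<open>j\<close>, so are
  all entries with both indices at least \<open>j\<close>, and the finitely many columns \<open>k < j\<close> are stationary
  from some point on.
\<close>

lemma symbols_stable: "\<exists>m. \<forall>k. symbols (Suc m) k = symbols m k"
proof -
  have "\<exists>j. \<forall>i\<ge>j. symbols i i = symbols j j"
    by (rule ideal_acc_stable) (simp_all add: ideal_symbols symbols_mono)
  then obtain j where j: "\<And>i. i \<ge> j \<Longrightarrow> symbols i i = symbols j j" by blast
  have "\<forall>k. \<exists>m. \<forall>i\<ge>m. symbols i k = symbols m k"
    by (intro allI ideal_acc_stable) (simp_all add: ideal_symbols symbols_mono)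
  from choice[OF this] obtain M where M: "\<forall>k. \<forall>i\<ge>M k. symbols i k = symbols (M k) k" ..
  define m where "m = Max (insert j (M ` {..<j}))"
  have m: "j \<le> m" "\<And>k. k < j \<Longrightarrow> M k \<le> m" by (auto simp: m_def)
  have "symbols (Suc m) k = symbols m k" for k
  proof (cases "k < j")
    case True
    have eq: "symbols i k = symbols (M k) k" if "M k \<le> i" for i
      by (rule M[rule_format, OF that])
    have "M k \<le> m" by (rule m(2)[OF True])
    then show ?thesis using eq[of m] eq[of "Suc m"] by (metis le_SucI)
  next
    case False
    have "symbols i k = symbols j j" if "j \<le> i" for i
    proof
      show "symbols i k \<subseteq> symbols j j"
        using symbols_mono[of i "max i k" k "max i k"] j[of "max i k"] that by auto
      show "symbols j j \<subseteq> symbols i k" using symbols_mono that False by simp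
    qed
    from this[of m] this[of "Suc m"] m(1) show ?thesis by simp
  qed
  then show ?thesis by blast
qed

text \<open>
  A filtered ideal is determined by its symbols within a larger one, by subtracting elements with the
  same top component.
\<close>

lemma chain_stable: "\<exists>m. \<forall>c. C (Suc m) c \<subseteq> C m c"
proof -
  obtain m where m: "\<And>k. symbols (Suc m) k = symbols m k" using symbols_stable by blast
  have "x \<in> C m c" if "x \<in> C (Suc m) c" "weight_le w b x" "b \<le> c" for x b c
    using that
  proof (induction b arbitrary: x)
    case (0 x)
    have "x \<in> symbols (Suc m) c" unfolding symbols_def
    proof (intro CollectI allI)
      fix c'
      show "\<exists>y\<in>C (Suc m) (c' + c). weight_le w c' y \<and> component w c' y = component w c' x"
        using 0 incl_le[of c "c' + c" x "Suc m"] weight_le_mono[of w 0 x c'] by (intro bexI[of _ x]) auto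
    qed
    then have "x \<in> symbols m c" by (simp only: m)
    from this[unfolded symbols_def, THEN CollectD, THEN spec, of 0]
    obtain y where y: "y \<in> C m (0 + c)" "weight_le w 0 y" "component w 0 y = component w 0 x"
      by blast
    have "x = component w 0 x" by (rule trans[OF sum_components[OF 0(2)]]) simp
    also have "\<dots> = y" unfolding y(3)[symmetric]
      by (rule sym, rule trans[OF sum_components[OF y(2)]]) simp
    finally show ?case using y(1) by simp
  next
    case (Suc b x)
    define k where "k = c - Suc b"
    have k: "Suc b + k = c" using Suc.prems by (simp add: k_def)
    have "component w (Suc b) x \<in> symbols (Suc m) k" unfolding symbols_def
    proof (intro CollectI allI)
      fix c'
      show "\<exists>y\<in>C (Suc m) (c' + k). weight_le w c' y \<and>
          component w c' y = component w c' (component w (Suc b) x)"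
      proof (cases "c' = Suc b")
        case True
        then show ?thesis using Suc.prems k by (intro bexI[of _ x]) (auto simp: component_same)
      next
        case False
        then show ?thesis by (intro bexI[of _ 0]) (auto simp: component_same zero)
      qed
    qed
    then have "component w (Suc b) x \<in> symbols m k" by (simp only: m)
    from this[unfolded symbols_def, THEN CollectD, THEN spec, of "Suc b"]
    obtain y where y: "y \<in> C m (Suc b + k)" "weight_le w (Suc b) y"
      "component w (Suc b) y = component w (Suc b) x"
      by (auto simp: component_same)
    have "y \<in> C m c" using y(1) k by simp
    have "x - y \<in> C (Suc m) c"
      using add[OF Suc.prems(1) uminus[OF chain[OF \<open>y \<in> C m c\<close>]]] by simp
    moreover have "weight_le w b (x - y)"
      using weight_le_diff[OF Suc.prems(2) y(2)] by (rule weight_le_pred) (simp add: component_diff y(3))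
    ultimately have "x - y \<in> C m c" using Suc.prems(3) by (intro Suc.IH) simp_all
    from add[OF this \<open>y \<in> C m c\<close>] show ?case by simp
  qed
  then show ?thesis using weight by blast
qed

end

text \<open>
  The graded form of Nakayama's lemma and Krull's intersection theorem that the theorem needs: if
  \<open>s init J \<subseteq> init P\<close> for a prime \<open>P\<close> strictly inside \<open>J\<close>, then a power of \<open>s\<close> lies in \<open>init P\<close>.
  Repeated division turns \<open>g\<close> into a sequence \<open>G m\<close> with \<open>s G m = G (m + 1)\<close> modulo \<open>P\<close> whose
  weights grow more slowly than expected. After inverting \<open>s\<close> the ideals generated by the \<open>G m\<close> form
  an ascending chain of filtered ideals. Once it is stationary, \<open>s\<^bsup>k\<^esup> G (m + 1) = r G m\<close> modulo \<open>P\<close>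
  with \<open>r\<close> of small weight, whence \<open>(s\<^bsup>k+1\<^esup> - r) G (m + 1) \<in> P\<close>. As \<open>P\<close> is prime, the first factor
  lies in \<open>P\<close>, and its leading form is \<open>s\<^bsup>k+1\<^esup>\<close>.
\<close>

lemma leading_annihilator:
  fixes J P :: "('n::finite, 'k::field) mpoly set"
  assumes J: "is_ideal J" and P: "is_prime P" and PJ: "P \<subseteq> J" and g: "g \<in> J" "g \<notin> P"
    and s: "weight_homogeneous w d s" and sJ: "\<And>x. x \<in> init_ideal w J \<Longrightarrow> s * x \<in> init_ideal w P"
  shows "\<exists>k. s ^ k \<in> init_ideal w P"
proof (cases "s \<in> P")
  case True
  then have "s ^ 1 \<in> init_ideal w P"
    using component_in_init[OF prime_ideal[OF P] True weight_homogeneous_le[OF s]] s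
    by (simp add: weight_homogeneous_iff)
  then show ?thesis by blast
next
  case s_notin: False
  have idP: "is_ideal P" by (rule prime_ideal[OF P])
  obtain a where a: "weight_le w a g" using weight_le_exists by blast
  define bounded where "bounded m x \<longleftrightarrow> (\<forall>e\<in>Poly_Mapping.keys x. weight w e + m \<le> a + m * d)"
    for m and x :: "('n, 'k) mpoly"
  have step: "\<exists>y. y \<in> J \<and> s * x - y \<in> P \<and> bounded (Suc m) y" if "x \<in> J" "bounded m x" for m x
    using leading_reduction_step[OF J idP PJ s sJ that(1), of m a] that(2) unfolding bounded_def by blast
  define next_elem where "next_elem m x = (SOME y. y \<in> J \<and> s * x - y \<in> P \<and> bounded (Suc m) y)" for m x
  define G where "G = rec_nat g next_elem"
  have G0: "G 0 = g" and G_Suc: "G (Suc m) = next_elem m (G m)" for m by (simp_all add: G_def)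
  have G: "G m \<in> J \<and> bounded m (G m)" for m
  proof (induction m)
    case 0
    then show ?case using g a by (simp add: G0 bounded_def weight_le_def)
  next
    case (Suc m)
    then show ?case unfolding G_Suc next_elem_def using someI_ex[OF step[of "G m" m]] by blast
  qed
  have G_step: "s * G m - G (Suc m) \<in> P" for m
    unfolding G_Suc next_elem_def using someI_ex[OF step[of "G m" m]] G[of m] by blast
  have G_notin: "G m \<notin> P" for m
  proof (induction m)
    case 0
    then show ?case using g by (simp add: G0)
  next
    case (Suc m)
    have "s * G m \<notin> P" using prime_mult[OF P] s_notin Suc by blast
    then show ?case using ideal_add[OF idP G_step[of m], of "G (Suc m)"] by auto
  qed
  \<comment> \<open>The ideal of \<open>G m\<close> after inverting \<open>s\<close>, filtered by the weight that \<open>x\<close> has as the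
    multiple \<open>r / s\<^bsup>k\<^esup>\<close> of \<open>G m\<close>, where \<open>G m\<close> counts with weight \<open>a + m d - m\<close>.\<close>
  define C where "C m c = {x. weight_le w c x \<and> (\<exists>k r. s ^ k * x - r * G m \<in> P \<and>
      (\<forall>e\<in>Poly_Mapping.keys r. weight w e + a + m * d \<le> c + k * d + m))}" for m c
  interpret filtered_chain C w
  proof
    show "0 \<in> C m c" for m c
      unfolding C_def using ideal_zero[OF idP] by (auto intro!: exI[of _ 0])
  next
    fix x y m c assume "x \<in> C m c" "y \<in> C m c"
    then obtain k r k' r' where x: "weight_le w c x" "s ^ k * x - r * G m \<in> P"
        "\<And>e. e \<in> Poly_Mapping.keys r \<Longrightarrow> weight w e + a + m * d \<le> c + k * d + m"
      and y: "weight_le w c y" "s ^ k' * y - r' * G m \<in> P"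
        "\<And>e. e \<in> Poly_Mapping.keys r' \<Longrightarrow> weight w e + a + m * d \<le> c + k' * d + m"
      unfolding C_def by blast
    let ?r = "s ^ k' * r + s ^ k * r'"
    have "s ^ (k + k') * (x + y) - ?r * G m = s ^ k' * (s ^ k * x - r * G m) + s ^ k * (s ^ k' * y - r' * G m)"
      by (simp add: algebra_simps power_add)
    also have "\<dots> \<in> P" using x y by (intro ideal_add[OF idP] ideal_mult[OF idP])
    finally have "s ^ (k + k') * (x + y) - ?r * G m \<in> P" .
    moreover have "weight w e + a + m * d \<le> c + (k + k') * d + m" if "e \<in> Poly_Mapping.keys ?r" for e
    proof -
      have power: "weight_homogeneous w (k * d) (s ^ k)" for k by (rule weight_homogeneous_power[OF s])
      have "e \<in> Poly_Mapping.keys (s ^ k' * r) \<union> Poly_Mapping.keys (s ^ k * r')"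
        by (rule subsetD[OF Poly_Mapping.keys_add that])
      then consider u v where "e = u + v" "u \<in> Poly_Mapping.keys (s ^ k')" "v \<in> Poly_Mapping.keys r"
        | u v where "e = u + v" "u \<in> Poly_Mapping.keys (s ^ k)" "v \<in> Poly_Mapping.keys r'"
        using keys_mult[of "s ^ k'" r] keys_mult[of "s ^ k" r'] by blast
      then show ?thesis
      proof cases
        case 1
        then have "weight w u = k' * d" using power[of k'] by (simp add: weight_homogeneous_def)
        with 1 x(3)[of v] show ?thesis by (simp add: add_mult_distrib)
      next
        case 2
        then have "weight w u = k * d" using power[of k] by (simp add: weight_homogeneous_def)
        with 2 y(3)[of v] show ?thesis by (simp add: add_mult_distrib)
      qed
    qed
    ultimately show "x + y \<in> C m c" unfolding C_def using weight_le_add[OF x(1) y(1)] by blast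
  next
    fix x m c b and t :: "('n, 'k) mpoly" assume "x \<in> C m c" and t: "weight_le w b t"
    then obtain k r where x: "weight_le w c x" "s ^ k * x - r * G m \<in> P"
        "\<And>e. e \<in> Poly_Mapping.keys r \<Longrightarrow> weight w e + a + m * d \<le> c + k * d + m"
      unfolding C_def by blast
    have "s ^ k * (t * x) - (t * r) * G m = t * (s ^ k * x - r * G m)" by (simp add: algebra_simps)
    also have "\<dots> \<in> P" by (rule ideal_mult[OF idP x(2)])
    finally have "s ^ k * (t * x) - (t * r) * G m \<in> P" .
    moreover have "weight w e + a + m * d \<le> (b + c) + k * d + m" if e: "e \<in> Poly_Mapping.keys (t * r)" for e
    proof -
      obtain u v where "e = u + v" "u \<in> Poly_Mapping.keys t" "v \<in> Poly_Mapping.keys r"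
        using e keys_mult[of t r] by blast
      moreover from this have "weight w u \<le> b" using t by (simp add: weight_le_def)
      ultimately show ?thesis using x(3)[of v] by simp
    qed
    ultimately show "t * x \<in> C m (b + c)" unfolding C_def using weight_le_mult[OF t x(1)] by blast
  next
    show "x \<in> C m c \<Longrightarrow> weight_le w c x" for x m c by (simp add: C_def)
  next
    fix x m c assume "x \<in> C m c"
    then obtain k r where x: "weight_le w c x" "s ^ k * x - r * G m \<in> P"
        "\<And>e. e \<in> Poly_Mapping.keys r \<Longrightarrow> weight w e + a + m * d \<le> c + k * d + m"
      unfolding C_def by blast
    have "weight w e + a + m * d \<le> Suc c + k * d + m" if "e \<in> Poly_Mapping.keys r" for e
      using x(3)[OF that] by simp
    then show "x \<in> C m (Suc c)"
      unfolding C_def using x(2) weight_le_mono[OF x(1), of "Suc c"] by auto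
    have "s ^ Suc k * x - r * G (Suc m) = s * (s ^ k * x - r * G m) + r * (s * G m - G (Suc m))"
      by (simp add: algebra_simps)
    also have "\<dots> \<in> P" using x(2) G_step by (intro ideal_add[OF idP] ideal_mult[OF idP])
    finally have "s ^ Suc k * x - r * G (Suc m) \<in> P" .
    moreover have "weight w e + a + Suc m * d \<le> c + Suc k * d + Suc m" if "e \<in> Poly_Mapping.keys r" for e
      using x(3)[OF that] by simp
    ultimately show "x \<in> C (Suc m) c" unfolding C_def using x(1) by blast
  qed
  obtain m where stable: "\<And>c. C (Suc m) c \<subseteq> C m c" using chain_stable by blast
  have "G (Suc m) \<noteq> 0" using G_notin[of "Suc m"] ideal_zero[OF idP] by auto
  then obtain e where "e \<in> Poly_Mapping.keys (G (Suc m))" by (metis all_not_in_conv keys_eq_empty)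
  then have large: "Suc m \<le> a + Suc m * d" using G[of "Suc m"] unfolding bounded_def by fastforce
  \<comment> \<open>The weight bound for \<open>G (m + 1)\<close>, a natural number because \<open>G (m + 1) \<noteq> 0\<close>.\<close>
  define c where "c = a + Suc m * d - Suc m"
  have c: "c + Suc m = a + Suc m * d" using large by (simp add: c_def)
  have "weight_le w c (G (Suc m))"
    unfolding weight_le_def
  proof
    fix e assume "e \<in> Poly_Mapping.keys (G (Suc m))"
    then have "weight w e + Suc m \<le> a + Suc m * d" using G[of "Suc m"] unfolding bounded_def by blast
    then show "weight w e \<le> c" using c by linarith
  qed
  moreover have "s ^ 0 * G (Suc m) - 1 * G (Suc m) \<in> P" using ideal_zero[OF idP] by simp
  moreover have "\<forall>e\<in>Poly_Mapping.keys (1 :: ('n, 'k) mpoly). weight w e + a + Suc m * d \<le> c + 0 * d + Suc m"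
    using c by simp
  ultimately have "G (Suc m) \<in> C (Suc m) c" unfolding C_def by blast
  then have "G (Suc m) \<in> C m c" using stable by blast
  then obtain k r where r: "s ^ k * G (Suc m) - r * G m \<in> P"
      "\<And>e. e \<in> Poly_Mapping.keys r \<Longrightarrow> weight w e + a + m * d \<le> c + k * d + m"
    unfolding C_def by blast
  have "(s ^ Suc k - r) * G (Suc m) = s * (s ^ k * G (Suc m) - r * G m) + r * (s * G m - G (Suc m))"
    by (simp add: algebra_simps)
  also have "\<dots> \<in> P" using r(1) G_step by (intro ideal_add[OF idP] ideal_mult[OF idP])
  finally have mem: "s ^ Suc k - r \<in> P" using prime_mult[OF P] G_notin by blast
  have r_small: "weight w e < Suc k * d" if "e \<in> Poly_Mapping.keys r" for e
    using r(2)[OF that] c by simp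
  have power: "weight_homogeneous w (Suc k * d) (s ^ Suc k)" by (rule weight_homogeneous_power[OF s])
  have "weight_le w (Suc k * d) (s ^ Suc k - r)"
    using weight_homogeneous_le[OF power] r_small
    by (intro weight_le_diff) (auto simp: weight_le_def less_imp_le)
  from component_in_init[OF idP mem this]
  have "component w (Suc k * d) (s ^ Suc k) - component w (Suc k * d) r \<in> init_ideal w P"
    unfolding component_diff .
  moreover have "component w (Suc k * d) r = 0"
  proof -
    have "Poly_Mapping.keys (component w (Suc k * d) r) = {}"
      using r_small unfolding keys_component by fastforce
    then show ?thesis by simp
  qed
  moreover have "component w (Suc k * d) (s ^ Suc k) = s ^ Suc k"
    using power by (simp only: weight_homogeneous_iff)
  ultimately have "s ^ Suc k \<in> init_ideal w P" by simp
  then show ?thesis by blast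
qed

section \<open>Degeneration of compatibly split ideals\<close>

lemma init_ideal_mult:
  fixes I J :: "('n::finite, 'k::field) mpoly set"
  assumes I: "is_ideal I" and J: "is_ideal J"
    and x: "x \<in> init_ideal w I" and y: "y \<in> init_ideal w J"
  shows "x * y \<in> init_ideal w (I \<inter> J)"
  unfolding mem_init_ideal[OF ideal_Int[OF I J]]
proof
  fix d
  obtain g where g: "\<forall>i. g i \<in> I \<and> weight_le w i (g i) \<and> component w i (g i) = component w i x"
    using x[unfolded mem_init_ideal[OF I]] by metis
  obtain h where h: "\<forall>i. h i \<in> J \<and> weight_le w i (h i) \<and> component w i (h i) = component w i y"
    using y[unfolded mem_init_ideal[OF J]] by metis
  define z where "z = (\<Sum>i\<le>d. g i * h (d - i))"
  have "z \<in> I \<inter> J"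
    unfolding z_def using g h by (intro ideal_sum[OF ideal_Int[OF I J]]) (auto intro: ideal_mult[OF J] ideal_mult_right[OF I])
  moreover have "weight_le w d z"
    unfolding z_def
  proof (rule weight_le_sum)
    fix i assume "i \<in> {..d}"
    then show "weight_le w d (g i * h (d - i))"
      using weight_le_mult[of w i "g i" "d - i" "h (d - i)"] g h by simp
  qed
  moreover have "component w d z = component w d (x * y)"
    unfolding z_def component_sum component_mult[of w d x y]
  proof (rule sum.cong)
    fix i assume "i \<in> {..d}"
    then show "component w d (g i * h (d - i)) = component w i x * component w (d - i) y"
      using component_mult_top[of w i "g i" "d - i" "h (d - i)"] g h by simp
  qed simp
  ultimately show "\<exists>z\<in>I \<inter> J. weight_le w d z \<and> component w d z = component w d (x * y)" by blast
qed

lemma one_notin_init: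
  assumes "is_ideal I" "1 \<notin> I"
  shows "1 \<notin> init_ideal w (I :: ('n::finite, 'k::field) mpoly set)"
proof
  assume "1 \<in> init_ideal w I"
  then have "init_ideal w I = UNIV" using ideal_one[OF ideal_init_ideal[OF assms(1)]] by simp
  then have "UNIV \<subseteq> I" by (intro init_ideal_reflects_subset[OF assms(1) ideal_UNIV]) auto
  with assms(2) show False by auto
qed

text \<open>
  Here \<open>\<phi>\<close> acts on the polynomial ring and \<open>\<phi>'\<close> on the associated graded ring of the weight
  filtration: on top components \<open>\<phi>\<close> induces \<open>\<phi>'\<close>.
\<close>

locale degeneration =
  generic: mpoly_splitting p \<phi> + special: mpoly_splitting p \<phi>'
  for p and w :: "'n::finite \<Rightarrow> nat" and \<phi> \<phi>' :: "('n, 'k::field) mpoly \<Rightarrow> ('n, 'k) mpoly" +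
  assumes weight_le_splitting: "weight_le w (p * c) g \<Longrightarrow> weight_le w c (\<phi> g)"
    and component_splitting: "weight_le w (p * c) g \<Longrightarrow> component w c (\<phi> g) = \<phi>' (component w (p * c) g)"
    and graded_special: "graded_map p w \<phi>'"
    and finite_generic: "finite {I. compatibly_split \<phi> I}"
    and finite_special: "finite {I. compatibly_split \<phi>' I}"
begin

lemma init_compatibly_split:
  assumes I: "compatibly_split \<phi> I"
  shows "compatibly_split \<phi>' (init_ideal w I)"
proof (rule compatibly_splitI)
  have idI: "is_ideal I" using I by (rule compatibly_split_ideal)
  then show "is_ideal (init_ideal w I)" by (rule ideal_init_ideal)
  fix x assume x: "x \<in> init_ideal w I"
  show "\<phi>' x \<in> init_ideal w I"
    unfolding mem_init_ideal[OF idI]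
  proof
    fix d
    obtain g where g: "g \<in> I" "weight_le w (p * d) g" "component w (p * d) g = component w (p * d) x"
      using x mem_init_ideal[OF idI] by blast
    have "component w d (\<phi> g) = component w d (\<phi>' x)"
      using component_splitting[OF g(2)] g(3) graded_special by (simp add: graded_map_def)
    then show "\<exists>g\<in>I. weight_le w d g \<and> component w d g = component w d (\<phi>' x)"
      using compatibly_split_mem[OF I g(1)] weight_le_splitting[OF g(2)] by blast
  qed
qed

text \<open>
  A square of an element of the right-hand side lies in the left-hand side, and the left-hand side is
  compatibly split, hence radical.
\<close>

lemma init_Int:
  assumes "compatibly_split \<phi> I" "compatibly_split \<phi> J"
  shows "init_ideal w (I \<inter> J) = init_ideal w I \<inter> init_ideal w J"
proof
  show "init_ideal w (I \<inter> J) \<subseteq> init_ideal w I \<inter> init_ideal w J"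
    by (simp add: init_ideal_mono)
  show "init_ideal w I \<inter> init_ideal w J \<subseteq> init_ideal w (I \<inter> J)"
  proof
    fix x assume "x \<in> init_ideal w I \<inter> init_ideal w J"
    then have "x * x \<in> init_ideal w (I \<inter> J)"
      using assms by (intro init_ideal_mult compatibly_split_ideal) auto
    then show "x \<in> init_ideal w (I \<inter> J)"
      using special.square_mem init_compatibly_split compatibly_split_Int[OF assms] by blast
  qed
qed

text \<open>
  Suppose \<open>a \<in> I\<close> and \<open>b \<in> J\<close> have larger weight than \<open>a + b\<close>. Then their top components cancel,
  so they lie in \<open>init I \<inter> init J = init (I \<inter> J)\<close>. Moving an element of \<open>I \<inter> J\<close> from \<open>a\<close> to \<open>b\<close>
  lowers both weights, until no cancellation is left.
\<close>

lemma init_plus_subset: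
  assumes I: "compatibly_split \<phi> I" and J: "compatibly_split \<phi> J" and P: "is_ideal P"
    and IP: "init_ideal w I \<subseteq> P" and JP: "init_ideal w J \<subseteq> P"
  shows "init_ideal w (ideal_plus I J) \<subseteq> P"
proof -
  have idI: "is_ideal I" and idJ: "is_ideal J" using I J by (auto intro: compatibly_split_ideal)
  have lead: "component w d (a + b) \<in> P"
    if "a \<in> I" "b \<in> J" "weight_le w c a" "weight_le w c b" "weight_le w d (a + b)" for a b c d
    using that
  proof (induction c arbitrary: a b)
    case 0
    have "weight_le w d a" "weight_le w d b" using 0 weight_le_mono by blast+
    then show ?case
      using 0 component_in_init[OF idI] component_in_init[OF idJ] IP JP ideal_add[OF P]
      unfolding component_add by blast
  next
    case (Suc c)
    show ?case
    proof (cases "Suc c \<le> d")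
      case True
      have "weight_le w d a" "weight_le w d b" using Suc.prems True weight_le_mono by blast+
      then show ?thesis
        using Suc.prems component_in_init[OF idI] component_in_init[OF idJ] IP JP ideal_add[OF P]
        unfolding component_add by blast
    next
      case False
      have cancel: "component w (Suc c) a = - component w (Suc c) b"
        using component_eq_0[OF Suc.prems(5), of "Suc c"] False
        by (simp add: component_add eq_neg_iff_add_eq_0)
      have "component w (Suc c) a \<in> init_ideal w I"
        using Suc.prems by (intro component_in_init[OF idI])
      moreover have "component w (Suc c) a \<in> init_ideal w J"
        unfolding cancel using Suc.prems
        by (intro ideal_uminus[OF ideal_init_ideal[OF idJ]] component_in_init[OF idJ])
      ultimately have "component w (Suc c) a \<in> init_ideal w (I \<inter> J)" by (simp add: init_Int[OF I J])
      then obtain k where k: "k \<in> I \<inter> J" "weight_le w (Suc c) k"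
          "component w (Suc c) k = component w (Suc c) a"
        by (rule init_homogeneous_obtains[OF ideal_Int[OF idI idJ] _ weight_homogeneous_component])
      have "component w d ((a - k) + (b + k)) \<in> P"
      proof (rule Suc.IH)
        show "a - k \<in> I" using k Suc.prems ideal_diff[OF idI] by simp
        show "b + k \<in> J" using k Suc.prems ideal_add[OF idJ] by simp
        show "weight_le w c (a - k)"
          using weight_le_diff[OF Suc.prems(3) k(2)] by (rule weight_le_pred) (simp add: component_diff k(3))
        show "weight_le w c (b + k)"
          using weight_le_add[OF Suc.prems(4) k(2)]
          by (rule weight_le_pred) (simp add: component_add k(3) cancel)
        show "weight_le w d ((a - k) + (b + k))" using Suc.prems(5) by simp
      qed
      then show ?thesis by simp
    qed
  qed
  show ?thesis
  proof
    fix x assume x: "x \<in> init_ideal w (ideal_plus I J)"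
    have "component w d x \<in> P" for d
    proof -
      obtain h where h: "h \<in> ideal_plus I J" "weight_le w d h" "component w d h = component w d x"
        using x mem_init_ideal[OF ideal_ideal_plus[OF idI idJ]] by blast
      obtain a b where ab: "h = a + b" "a \<in> I" "b \<in> J" using h(1) by (auto simp: ideal_plus_def)
      obtain c c' where "weight_le w c a" "weight_le w c' b" using weight_le_exists by metis
      then have "weight_le w (max c c') a" "weight_le w (max c c') b"
        using weight_le_mono max.cobounded1 max.cobounded2 by blast+
      then show ?thesis using lead[of a b "max c c'" d] ab h by simp
    qed
    moreover obtain c where "weight_le w c x" using weight_le_exists by blast
    ultimately have "(\<Sum>d\<le>c. component w d x) \<in> P" by (intro ideal_sum[OF P])
    then show "x \<in> P" using sum_components[OF \<open>weight_le w c x\<close>] by simp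
  qed
qed

text \<open>
  By \<open>init_plus_subset\<close> this union is directed, so it is the largest compatibly split ideal whose
  initial ideal lies in \<open>P\<close>.
\<close>

definition lift :: "('n, 'k) mpoly set \<Rightarrow> ('n, 'k) mpoly set" where
  "lift P = \<Union>{I. compatibly_split \<phi> I \<and> init_ideal w I \<subseteq> P}"

lemma lift_greatest: "compatibly_split \<phi> I \<Longrightarrow> init_ideal w I \<subseteq> P \<Longrightarrow> I \<subseteq> lift P"
  by (auto simp: lift_def)

lemma lift_memE:
  assumes "x \<in> lift P"
  obtains I where "compatibly_split \<phi> I" "init_ideal w I \<subseteq> P" "x \<in> I"
  using assms unfolding lift_def by blast

lemma zero_compatibly_split: "compatibly_split \<phi> {0}"
  by (simp add: compatibly_split_iff is_ideal_def)

lemma init_zero_subset: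
  fixes P :: "('n, 'k) mpoly set"
  assumes "is_ideal P" shows "init_ideal w {0} \<subseteq> P"
proof -
  have "leading_form w ` {0} \<subseteq> {0 :: ('n, 'k) mpoly}" by (simp add: leading_form_def)
  then have "init_ideal w {0} \<subseteq> {0 :: ('n, 'k) mpoly}"
    unfolding init_ideal_def by (rule mpoly_vs.span_minimal) (rule mpoly_vs.subspace_single_0)
  moreover have "{0} \<subseteq> P" using ideal_zero[OF assms] by simp
  ultimately show ?thesis by (rule subset_trans)
qed

lemma lift_compatibly_split:
  assumes P: "is_ideal P"
  shows "compatibly_split \<phi> (lift P)"
proof (rule compatibly_splitI)
  show "is_ideal (lift P)"
  proof (rule is_idealI)
    show "0 \<in> lift P"
      using lift_greatest[OF zero_compatibly_split init_zero_subset[OF P]] by simp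
  next
    fix x y assume "x \<in> lift P" "y \<in> lift P"
    then obtain I J where I: "compatibly_split \<phi> I" "init_ideal w I \<subseteq> P" "x \<in> I"
      and J: "compatibly_split \<phi> J" "init_ideal w J \<subseteq> P" "y \<in> J"
      using lift_memE by metis
    have "ideal_plus I J \<subseteq> lift P"
      using I J P by (intro lift_greatest generic.compatibly_split_plus init_plus_subset)
    moreover have "x + y \<in> ideal_plus I J" using I J by (auto simp: ideal_plus_def)
    ultimately show "x + y \<in> lift P" by blast
  next
    fix x r assume "x \<in> lift P"
    then obtain I where I: "compatibly_split \<phi> I" "init_ideal w I \<subseteq> P" "x \<in> I" by (rule lift_memE)
    then have "r * x \<in> I" using compatibly_split_ideal ideal_mult by blast
    then show "r * x \<in> lift P" using lift_greatest[OF I(1,2)] by blast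
  qed
  fix x assume "x \<in> lift P"
  then obtain I where I: "compatibly_split \<phi> I" "init_ideal w I \<subseteq> P" "x \<in> I" by (rule lift_memE)
  then have "\<phi> x \<in> I" using compatibly_split_mem by blast
  then show "\<phi> x \<in> lift P" using lift_greatest[OF I(1,2)] by blast
qed

lemma init_lift_subset:
  assumes P: "is_ideal P"
  shows "init_ideal w (lift P) \<subseteq> P"
proof
  have idL: "is_ideal (lift P)" using lift_compatibly_split[OF P] by (rule compatibly_split_ideal)
  fix x assume x: "x \<in> init_ideal w (lift P)"
  have "component w d x \<in> P" for d
  proof -
    obtain g where g: "g \<in> lift P" "weight_le w d g" "component w d g = component w d x"
      using x mem_init_ideal[OF idL] by blast
    obtain I where I: "compatibly_split \<phi> I" "init_ideal w I \<subseteq> P" "g \<in> I" using g(1) by (rule lift_memE)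
    have "component w d g \<in> init_ideal w I"
      by (rule component_in_init[OF compatibly_split_ideal[OF I(1)] I(3) g(2)])
    then show ?thesis using I(2) g(3) by auto
  qed
  moreover obtain c where "weight_le w c x" using weight_le_exists by blast
  ultimately have "(\<Sum>d\<le>c. component w d x) \<in> P" by (intro ideal_sum[OF P])
  then show "x \<in> P" using sum_components[OF \<open>weight_le w c x\<close>] by simp
qed

lemma lift_mono: "P \<subseteq> Q \<Longrightarrow> lift P \<subseteq> lift Q"
  unfolding lift_def by blast

text \<open>
  If \<open>a b \<in> lift P\<close>, the ideal quotients \<open>B = (lift P : a)\<close> and \<open>A = (lift P : B)\<close> have intersection
  \<open>lift P\<close>. Since \<open>P\<close> is prime and \<open>init A \<inter> init B \<subseteq> P\<close>, one of \<open>init A\<close> and \<open>init B\<close> lies in \<open>P\<close>,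
  and then \<open>A\<close> or \<open>B\<close> lies in \<open>lift P\<close> by maximality.
\<close>

lemma lift_prime:
  assumes P: "is_prime P"
  shows "is_prime (lift P)"
  unfolding is_prime_def
proof (intro conjI allI impI)
  let ?K = "lift P"
  have idP: "is_ideal P" by (rule prime_ideal[OF P])
  have split: "compatibly_split \<phi> ?K" by (rule lift_compatibly_split[OF idP])
  then show idK: "is_ideal ?K" by (rule compatibly_split_ideal)
  show "1 \<notin> ?K"
    using one_in_init[OF idK, of w] init_lift_subset[OF idP] prime_one[OF P] by blast
  fix a b assume ab: "a * b \<in> ?K"
  define B where "B = colon ?K {a}"
  define A where "A = colon ?K B"
  have A: "compatibly_split \<phi> A" and B: "compatibly_split \<phi> B"
    unfolding A_def B_def by (intro generic.compatibly_split_colon split)+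
  have "b \<in> B" using ab by (simp add: B_def colon_def mult.commute)
  have "a \<in> A" by (auto simp: A_def B_def colon_def mult.commute)
  have "A \<inter> B \<subseteq> ?K"
  proof
    fix x assume "x \<in> A \<inter> B"
    then have "x * x \<in> ?K" by (simp add: A_def colon_def)
    then show "x \<in> ?K" by (rule generic.square_mem[OF split])
  qed
  then have "init_ideal w A \<inter> init_ideal w B \<subseteq> P"
    using init_Int[OF A B] init_ideal_mono[of "A \<inter> B" ?K w] init_lift_subset[OF idP] by blast
  then have "init_ideal w A \<subseteq> P \<or> init_ideal w B \<subseteq> P"
    using A B by (intro prime_Int_subset[OF P] ideal_init_ideal compatibly_split_ideal)
  then show "a \<in> ?K \<or> b \<in> ?K"
    using lift_greatest[OF A, of P] lift_greatest[OF B, of P] \<open>a \<in> A\<close> \<open>b \<in> B\<close> by blast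
qed

lemma special_graded: "compatibly_split \<phi>' I \<Longrightarrow> graded w I"
  using special.graded_compatibly_split graded_special by blast

text \<open>
  Let \<open>Q\<close> be a compatibly split prime above \<open>init Y\<close> that contains no \<open>init J \<inter> L\<close> with
  \<open>J\<close> strictly larger than \<open>Y\<close> and \<open>L\<close> not inside \<open>P\<close>. Taking for \<open>J\<close> the whole ring gives
  \<open>Q \<subseteq> P\<close>; taking for \<open>L\<close> the whole ring gives \<open>lift Q = Y\<close>. Such a \<open>Q\<close> exists unless some
  \<open>init J \<inter> L\<close> lies in \<open>init Y\<close>. But then a homogeneous \<open>s \<in> L\<close> outside \<open>P\<close> satisfies
  \<open>s init J \<subseteq> init Y\<close>, and \<open>leading_annihilator\<close> puts a power of \<open>s\<close> into \<open>init Y \<subseteq> P\<close>.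
\<close>

lemma prime_between_exists:
  assumes Y: "is_prime Y" "compatibly_split \<phi> Y" and P: "is_prime P" "init_ideal w Y \<subseteq> P"
  obtains Q where "is_prime Q" "compatibly_split \<phi>' Q" "Q \<subseteq> P" "lift Q = Y"
proof -
  define \<F> where "\<F> = {init_ideal w J \<inter> L |J L. compatibly_split \<phi> J \<and> Y \<subset> J \<and>
      compatibly_split \<phi>' L \<and> \<not> L \<subseteq> P}"
  have idY: "is_ideal Y" by (rule prime_ideal[OF Y(1)])
  have memF: "init_ideal w J \<inter> L \<in> \<F>"
    if "compatibly_split \<phi> J" "Y \<subset> J" "compatibly_split \<phi>' L" "\<not> L \<subseteq> P" for J L
    unfolding \<F>_def using that by blast
  have UNIV_P: "\<not> UNIV \<subseteq> P" using prime_one[OF P(1)] by auto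
  have UNIV_Y: "Y \<subset> UNIV" using prime_one[OF Y(1)] by auto
  have init_UNIV: "init_ideal w (UNIV :: ('n, 'k) mpoly set) = UNIV"
    by (rule ideal_one[OF ideal_init_ideal[OF ideal_UNIV] one_in_init[OF ideal_UNIV]]) simp
  obtain Q where Q: "is_prime Q" "compatibly_split \<phi>' Q" "init_ideal w Y \<subseteq> Q"
    and avoid: "\<And>J. J \<in> \<F> \<Longrightarrow> \<not> J \<subseteq> Q"
  proof (rule special.prime_avoiding_exists[OF finite_special init_compatibly_split[OF Y(2)], of \<F>])
    show "UNIV \<in> \<F>"
      using memF[OF compatibly_split_UNIV UNIV_Y compatibly_split_UNIV UNIV_P] by (simp add: init_UNIV)
  next
    fix K assume "K \<in> \<F>"
    then obtain J L where K: "K = init_ideal w J \<inter> L" and JL: "compatibly_split \<phi> J" "Y \<subset> J"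
        "compatibly_split \<phi>' L" "\<not> L \<subseteq> P"
      unfolding \<F>_def by blast
    show "compatibly_split \<phi>' K"
      unfolding K using JL by (intro compatibly_split_Int init_compatibly_split)
    show "\<not> K \<subseteq> init_ideal w Y"
    proof
      assume sub: "K \<subseteq> init_ideal w Y"
      obtain s d where s: "s \<in> L" "weight_homogeneous w d s" "s \<notin> P"
        using graded_not_subset[OF special_graded[OF JL(3)] prime_ideal[OF P(1)] JL(4)] by blast
      obtain g where g: "g \<in> J" "g \<notin> Y" using JL(2) by blast
      have idJ: "is_ideal J" by (rule compatibly_split_ideal[OF JL(1)])
      have "\<exists>k. s ^ k \<in> init_ideal w Y"
      proof (rule leading_annihilator[OF idJ Y(1) _ g s(2)])
        show "Y \<subseteq> J" using JL(2) by blast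
        fix x assume "x \<in> init_ideal w J"
        then have "s * x \<in> K"
          unfolding K using s(1) ideal_mult[OF ideal_init_ideal[OF idJ]]
            ideal_mult_right[OF compatibly_split_ideal[OF JL(3)]] by blast
        then show "s * x \<in> init_ideal w Y" using sub by blast
      qed
      then show False using prime_power[OF P(1)] P(2) s(3) by blast
    qed
  next
    fix K K' assume "K \<in> \<F>" "K' \<in> \<F>"
    then obtain J L J' L' where K: "K = init_ideal w J \<inter> L" "compatibly_split \<phi> J" "Y \<subset> J"
        "compatibly_split \<phi>' L" "\<not> L \<subseteq> P"
      and K': "K' = init_ideal w J' \<inter> L'" "compatibly_split \<phi> J'" "Y \<subset> J'"
        "compatibly_split \<phi>' L'" "\<not> L' \<subseteq> P"
      unfolding \<F>_def by blast
    have "\<not> J \<inter> J' \<subseteq> Y"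
      using prime_Int_subset[OF Y(1), of J J'] K K' compatibly_split_ideal by blast
    then have "Y \<subset> J \<inter> J'" using K K' by blast
    moreover have "\<not> L \<inter> L' \<subseteq> P"
      using prime_Int_subset[OF P(1), of L L'] K K' compatibly_split_ideal by blast
    ultimately have "init_ideal w (J \<inter> J') \<inter> (L \<inter> L') \<in> \<F>"
      using K K' by (intro memF compatibly_split_Int)
    moreover have "init_ideal w (J \<inter> J') \<inter> (L \<inter> L') = K \<inter> K'"
      using init_Int[OF K(2) K'(2)] K(1) K'(1) by blast
    ultimately show "K \<inter> K' \<in> \<F>" by simp
  qed blast
  have "Q \<subseteq> P"
  proof (rule ccontr)
    assume "\<not> Q \<subseteq> P"
    then have "Q \<in> \<F>" using memF[OF compatibly_split_UNIV UNIV_Y Q(2)] by (simp add: init_UNIV)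
    then show False using avoid by blast
  qed
  moreover have "lift Q = Y"
  proof
    show "Y \<subseteq> lift Q" by (rule lift_greatest[OF Y(2) Q(3)])
    show "lift Q \<subseteq> Y"
    proof (rule ccontr)
      assume "\<not> lift Q \<subseteq> Y"
      then have "Y \<subset> lift Q" using \<open>Y \<subseteq> lift Q\<close> by blast
      from memF[OF lift_compatibly_split[OF prime_ideal[OF Q(1)]] this compatibly_split_UNIV UNIV_P]
      have "init_ideal w (lift Q) \<in> \<F>" by simp
      then show False using avoid init_lift_subset[OF prime_ideal[OF Q(1)]] by blast
    qed
  qed
  ultimately show thesis using that Q by blast
qed

lemma split_varieties_iff: "Y \<in> split_varieties \<psi> \<longleftrightarrow> is_prime Y \<and> compatibly_split \<psi> Y"
  by (simp add: split_varieties_def irreducible_variety_def primeideal_iff_is_prime)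

lemma minimal_degenerating_to_iff:
  assumes "is_prime Y'"
  shows "minimal_degenerating_to w (split_varieties \<phi>) Y' Y \<longleftrightarrow> Y = lift Y'"
proof -
  have "is_ideal Y'" by (rule prime_ideal[OF assms])
  note L = lift_prime[OF assms] lift_compatibly_split[OF this] init_lift_subset[OF this]
  have mem: "lift Y' \<in> split_varieties \<phi>" using L by (simp add: split_varieties_iff)
  show ?thesis
  proof
    assume Y: "minimal_degenerating_to w (split_varieties \<phi>) Y' Y"
    then have "compatibly_split \<phi> Y" "init_ideal w Y \<subseteq> Y'"
      by (auto simp: minimal_degenerating_to_def split_varieties_iff subscheme_le_def)
    then have "Y \<subseteq> lift Y'" by (rule lift_greatest)
    then show "Y = lift Y'"
      using Y mem L(3) by (auto simp: minimal_degenerating_to_def subscheme_le_def)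
  next
    assume Y: "Y = lift Y'"
    show "minimal_degenerating_to w (split_varieties \<phi>) Y' Y"
      unfolding minimal_degenerating_to_def subscheme_le_def Y
    proof (intro conjI ballI impI mem L(3))
      fix Z assume "Z \<in> split_varieties \<phi>" and Z: "init_ideal w Z \<subseteq> Y' \<and> lift Y' \<subseteq> Z"
      then have "Z \<subseteq> lift Y'" by (intro lift_greatest) (auto simp: split_varieties_iff)
      with Z show "Z = lift Y'" by blast
    qed
  qed
qed

lemma degeneration_map_eq:
  "is_prime Y' \<Longrightarrow> degeneration_map w (split_varieties \<phi>) Y' = lift Y'"
  unfolding degeneration_map_def by (intro the_equality) (simp_all add: minimal_degenerating_to_iff)

text \<open>
  Any compatibly split prime above \<open>init Y\<close> can serve as the upper bound in \<open>prime_between_exists\<close>.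
\<close>

lemma lift_surjective:
  assumes "is_prime Y" "compatibly_split \<phi> Y"
  obtains Q where "is_prime Q" "compatibly_split \<phi>' Q" "lift Q = Y"
proof -
  obtain P where "is_prime P" "init_ideal w Y \<subseteq> P"
    using special.prime_separating_exists[OF finite_special init_compatibly_split[OF assms(2)]
        one_notin_init[OF prime_ideal[OF assms(1)] prime_one[OF assms(1)]]] by metis
  from prime_between_exists[OF assms this] show thesis using that by metis
qed

end

section \<open>Hilbert functions by counting over a finite field\<close>

lemma card_image_kernel:
  fixes T :: "'a::ab_group_add \<Rightarrow> 'b::ab_group_add"
  assumes fin: "finite A" and diff: "\<And>a b. a \<in> A \<Longrightarrow> b \<in> A \<Longrightarrow> a - b \<in> A"
    and T: "\<And>a b. a \<in> A \<Longrightarrow> b \<in> A \<Longrightarrow> T (a - b) = T a - T b"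
  shows "card A = card (T ` A) * card {a \<in> A. T a = 0}"
proof -
  have fiber: "card {a \<in> A. T a = y} = card {a \<in> A. T a = 0}" if y: "y \<in> T ` A" for y
  proof -
    obtain b where b: "b \<in> A" "y = T b" using y by blast
    have zero: "0 \<in> A" using diff[OF b(1) b(1)] by simp
    have neg: "- a \<in> A" if "a \<in> A" for a using diff[OF zero that] by simp
    have add: "a + c \<in> A" if "a \<in> A" "c \<in> A" for a c using diff[OF that(1) neg[OF that(2)]] by simp
    have T_add: "T (a + b) = T a + T b" if "a \<in> A" for a
      using T[OF add[OF that b(1)] b(1)] by simp
    have "bij_betw (\<lambda>a. a - b) {a \<in> A. T a = y} {a \<in> A. T a = 0}"
      by (rule bij_betw_byWitness[where f' = "\<lambda>a. a + b"])
        (use b diff add T T_add in auto)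
    then show ?thesis by (rule bij_betw_same_card)
  qed
  have "card A = (\<Sum>y\<in>T ` A. card {a \<in> A. T a = y})"
    using sum.image_gen[OF fin, of "\<lambda>_. 1::nat" T] by simp
  also have "\<dots> = (\<Sum>y\<in>T ` A. card {a \<in> A. T a = 0})" by (intro sum.cong refl fiber)
  finally show ?thesis by simp
qed

text \<open>
  The kernel of \<open>(a, b) \<mapsto> a + T b\<close> is the graph of \<open>- T\<close> over the \<open>b\<close> with \<open>T b \<in> A\<close>. With \<open>T\<close> a
  multiplication or the identity, this one count yields all exact sequences used below.
\<close>

lemma card_sum_map:
  fixes A B :: "'a::ab_group_add set" and T :: "'a \<Rightarrow> 'a"
  assumes fin: "finite A" "finite B" and A: "\<And>a b. a \<in> A \<Longrightarrow> b \<in> A \<Longrightarrow> a - b \<in> A" "0 \<in> A"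
    and B: "\<And>a b. a \<in> B \<Longrightarrow> b \<in> B \<Longrightarrow> a - b \<in> B" and T: "\<And>a b. T (a - b) = T a - T b"
  shows "card A * card B = card {a + T b |a b. a \<in> A \<and> b \<in> B} * card {b \<in> B. T b \<in> A}"
proof -
  let ?S = "\<lambda>(a, b). a + T b"
  let ?K = "{x \<in> A \<times> B. ?S x = 0}"
  have neg: "- a \<in> A" if "a \<in> A" for a using A(1)[OF A(2) that] by simp
  have "bij_betw snd ?K {b \<in> B. T b \<in> A}"
  proof (rule bij_betw_byWitness[where f' = "\<lambda>b. (- T b, b)"])
    show "\<forall>x\<in>?K. (- T (snd x), snd x) = x" by (auto simp: add_eq_0_iff)
    show "snd ` ?K \<subseteq> {b \<in> B. T b \<in> A}" by (auto simp: add_eq_0_iff neg)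
    show "(\<lambda>b. (- T b, b)) ` {b \<in> B. T b \<in> A} \<subseteq> ?K" by (auto simp: neg)
  qed simp
  then have "card ?K = card {b \<in> B. T b \<in> A}" by (rule bij_betw_same_card)
  moreover have "?S ` (A \<times> B) = {a + T b |a b. a \<in> A \<and> b \<in> B}" by auto
  moreover have "card (A \<times> B) = card (?S ` (A \<times> B)) * card ?K"
    by (rule card_image_kernel) (auto simp: fin A B T algebra_simps)
  ultimately show ?thesis by (simp add: card_cartesian_product)
qed

lemma card_subspace:
  fixes V :: "('n, 'k::{field, finite}) mpoly set"
  assumes V: "mpoly_vs.subspace V" and fin: "finite V"
  shows "card V = CARD('k) ^ mpoly_vs.dim V"
proof -
  obtain B where B: "B \<subseteq> V" "mpoly_vs.independent B" "V \<subseteq> mpoly_vs.span B" "card B = mpoly_vs.dim V"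
    using mpoly_vs.basis_exists by blast
  have finB: "finite B" using B(1) fin by (rule finite_subset)
  have span: "mpoly_vs.span B = V"
    using B V by (intro antisym mpoly_vs.span_minimal)
  let ?L = "\<lambda>c. \<Sum>b\<in>B. scalar_mult (c b) b"
  let ?F = "Pi\<^sub>E B (\<lambda>_. UNIV :: 'k set)"
  have inj: "inj_on ?L ?F"
  proof (rule inj_onI)
    fix c c' assume c: "c \<in> ?F" "c' \<in> ?F" and eq: "?L c = ?L c'"
    have "(\<Sum>b\<in>B. scalar_mult (c b - c' b) b) = 0"
      using eq by (simp add: mpoly_vs.scale_left_diff_distrib sum_subtractf)
    then have "c b - c' b = 0" if "b \<in> B" for b
      using mpoly_vs.independentD[OF B(2) finB subset_refl, of "\<lambda>b. c b - c' b" b] that by blast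
    then show "c = c'" using c by (intro PiE_ext) auto
  qed
  have image: "?L ` ?F = V"
  proof -
    have "?L ` ?F = range ?L"
    proof
      show "range ?L \<subseteq> ?L ` ?F"
      proof
        fix x assume "x \<in> range ?L"
        then obtain c where "x = ?L c" by blast
        also have "?L c = ?L (restrict c B)" by (intro sum.cong) auto
        finally have "x = ?L (restrict c B)" .
        moreover have "restrict c B \<in> ?F" by simp
        ultimately show "x \<in> ?L ` ?F" by (rule image_eqI)
      qed
    qed auto
    also have "range ?L = mpoly_vs.span B" by (rule mpoly_vs.span_finite[OF finB, symmetric])
    also note span
    finally show ?thesis .
  qed
  have "card V = card ?F" using card_image[OF inj] unfolding image .
  then show ?thesis using B(4) finB by (simp add: card_PiE)
qed

text \<open>
  For finite \<open>U\<close> this is the dimension of \<open>U / (I \<inter> U)\<close>.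
\<close>

definition codim :: "('n, 'k::field) mpoly set \<Rightarrow> ('n, 'k) mpoly set \<Rightarrow> nat" where
  "codim U I = mpoly_vs.dim U - mpoly_vs.dim (I \<inter> U)"

lemma CARD_field_ge_2: "CARD('k::{field, finite}) \<ge> 2"
proof -
  have "card {0 :: 'k, 1} \<le> CARD('k)" by (intro card_mono) auto
  then show ?thesis by simp
qed

lemma ideal_subspace: "is_ideal I \<Longrightarrow> mpoly_vs.subspace (I :: ('n::finite, 'k::field) mpoly set)"
  unfolding mpoly_vs.subspace_def by (simp add: ideal_zero ideal_add ideal_scalar_mult)

lemma card_codim:
  fixes U I :: "('n::finite, 'k::{field, finite}) mpoly set"
  assumes U: "mpoly_vs.subspace U" and fin: "finite U" and I: "is_ideal I"
  shows "card U = card (I \<inter> U) * CARD('k) ^ codim U I"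
proof -
  have IU: "mpoly_vs.subspace (I \<inter> U)"
    using ideal_subspace[OF I] U by (rule mpoly_vs.subspace_inter)
  have finIU: "finite (I \<inter> U)" using fin by simp
  have "card (I \<inter> U) \<le> card U" using fin by (intro card_mono) auto
  then have "CARD('k) ^ mpoly_vs.dim (I \<inter> U) \<le> CARD('k) ^ mpoly_vs.dim U"
    using card_subspace[OF IU finIU] card_subspace[OF U fin] by simp
  then have "mpoly_vs.dim (I \<inter> U) \<le> mpoly_vs.dim U"
    using CARD_field_ge_2[where 'k='k] by (subst (asm) power_increasing_iff) auto
  then show ?thesis
    unfolding card_subspace[OF IU finIU] card_subspace[OF U fin] codim_def
    by (simp flip: power_add)
qed

definition forms :: "nat \<Rightarrow> ('n::finite, 'k::field) mpoly set" where
  "forms d = {g. weight_homogeneous (\<lambda>_. 1) d g}"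

definition bounded_polys :: "nat \<Rightarrow> ('n::finite, 'k::field) mpoly set" where
  "bounded_polys d = {g. weight_le (\<lambda>_. 1) d g}"

lemma subspace_forms: "mpoly_vs.subspace (forms d)"
  unfolding mpoly_vs.subspace_def forms_def
  by (auto simp: weight_homogeneous_iff component_add component_scalar_mult)

lemma subspace_bounded: "mpoly_vs.subspace (bounded_polys d)"
  unfolding mpoly_vs.subspace_def bounded_polys_def
  by (auto simp: weight_le_add weight_le_scalar_mult)

lemma forms_bounded: "forms d \<subseteq> bounded_polys d"
  by (auto simp: forms_def bounded_polys_def weight_homogeneous_le)

lemma finite_bounded: "finite (bounded_polys d :: ('n::finite, 'k::{field, finite}) mpoly set)"
  unfolding bounded_polys_def by (rule finite_bounded_degree)

lemma finite_forms: "finite (forms d :: ('n::finite, 'k::{field, finite}) mpoly set)"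
  using forms_bounded finite_bounded by (rule finite_subset)

lemma forms_diff: "a \<in> forms d \<Longrightarrow> b \<in> forms d \<Longrightarrow> a - b \<in> forms d"
  by (simp add: forms_def weight_homogeneous_iff component_diff)

lemma bounded_diff: "a \<in> bounded_polys d \<Longrightarrow> b \<in> bounded_polys d \<Longrightarrow> a - b \<in> bounded_polys d"
  by (simp add: bounded_polys_def weight_le_diff)

lemma hilbert_function_codim: "hilbert_function I d = codim (forms d) I"
proof -
  have "{g \<in> I. homogeneous_of_degree d g} = I \<inter> forms d"
    by (auto simp: forms_def homogeneous_of_degree_eq)
  then show ?thesis
    by (simp add: hilbert_function_def codim_def forms_def homogeneous_of_degree_eq)
qed

lemma card_forms:
  fixes I :: "('n::finite, 'k::{field, finite}) mpoly set"
  assumes "is_ideal I"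
  shows "card (forms d :: ('n, 'k) mpoly set) = card (I \<inter> forms d) * CARD('k) ^ hilbert_function I d"
  unfolding hilbert_function_codim by (rule card_codim[OF subspace_forms finite_forms assms])

lemma card_pos:
  fixes I :: "('n::finite, 'k::{field, finite}) mpoly set"
  assumes "is_ideal I" "mpoly_vs.subspace U" "finite U"
  shows "card (I \<inter> U) > 0"
  using assms ideal_zero[OF assms(1)] mpoly_vs.subspace_0[OF assms(2)]
  by (auto simp: card_gt_0_iff)

lemma power_CARD_cancel:
  assumes "CARD('k::{field, finite}) ^ a = CARD('k) ^ b"
  shows "a = b"
  using assms CARD_field_ge_2[where 'k='k] by simp

lemma codim_antimono:
  fixes I J U :: "('n::finite, 'k::{field, finite}) mpoly set"
  assumes U: "mpoly_vs.subspace U" "finite U" and I: "is_ideal I" and J: "is_ideal J" and "I \<subseteq> J"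
  shows "codim U J \<le> codim U I"
proof -
  have le: "card (I \<inter> U) \<le> card (J \<inter> U)"
    using U(2) \<open>I \<subseteq> J\<close> by (intro card_mono) auto
  have eq: "card (I \<inter> U) * CARD('k) ^ codim U I = card (J \<inter> U) * CARD('k) ^ codim U J"
    using card_codim[OF U I] card_codim[OF U J] by simp
  have "card (I \<inter> U) * CARD('k) ^ codim U J \<le> card (I \<inter> U) * CARD('k) ^ codim U I"
    unfolding eq by (rule mult_le_mono1[OF le])
  then have "CARD('k) ^ codim U J \<le> CARD('k) ^ codim U I" using card_pos[OF I U] by simp
  then show ?thesis
    using CARD_field_ge_2[where 'k='k] by (subst (asm) power_increasing_iff) auto
qed

lemma hilbert_function_antimono:
  fixes I J :: "('n::finite, 'k::{field, finite}) mpoly set"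
  assumes "is_ideal I" "is_ideal J" "I \<subseteq> J"
  shows "hilbert_function J d \<le> hilbert_function I d"
  unfolding hilbert_function_codim by (rule codim_antimono[OF subspace_forms finite_forms assms])

text \<open>
  The exact sequence \<open>0 \<rightarrow> R / (I : a) \<rightarrow> R / I \<rightarrow> R / (I + a R) \<rightarrow> 0\<close> whose first map is
  multiplication by \<open>a\<close>.
\<close>

lemma hilbert_function_exact:
  fixes I :: "('n::finite, 'k::{field, finite}) mpoly set"
  assumes I: "is_ideal I" and gr: "graded (\<lambda>_. 1) I" and a: "weight_homogeneous (\<lambda>_. 1) e a"
  shows "hilbert_function I (e + d) =
    hilbert_function (ideal_plus I (principal_ideal a)) (e + d) + hilbert_function (colon I {a}) d"
proof -
  let ?J = "ideal_plus I (principal_ideal a)" and ?C = "colon I {a}"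
  have J: "is_ideal ?J" and C: "is_ideal ?C"
    by (simp_all add: I ideal_ideal_plus ideal_principal ideal_colon)
  have mult: "a * r \<in> forms (e + d)" if "r \<in> forms d" for r
    using weight_homogeneous_mult[OF a] that by (simp add: forms_def)
  have "{i + a * r |i r. i \<in> I \<inter> forms (e + d) \<and> r \<in> forms d} = ?J \<inter> forms (e + d)" (is "?S = _")
  proof
    show "?S \<subseteq> ?J \<inter> forms (e + d)"
    proof
      fix x assume "x \<in> ?S"
      then obtain i r where x: "x = i + a * r" "i \<in> I" "i \<in> forms (e + d)" "r \<in> forms d" by blast
      have "a * r \<in> principal_ideal a" unfolding principal_ideal_def mult.commute[of a] by (rule rangeI)
      then have "x \<in> ?J" using x(1,2) unfolding ideal_plus_def by blast
      moreover have "x \<in> forms (e + d)"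
        unfolding x(1) by (rule mpoly_vs.subspace_add[OF subspace_forms x(3) mult[OF x(4)]])
      ultimately show "x \<in> ?J \<inter> forms (e + d)" by simp
    qed
    show "?J \<inter> forms (e + d) \<subseteq> ?S"
    proof
      fix x assume "x \<in> ?J \<inter> forms (e + d)"
      then obtain i r where x: "x = i + a * r" "i \<in> I" "x \<in> forms (e + d)"
        by (auto simp: ideal_plus_def principal_ideal_def mult.commute)
      have "x = component (\<lambda>_. 1) (e + d) x" using x(3) by (simp add: forms_def weight_homogeneous_iff)
      also have "\<dots> = component (\<lambda>_. 1) (e + d) i + a * component (\<lambda>_. 1) d r"
        unfolding x(1) component_add component_mult_homogeneous[OF a] ..
      finally have "x = component (\<lambda>_. 1) (e + d) i + a * component (\<lambda>_. 1) d r" .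
      moreover have "component (\<lambda>_. 1) (e + d) i \<in> I \<inter> forms (e + d)" "component (\<lambda>_. 1) d r \<in> forms d"
        using x(2) gr by (simp_all add: graded_def forms_def)
      ultimately show "x \<in> ?S" by blast
    qed
  qed
  moreover have "{r \<in> forms d. a * r \<in> I \<inter> forms (e + d)} = ?C \<inter> forms d"
    using mult by (auto simp: colon_def mult.commute)
  moreover have "card (I \<inter> forms (e + d)) * card (forms d :: ('n, 'k) mpoly set) =
      card {i + a * r |i r. i \<in> I \<inter> forms (e + d) \<and> r \<in> forms d} *
      card {r \<in> forms d. a * r \<in> I \<inter> forms (e + d)}"
    by (rule card_sum_map)
      (simp_all add: finite_forms forms_diff ideal_diff[OF I] ideal_zero[OF I]
        mpoly_vs.subspace_0[OF subspace_forms] right_diff_distrib)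
  ultimately have "card (I \<inter> forms (e + d)) * card (forms d :: ('n, 'k) mpoly set) =
      card (?J \<inter> forms (e + d)) * card (?C \<inter> forms d)"
    by simp
  then have colon: "card (I \<inter> forms (e + d)) * CARD('k) ^ hilbert_function ?C d = card (?J \<inter> forms (e + d))"
    unfolding card_forms[OF C] using card_pos[OF C subspace_forms finite_forms, of d] by simp
  have "card (I \<inter> forms (e + d)) * CARD('k) ^ hilbert_function I (e + d) =
      card (?J \<inter> forms (e + d)) * CARD('k) ^ hilbert_function ?J (e + d)"
    using card_forms[OF I] card_forms[OF J] by metis
  also have "\<dots> = card (I \<inter> forms (e + d)) *
      CARD('k) ^ (hilbert_function ?J (e + d) + hilbert_function ?C d)"
    unfolding colon[symmetric] by (simp add: power_add)
  finally have "CARD('k) ^ hilbert_function I (e + d) =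
      CARD('k) ^ (hilbert_function ?J (e + d) + hilbert_function ?C d)"
    using card_pos[OF I subspace_forms finite_forms, of "e + d"] by simp
  then show ?thesis by (rule power_CARD_cancel)
qed

text \<open>
  The exact sequence \<open>0 \<rightarrow> R / (I \<inter> J) \<rightarrow> R / I \<oplus> R / J \<rightarrow> R / (I + J) \<rightarrow> 0\<close>.
\<close>

lemma hilbert_function_Int_plus:
  fixes I J :: "('n::finite, 'k::{field, finite}) mpoly set"
  assumes I: "is_ideal I" and J: "is_ideal J" and gr: "graded (\<lambda>_. 1) I" "graded (\<lambda>_. 1) J"
  shows "hilbert_function (I \<inter> J) d + hilbert_function (ideal_plus I J) d =
    hilbert_function I d + hilbert_function J d"
proof -
  let ?S = "ideal_plus I J"
  have S: "is_ideal ?S" and IJ: "is_ideal (I \<inter> J)"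
    by (simp_all add: I J ideal_ideal_plus ideal_Int)
  have "{i + j |i j. i \<in> I \<inter> forms d \<and> j \<in> J \<inter> forms d} = ?S \<inter> forms d" (is "?T = _")
  proof
    show "?T \<subseteq> ?S \<inter> forms d"
      using mpoly_vs.subspace_add[OF subspace_forms] by (auto simp: ideal_plus_def)
    show "?S \<inter> forms d \<subseteq> ?T"
    proof
      fix x assume "x \<in> ?S \<inter> forms d"
      then obtain i j where x: "x = i + j" "i \<in> I" "j \<in> J" "x \<in> forms d" by (auto simp: ideal_plus_def)
      have "x = component (\<lambda>_. 1) d x" using x(4) by (simp add: forms_def weight_homogeneous_iff)
      also have "\<dots> = component (\<lambda>_. 1) d i + component (\<lambda>_. 1) d j" by (simp add: x(1) component_add)
      finally have "x = component (\<lambda>_. 1) d i + component (\<lambda>_. 1) d j" .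
      moreover have "component (\<lambda>_. 1) d i \<in> I \<inter> forms d" "component (\<lambda>_. 1) d j \<in> J \<inter> forms d"
        using x gr by (simp_all add: graded_def forms_def)
      ultimately show "x \<in> ?T" by blast
    qed
  qed
  moreover have "{j \<in> J \<inter> forms d. j \<in> I \<inter> forms d} = (I \<inter> J) \<inter> forms d" by blast
  moreover have "card (I \<inter> forms d) * card (J \<inter> forms d) =
      card {i + j |i j. i \<in> I \<inter> forms d \<and> j \<in> J \<inter> forms d} * card {j \<in> J \<inter> forms d. j \<in> I \<inter> forms d}"
    by (rule card_sum_map)
      (simp_all add: finite_forms forms_diff ideal_diff[OF I] ideal_diff[OF J] ideal_zero[OF I]
        mpoly_vs.subspace_0[OF subspace_forms])
  ultimately have eq: "card (I \<inter> forms d) * card (J \<inter> forms d) = card (?S \<inter> forms d) * card ((I \<inter> J) \<inter> forms d)"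
    by simp
  have "card (I \<inter> forms d) * card (J \<inter> forms d) * CARD('k) ^ (hilbert_function I d + hilbert_function J d)
    = (card (I \<inter> forms d) * CARD('k) ^ hilbert_function I d) * (card (J \<inter> forms d) * CARD('k) ^ hilbert_function J d)"
    by (simp add: power_add)
  also have "\<dots> = (card (?S \<inter> forms d) * CARD('k) ^ hilbert_function ?S d) *
      (card ((I \<inter> J) \<inter> forms d) * CARD('k) ^ hilbert_function (I \<inter> J) d)"
    by (simp only: card_forms[OF I, symmetric] card_forms[OF J, symmetric]
        card_forms[OF S, symmetric] card_forms[OF IJ, symmetric])
  also have "\<dots> = card (?S \<inter> forms d) * card ((I \<inter> J) \<inter> forms d) *
      CARD('k) ^ (hilbert_function (I \<inter> J) d + hilbert_function ?S d)"
    by (simp add: power_add)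
  finally have "CARD('k) ^ (hilbert_function (I \<inter> J) d + hilbert_function ?S d) =
      CARD('k) ^ (hilbert_function I d + hilbert_function J d)"
    unfolding eq using card_pos[OF S subspace_forms finite_forms, of d]
      card_pos[OF IJ subspace_forms finite_forms, of d] by simp
  then show ?thesis by (rule power_CARD_cancel)
qed

lemma weight_bounded_by_degree: "weight w e \<le> (\<Sum>i\<in>UNIV. w i) * monom_degree e"
proof -
  have "weight w e \<le> (\<Sum>i\<in>UNIV. (\<Sum>j\<in>UNIV. w j) * Poly_Mapping.lookup e i)"
    unfolding weight_def by (intro sum_mono mult_le_mono1 member_le_sum) auto
  then show ?thesis by (simp add: weight_def sum_distrib_left)
qed

text \<open>
  The kernel of \<open>component w (c + 1)\<close> on the elements of weight at most \<open>c + 1\<close> consists of those of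
  weight at most \<open>c\<close>.
\<close>

lemma card_by_leading_components:
  fixes V :: "('n::finite, 'k::{field, finite}) mpoly set"
  assumes fin: "finite V" and diff: "\<And>a b. a \<in> V \<Longrightarrow> b \<in> V \<Longrightarrow> a - b \<in> V"
  shows "card {g \<in> V. weight_le w c g} =
    (\<Prod>i\<le>c. card (component w i ` {g \<in> V. weight_le w i g}))"
proof (induction c)
  case 0
  have "inj_on (component w 0) {g \<in> V. weight_le w 0 g}"
  proof (rule inj_onI)
    fix g h assume "g \<in> {g \<in> V. weight_le w 0 g}" "h \<in> {g \<in> V. weight_le w 0 g}"
      and eq: "component w 0 g = component w 0 h"
    then have g: "weight_le w 0 g" and h: "weight_le w 0 h" by simp_all
    have "g = component w 0 g" by (rule trans[OF sum_components[OF g]]) simp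
    also have "\<dots> = h" unfolding eq by (rule sym, rule trans[OF sum_components[OF h]]) simp
    finally show "g = h" .
  qed
  then show ?case by (simp add: card_image)
next
  case (Suc c)
  let ?A = "{g \<in> V. weight_le w (Suc c) g}"
  have "{g \<in> ?A. component w (Suc c) g = 0} = {g \<in> V. weight_le w c g}"
  proof (intro Collect_cong iffI)
    fix g assume "g \<in> ?A \<and> component w (Suc c) g = 0"
    then show "g \<in> V \<and> weight_le w c g" using weight_le_pred by blast
  next
    fix g assume "g \<in> V \<and> weight_le w c g"
    then show "g \<in> ?A \<and> component w (Suc c) g = 0"
      using weight_le_mono[of w c g "Suc c"] component_eq_0[of w c g "Suc c"] by simp
  qed
  moreover have "card ?A = card (component w (Suc c) ` ?A) * card {g \<in> ?A. component w (Suc c) g = 0}"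
    by (rule card_image_kernel) (auto simp: fin diff weight_le_diff component_diff)
  ultimately show ?case by (simp add: Suc.IH mult.commute)
qed

text \<open>
  The forms of degree \<open>d\<close> in \<open>I\<close> and those in its initial ideal have the same top components in each
  weight, so there are equally many of them.
\<close>

lemma hilbert_function_init:
  fixes I :: "('n::finite, 'k::{field, finite}) mpoly set"
  assumes I: "is_ideal I" and gr: "graded (\<lambda>_. 1) I"
  shows "hilbert_function (init_ideal w I) d = hilbert_function I d"
proof -
  let ?J = "init_ideal w I"
  have J: "is_ideal ?J" by (rule ideal_init_ideal[OF I])
  define c where "c = (\<Sum>i\<in>UNIV. w i) * d"
  have bound: "weight_le w c g" if "g \<in> forms d" for g :: "('n, 'k) mpoly"
    using that weight_bounded_by_degree[of w]
    by (fastforce simp: weight_le_def forms_def weight_homogeneous_def c_def)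
  have diff: "a - b \<in> K \<inter> forms d" if "is_ideal K" "a \<in> K \<inter> forms d" "b \<in> K \<inter> forms d"
    for K and a b :: "('n, 'k) mpoly"
    using that forms_diff ideal_diff by blast
  have lead: "component w i ` {g \<in> ?J \<inter> forms d. weight_le w i g} =
      component w i ` {g \<in> I \<inter> forms d. weight_le w i g}" for i
  proof
    show "component w i ` {g \<in> ?J \<inter> forms d. weight_le w i g} \<subseteq> component w i ` {g \<in> I \<inter> forms d. weight_le w i g}"
    proof
      fix y assume "y \<in> component w i ` {g \<in> ?J \<inter> forms d. weight_le w i g}"
      then obtain x where x: "y = component w i x" "x \<in> ?J" "x \<in> forms d" by blast
      obtain g where g: "g \<in> I" "weight_le w i g" "component w i g = component w i x"
        using x(2) mem_init_ideal[OF I] by blast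
      let ?g = "component (\<lambda>_. 1) d g"
      have "?g \<in> I" using g(1) gr by (simp add: graded_def)
      moreover have "?g \<in> forms d" by (simp add: forms_def)
      moreover have "weight_le w i ?g" using g(2) by (rule weight_le_component')
      moreover have "component w i ?g = y"
      proof -
        have "component w i ?g = component (\<lambda>_. 1) d (component w i x)"
          unfolding component_component[of w i] g(3) ..
        also have "\<dots> = component w i (component (\<lambda>_. 1) d x)" by (rule component_component)
        also have "component (\<lambda>_. 1) d x = x" using x(3) by (simp add: forms_def weight_homogeneous_iff)
        finally show ?thesis by (simp add: x(1))
      qed
      ultimately show "y \<in> component w i ` {g \<in> I \<inter> forms d. weight_le w i g}" by blast
    qed
    show "component w i ` {g \<in> I \<inter> forms d. weight_le w i g} \<subseteq> component w i ` {g \<in> ?J \<inter> forms d. weight_le w i g}"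
    proof
      fix y assume "y \<in> component w i ` {g \<in> I \<inter> forms d. weight_le w i g}"
      then obtain g where g: "y = component w i g" "g \<in> I" "g \<in> forms d" "weight_le w i g" by blast
      have "y \<in> ?J" unfolding g(1) by (rule component_in_init[OF I g(2,4)])
      moreover have "y \<in> forms d"
        using g(3) by (simp add: g(1) forms_def weight_homogeneous_def keys_component)
      moreover have "weight_le w i y" unfolding g(1) by (rule weight_le_component)
      moreover have "y = component w i y" by (simp add: g(1) component_same)
      ultimately show "y \<in> component w i ` {g \<in> ?J \<inter> forms d. weight_le w i g}" by blast
    qed
  qed
  have "card {g \<in> ?J \<inter> forms d. weight_le w c g} = card {g \<in> I \<inter> forms d. weight_le w c g}"
  proof -
    have count: "card {g \<in> K \<inter> forms d. weight_le w c g} =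
        (\<Prod>i\<le>c. card (component w i ` {g \<in> K \<inter> forms d. weight_le w i g}))"
      if "is_ideal K" for K :: "('n, 'k) mpoly set"
      by (rule card_by_leading_components) (use finite_forms diff[OF that] in auto)
    show ?thesis unfolding count[OF I] count[OF J] lead by (rule refl)
  qed
  moreover have "{g \<in> K \<inter> forms d. weight_le w c g} = K \<inter> forms d" for K :: "('n, 'k) mpoly set"
    using bound by blast
  ultimately have "card (?J \<inter> forms d) = card (I \<inter> forms d)" by simp
  then have "CARD('k) ^ hilbert_function ?J d = CARD('k) ^ hilbert_function I d"
    using card_forms[OF I, of d] card_forms[OF J, of d] card_pos[OF I subspace_forms finite_forms, of d] by simp
  then show ?thesis by (rule power_CARD_cancel)
qed

text \<open>
  Multiplication by \<open>x\<close> embeds \<open>R / P\<close> into \<open>Q / P\<close>. Chains of primes consist of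
  arbitrary ideals, so elements are counted by bounded degree instead of by degree.
\<close>

lemma affine_hilbert_step:
  fixes P Q :: "('n::finite, 'k::{field, finite}) mpoly set"
  assumes P: "is_prime P" and Q: "is_ideal Q" and PQ: "P \<subseteq> Q"
    and x: "x \<in> Q" "x \<notin> P" "weight_le (\<lambda>_. 1) e x"
  shows "codim (bounded_polys (e + d)) Q + codim (bounded_polys d) P \<le> codim (bounded_polys (e + d)) P"
proof -
  let ?B = "bounded_polys :: nat \<Rightarrow> ('n, 'k) mpoly set"
  have idP: "is_ideal P" by (rule prime_ideal[OF P])
  have mult: "x * r \<in> ?B (e + d)" if "r \<in> ?B d" for r
    using weight_le_mult[OF x(3)] that by (simp add: bounded_polys_def)
  let ?S = "{u + x * r |u r. u \<in> P \<inter> ?B (e + d) \<and> r \<in> ?B d}"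
  have "?S \<subseteq> Q \<inter> ?B (e + d)"
  proof
    fix y assume "y \<in> ?S"
    then obtain u r where y: "y = u + x * r" "u \<in> P" "u \<in> ?B (e + d)" "r \<in> ?B d" by blast
    show "y \<in> Q \<inter> ?B (e + d)"
      unfolding y(1) using y PQ x(1) mult[OF y(4)]
      by (auto intro: ideal_add[OF Q] ideal_mult_right[OF Q] mpoly_vs.subspace_add[OF subspace_bounded])
  qed
  then have "card ?S \<le> card (Q \<inter> ?B (e + d))"
    using finite_bounded by (intro card_mono) auto
  moreover have "{r \<in> ?B d. x * r \<in> P \<inter> ?B (e + d)} = P \<inter> ?B d"
    using mult prime_mult[OF P] x(2) ideal_mult[OF idP] by blast
  moreover have "card (P \<inter> ?B (e + d)) * card (?B d) = card ?S * card {r \<in> ?B d. x * r \<in> P \<inter> ?B (e + d)}"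
    by (rule card_sum_map)
      (simp_all add: finite_bounded bounded_diff ideal_diff[OF idP] ideal_zero[OF idP]
        mpoly_vs.subspace_0[OF subspace_bounded] right_diff_distrib)
  ultimately have "card (P \<inter> ?B (e + d)) * card (?B d) \<le> card (Q \<inter> ?B (e + d)) * card (P \<inter> ?B d)"
    by simp
  then have "card (P \<inter> ?B (e + d)) * CARD('k) ^ codim (?B d) P \<le> card (Q \<inter> ?B (e + d))"
    unfolding card_codim[OF subspace_bounded finite_bounded idP, of d]
    using card_pos[OF idP subspace_bounded finite_bounded, of d] by simp
  then have "card (P \<inter> ?B (e + d)) * CARD('k) ^ codim (?B d) P * CARD('k) ^ codim (?B (e + d)) Q \<le>
      card (P \<inter> ?B (e + d)) * CARD('k) ^ codim (?B (e + d)) P"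
    using card_codim[OF subspace_bounded finite_bounded idP, of "e + d"]
      card_codim[OF subspace_bounded finite_bounded Q, of "e + d"] mult_le_mono1 by metis
  then have "CARD('k) ^ (codim (?B (e + d)) Q + codim (?B d) P) \<le> CARD('k) ^ codim (?B (e + d)) P"
    using card_pos[OF idP subspace_bounded finite_bounded, of "e + d"] by (simp add: power_add mult_ac)
  then show ?thesis
    using CARD_field_ge_2[where 'k='k] by (subst (asm) power_increasing_iff) auto
qed

lemma affine_hilbert_graded:
  fixes I :: "('n::finite, 'k::{field, finite}) mpoly set"
  assumes I: "is_ideal I" and gr: "graded (\<lambda>_. 1) I"
  shows "codim (bounded_polys d) I = (\<Sum>i\<le>d. hilbert_function I i)"
proof -
  let ?B = "bounded_polys :: nat \<Rightarrow> ('n, 'k) mpoly set"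
  have count: "card (K \<inter> ?B d) = (\<Prod>i\<le>d. card (K \<inter> forms i))"
    if K: "is_ideal K" "graded (\<lambda>_. 1) K" for K :: "('n, 'k) mpoly set"
  proof -
    have "component (\<lambda>_. 1) i ` {g \<in> K \<inter> ?B d. weight_le (\<lambda>_. 1) i g} = K \<inter> forms i" if "i \<le> d" for i
    proof
      show "component (\<lambda>_. 1) i ` {g \<in> K \<inter> ?B d. weight_le (\<lambda>_. 1) i g} \<subseteq> K \<inter> forms i"
        using K(2) by (auto simp: graded_def forms_def)
      show "K \<inter> forms i \<subseteq> component (\<lambda>_. 1) i ` {g \<in> K \<inter> ?B d. weight_le (\<lambda>_. 1) i g}"
      proof
        fix g assume g: "g \<in> K \<inter> forms i"
        then have "component (\<lambda>_. 1) i g = g" "weight_le (\<lambda>_. 1) i g"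
          by (simp_all add: forms_def weight_homogeneous_le flip: weight_homogeneous_iff)
        moreover have "g \<in> ?B d" using weight_le_mono[OF calculation(2) that] by (simp add: bounded_polys_def)
        ultimately show "g \<in> component (\<lambda>_. 1) i ` {g \<in> K \<inter> ?B d. weight_le (\<lambda>_. 1) i g}"
          using g by (metis (mono_tags, lifting) IntD1 IntI image_eqI mem_Collect_eq)
      qed
    qed
    moreover have "card {g \<in> K \<inter> ?B d. weight_le (\<lambda>_. 1) d g} =
        (\<Prod>i\<le>d. card (component (\<lambda>_. 1) i ` {g \<in> K \<inter> ?B d. weight_le (\<lambda>_. 1) i g}))"
      by (rule card_by_leading_components) (auto simp: finite_bounded bounded_diff ideal_diff[OF K(1)])
    moreover have "{g \<in> K \<inter> ?B d. weight_le (\<lambda>_. 1) d g} = K \<inter> ?B d" by (auto simp: bounded_polys_def)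
    ultimately show ?thesis by simp
  qed
  have "graded (\<lambda>_. 1) (UNIV :: ('n, 'k) mpoly set)" by (simp add: graded_def)
  from count[OF ideal_UNIV this] have "card (?B d) = (\<Prod>i\<le>d. card (forms i :: ('n, 'k) mpoly set))" by simp
  also have "\<dots> = card (I \<inter> ?B d) * CARD('k) ^ (\<Sum>i\<le>d. hilbert_function I i)"
    unfolding card_forms[OF I] prod.distrib count[OF I gr] by (simp add: power_sum)
  finally have "CARD('k) ^ codim (?B d) I = CARD('k) ^ (\<Sum>i\<le>d. hilbert_function I i)"
    using card_codim[OF subspace_bounded finite_bounded I, of d]
      card_pos[OF I subspace_bounded finite_bounded, of d] by simp
  then show ?thesis by (rule power_CARD_cancel)
qed

section \<open>Polynomial growth\<close>

text \<open>
  For \<open>x\<^sup>n\<close>, the difference of \<open>x\<^bsup>n+1\<^esup> / (n + 1)\<close> has the right leading term by the binomial theorem,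
  and the remaining terms are dealt with by induction.
\<close>

lemma antidifference_exists: "\<exists>S :: rat poly. \<forall>x. poly S (x + 1) - poly S x = poly Q x"
proof -
  have monomial: "\<exists>S :: rat poly. \<forall>x. poly S (x + 1) - poly S x = x ^ n" for n
  proof (induction n rule: less_induct)
    case (less n)
    then have "\<forall>k\<in>{..<n}. \<exists>S :: rat poly. \<forall>x. poly S (x + 1) - poly S x = x ^ k" by simp
    from bchoice[OF this] obtain S :: "nat \<Rightarrow> rat poly"
      where S: "\<forall>k\<in>{..<n}. \<forall>x. poly (S k) (x + 1) - poly (S k) x = x ^ k" ..
    define R where "R = Polynomial.smult (1 / of_nat (Suc n))
      (Polynomial.monom 1 (Suc n) - (\<Sum>k<n. Polynomial.smult (of_nat (Suc n choose k)) (S k)))"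
    have "poly R (x + 1) - poly R x = x ^ n" for x
    proof -
      have "(x + 1) ^ Suc n = (\<Sum>k\<le>Suc n. of_nat (Suc n choose k) * x ^ k)"
        using binomial_ring[of x 1 "Suc n"] by simp
      also have "\<dots> = (\<Sum>k<n. of_nat (Suc n choose k) * x ^ k) + of_nat (Suc n) * x ^ n + x ^ Suc n"
        by (simp add: lessThan_Suc_atMost[symmetric])
      finally have binomial: "(x + 1) ^ Suc n - x ^ Suc n - (\<Sum>k<n. of_nat (Suc n choose k) * x ^ k)
          = of_nat (Suc n) * x ^ n" by simp
      have "of_nat (Suc n) * (poly R (x + 1) - poly R x) = (x + 1) ^ Suc n - x ^ Suc n -
          (\<Sum>k<n. of_nat (Suc n choose k) * (poly (S k) (x + 1) - poly (S k) x))"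
        unfolding R_def
        by (simp add: poly_sum poly_monom right_diff_distrib sum_subtractf diff_divide_distrib
            del: of_nat_Suc power_Suc binomial_Suc_Suc) 
      also have "(\<Sum>k<n. of_nat (Suc n choose k) * (poly (S k) (x + 1) - poly (S k) x)) =
          (\<Sum>k<n. of_nat (Suc n choose k) * x ^ k)"
        using S by (intro sum.cong) auto
      finally have "of_nat (Suc n) * (poly R (x + 1) - poly R x) = of_nat (Suc n) * x ^ n"
        unfolding binomial .
      then show ?thesis by (simp del: of_nat_Suc)
    qed
    then show ?case by blast
  qed
  then obtain S :: "nat \<Rightarrow> rat poly" where S: "\<forall>k. \<forall>x. poly (S k) (x + 1) - poly (S k) x = x ^ k"
    by metis
  define R where "R = (\<Sum>k\<le>Polynomial.degree Q. Polynomial.smult (Polynomial.coeff Q k) (S k))"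
  have "poly R (x + 1) - poly R x = poly Q x" for x
  proof -
    have "poly R (x + 1) - poly R x = (\<Sum>k\<le>Polynomial.degree Q. Polynomial.coeff Q k * (poly (S k) (x + 1) - poly (S k) x))"
      by (simp add: R_def poly_sum right_diff_distrib sum_subtractf)
    also have "\<dots> = poly Q x" by (simp add: S poly_altdef[of Q])
    finally show ?thesis .
  qed
  then show ?thesis by blast
qed

lemma poly_eventually_ge_lead_coeff:
  fixes q :: "rat poly"
  shows "Polynomial.lead_coeff q > 0 \<Longrightarrow> \<exists>N. \<forall>n\<ge>N. Polynomial.lead_coeff q \<le> poly q (of_nat n)"
proof (induction q)
  case 0
  then show ?case by simp
next
  case (pCons a q)
  show ?case
  proof (cases "q = 0")
    case True
    then show ?thesis by simp
  next
    case False
    define l where "l = Polynomial.lead_coeff q"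
    have l: "l > 0" using pCons.prems False by (simp add: l_def)
    then obtain N where N: "\<And>n. n \<ge> N \<Longrightarrow> l \<le> poly q (of_nat n)"
      using pCons.IH unfolding l_def by blast
    obtain M :: nat where M: "1 - a / l < of_nat M" using reals_Archimedean2 by blast
    have "Polynomial.lead_coeff (pCons a q) \<le> poly (pCons a q) (of_nat n)" if n: "n \<ge> max N M" for n
    proof -
      have "(1 - a / l) * l \<le> of_nat n * l"
      proof (rule mult_right_mono)
        have "of_nat M \<le> (of_nat n :: rat)" using n by simp
        then show "1 - a / l \<le> of_nat n" using M by linarith
      qed (use l in simp)
      then have "l - a \<le> of_nat n * l" using l by (simp add: left_diff_distrib)
      also have "\<dots> \<le> of_nat n * poly q (of_nat n)" using N[of n] n by (intro mult_left_mono) auto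
      finally have "l \<le> a + of_nat n * poly q (of_nat n)" by simp
      then show ?thesis using False by (simp add: l_def)
    qed
    then show ?thesis by blast
  qed
qed

lemma poly_bounded_by_degree:
  fixes q :: "rat poly"
  shows "\<exists>C :: nat. \<forall>n. \<bar>poly q (of_nat n)\<bar> \<le> of_nat C * (of_nat n + 1) ^ Polynomial.degree q"
proof (induction q)
  case 0
  then show ?case by simp
next
  case (pCons a q)
  obtain C :: nat where C: "\<And>n. \<bar>poly q (of_nat n)\<bar> \<le> of_nat C * (of_nat n + 1) ^ Polynomial.degree q"
    using pCons.IH by blast
  obtain A :: nat where A: "\<bar>a\<bar> \<le> of_nat A" using real_arch_simple by blast
  show ?case
  proof (cases "q = 0")
    case True
    then show ?thesis using A by (auto intro!: exI[of _ A])
  next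
    case False
    have "\<bar>poly (pCons a q) (of_nat n)\<bar> \<le> of_nat (A + C) * (of_nat n + 1) ^ Polynomial.degree (pCons a q)" for n
    proof -
      have "\<bar>poly (pCons a q) (of_nat n)\<bar> \<le> \<bar>a\<bar> + of_nat n * \<bar>poly q (of_nat n)\<bar>"
        using abs_triangle_ineq[of a "of_nat n * poly q (of_nat n)"] by (simp add: abs_mult)
      also have "\<dots> \<le> of_nat A * 1 + (of_nat n + 1) * (of_nat C * (of_nat n + 1) ^ Polynomial.degree q)"
        using A C by (intro add_mono mult_mono) auto
      also have "\<dots> \<le> of_nat A * (of_nat n + 1) ^ Suc (Polynomial.degree q) + of_nat C * (of_nat n + 1) ^ Suc (Polynomial.degree q)"
        by (intro add_mono mult_left_mono one_le_power) auto
      finally show ?thesis using False by (simp add: distrib_right)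
    qed
    then show ?thesis by blast
  qed
qed

lemma poly_eq_eventually:
  fixes q r :: "rat poly"
  assumes "\<forall>\<^sub>F n in sequentially. poly q (of_nat n) = poly r (of_nat n)"
  shows "q = r"
proof (rule ccontr)
  assume "q \<noteq> r"
  then have "finite {x. poly (q - r) x = 0}" by (intro poly_roots_finite) simp
  moreover obtain N where N: "\<And>n. n \<ge> N \<Longrightarrow> poly q (of_nat n) = poly r (of_nat n)"
    using assms by (auto simp: eventually_sequentially)
  have "(of_nat :: nat \<Rightarrow> rat) ` {N..} \<subseteq> {x. poly (q - r) x = 0}" using N by auto
  moreover have "infinite ((of_nat :: nat \<Rightarrow> rat) ` {N..})"
    by (subst finite_image_iff) (auto simp: inj_on_def infinite_Ici)
  ultimately show False using finite_subset by blast
qed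

text \<open>
  For a Hilbert polynomial, this is the dimension of the cone: the degree is the dimension of the
  projective variety, and the zero polynomial belongs to the origin.
\<close>

definition poly_dim :: "rat poly \<Rightarrow> nat" where
  "poly_dim q = (if q = 0 then 0 else Suc (Polynomial.degree q))"

lemma poly_dim_le_iff: "poly_dim q \<le> k \<longleftrightarrow> (\<forall>i\<ge>k. Polynomial.coeff q i = 0)"
proof
  assume "poly_dim q \<le> k"
  then show "\<forall>i\<ge>k. Polynomial.coeff q i = 0"
    by (auto simp: poly_dim_def coeff_eq_0 split: if_splits)
next
  assume zero: "\<forall>i\<ge>k. Polynomial.coeff q i = 0"
  show "poly_dim q \<le> k"
  proof (cases "q = 0")
    case False
    then have "Polynomial.coeff q (Polynomial.degree q) \<noteq> 0" by simp
    then have "Polynomial.degree q < k" using zero not_less by blast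
    then show ?thesis by (simp add: poly_dim_def)
  qed (simp add: poly_dim_def)
qed

lemma poly_dim_add: "poly_dim q \<le> k \<Longrightarrow> poly_dim r \<le> k \<Longrightarrow> poly_dim (q + r) \<le> k"
  by (simp add: poly_dim_le_iff)

lemma poly_dim_shift: "poly_dim (pcompose q [:c, 1:]) = poly_dim q"
proof -
  have "pcompose q [:c, 1:] = 0 \<longleftrightarrow> q = 0" by (intro pcompose_eq_0_iff) simp
  then show ?thesis by (simp add: poly_dim_def degree_pcompose)
qed

text \<open>
  If the degree were larger than \<open>k\<close>, the difference of the bound and \<open>q\<close> would have negative leading
  coefficient.
\<close>

lemma poly_dim_le_growth:
  assumes nonneg: "\<forall>\<^sub>F n in sequentially. 0 \<le> poly q (of_nat n)"
    and le: "\<forall>\<^sub>F n in sequentially. poly q (of_nat n) \<le> of_nat C * (of_nat n + 1) ^ k"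
  shows "poly_dim q \<le> Suc k"
proof (rule ccontr)
  assume "\<not> ?thesis"
  then have deg: "Polynomial.degree q > k" and "q \<noteq> 0" by (auto simp: poly_dim_def split: if_splits)
  have eventually_neg: "\<forall>\<^sub>F n in sequentially. poly r (of_nat n) < 0" if "Polynomial.lead_coeff r < 0" for r :: "rat poly"
  proof -
    obtain N where "\<forall>n\<ge>N. Polynomial.lead_coeff (- r) \<le> poly (- r) (of_nat n)"
      using poly_eventually_ge_lead_coeff[of "- r"] \<open>Polynomial.lead_coeff r < 0\<close> by auto
    then have "poly r (of_nat n) < 0" if "n \<ge> N" for n using that \<open>Polynomial.lead_coeff r < 0\<close> by fastforce
    then show ?thesis by (auto simp: eventually_sequentially)
  qed
  have "Polynomial.lead_coeff q > 0"
  proof (rule ccontr)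
    assume "\<not> ?thesis"
    then have "Polynomial.lead_coeff q < 0" using \<open>q \<noteq> 0\<close> by (simp add: less_le)
    from eventually_conj[OF eventually_neg[OF this] nonneg] show False by (auto simp: eventually_sequentially)
  qed
  define b :: "rat poly" where "b = Polynomial.smult (of_nat C) ([:1, 1:] ^ k)"
  have "Polynomial.degree b \<le> k"
    unfolding b_def using degree_smult_le[of "of_nat C" "[:1, 1:] ^ k :: rat poly"]
    by (simp add: degree_linear_power)
  then have "Polynomial.degree (b + - q) = Polynomial.degree q" "Polynomial.coeff b (Polynomial.degree q) = 0"
    using deg degree_add_eq_right[of b "- q"] by (simp_all add: coeff_eq_0)
  then have "Polynomial.lead_coeff (b - q) < 0" using \<open>Polynomial.lead_coeff q > 0\<close> by simp
  from eventually_conj[OF eventually_neg[OF this] le] show False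
    by (auto simp: eventually_sequentially b_def poly_power add.commute)
qed

lemma poly_dim_0_iff: "poly_dim q = 0 \<longleftrightarrow> q = 0"
  by (simp add: poly_dim_def)

section \<open>Hilbert polynomials\<close>

abbreviation cone_ideal :: "('n::finite, 'k::field) mpoly set \<Rightarrow> bool" where
  "cone_ideal I \<equiv> is_ideal I \<and> graded (\<lambda>_. 1) I"

lemma graded_principal:
  fixes a :: "('n::finite, 'k::field) mpoly"
  assumes a: "weight_homogeneous w e a"
  shows "graded w (principal_ideal a)"
  unfolding graded_def
proof (intro ballI allI)
  fix g d assume "g \<in> principal_ideal a"
  then obtain r where g: "g = a * r" by (auto simp: principal_ideal_def mult.commute)
  show "component w d g \<in> principal_ideal a"
  proof (cases "e \<le> d")
    case True
    then have "component w d g = component w (d - e) r * a"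
      using component_mult_homogeneous[OF a, of "d - e" r] g by (simp add: mult.commute)
    then show ?thesis by (simp add: principal_ideal_def)
  next
    case False
    have "component w i a = 0" if "i \<le> d" for i
      using that False component_other[OF a, of i] by simp
    then have "component w d g = 0" unfolding g component_mult by simp
    then show ?thesis using ideal_zero[OF ideal_principal] by simp
  qed
qed

lemma graded_plus: "graded w I \<Longrightarrow> graded w J \<Longrightarrow> graded w (ideal_plus I J)"
  unfolding graded_def
proof (intro ballI allI)
  fix g d assume gr: "\<forall>g\<in>I. \<forall>d. component w d g \<in> I" "\<forall>g\<in>J. \<forall>d. component w d g \<in> J"
    and "g \<in> ideal_plus I J"
  then obtain a b where "g = a + b" "a \<in> I" "b \<in> J" by (auto simp: ideal_plus_def)
  then show "component w d g \<in> ideal_plus I J"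
    using gr unfolding ideal_plus_def by (simp add: component_add) blast
qed

lemma graded_Int: "graded w I \<Longrightarrow> graded w J \<Longrightarrow> graded w (I \<inter> J)"
  unfolding graded_def by auto

lemma graded_colon:
  fixes a :: "('n::finite, 'k::field) mpoly"
  assumes gr: "graded w I" and a: "weight_homogeneous w e a"
  shows "graded w (colon I {a})"
  unfolding graded_def
proof (intro ballI allI)
  fix g d assume "g \<in> colon I {a}"
  then have "component w (e + d) (a * g) \<in> I" using gr by (simp add: colon_def graded_def mult.commute)
  then show "component w d g \<in> colon I {a}"
    by (simp add: component_mult_homogeneous[OF a] colon_def mult.commute)
qed

lemma cone_plus_principal:
  "cone_ideal I \<Longrightarrow> weight_homogeneous (\<lambda>_. 1) e a \<Longrightarrow> cone_ideal (ideal_plus I (principal_ideal a))"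
  by (simp add: ideal_ideal_plus ideal_principal graded_plus graded_principal)

lemma cone_colon: "cone_ideal I \<Longrightarrow> weight_homogeneous (\<lambda>_. 1) e a \<Longrightarrow> cone_ideal (colon I {a})"
  by (simp add: ideal_colon graded_colon)

text \<open>
  Remove components in \<open>I\<close> from the top.
\<close>

lemma graded_reduce:
  fixes g :: "('n::finite, 'k::field) mpoly"
  assumes I: "is_ideal I" and gr: "graded w I" and g: "g \<notin> I"
  obtains c h where "weight_le w c h" "component w c h \<notin> I" "g - h \<in> I"
proof -
  have "\<exists>c h. weight_le w c h \<and> component w c h \<notin> I \<and> g - h \<in> I" if "weight_le w b g" "g \<notin> I" for b g
    using that
  proof (induction b arbitrary: g)
    case 0
    have "g = component w 0 g" by (rule trans[OF sum_components[OF 0(1)]]) simp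
    then have "component w 0 g \<notin> I" using 0(2) by simp
    then show ?case using 0 ideal_zero[OF I] by (intro exI[of _ 0] exI[of _ g]) simp
  next
    case (Suc b)
    show ?case
    proof (cases "component w (Suc b) g \<in> I")
      case False
      then show ?thesis using Suc.prems ideal_zero[OF I] by (intro exI[of _ "Suc b"] exI[of _ g]) simp
    next
      case True
      let ?g = "g - component w (Suc b) g"
      have "weight_le w b ?g"
        using weight_le_diff[OF Suc.prems(1) weight_le_component]
        by (rule weight_le_pred) (simp add: component_diff component_same)
      moreover have "?g \<notin> I" using ideal_add[OF I True, of ?g] Suc.prems(2) by auto
      ultimately obtain c h where h: "weight_le w c h" "component w c h \<notin> I" "?g - h \<in> I"
        using Suc.IH by blast
      have "g - h = component w (Suc b) g + (?g - h)" by simp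
      also have "\<dots> \<in> I" by (rule ideal_add[OF I True h(3)])
      finally show ?thesis using h by blast
    qed
  qed
  moreover obtain b where "weight_le w b g" using weight_le_exists by blast
  ultimately show thesis using g that by blast
qed

text \<open>
  For a graded ideal primality can be tested on homogeneous elements: modulo the ideal, the top
  components of two elements outside of it may be assumed to lie outside of it.
\<close>

lemma graded_primeI:
  fixes I :: "('n::finite, 'k::field) mpoly set"
  assumes I: "is_ideal I" and gr: "graded w I" and one: "1 \<notin> I"
    and prime: "\<And>a b d e. weight_homogeneous w d a \<Longrightarrow> weight_homogeneous w e b \<Longrightarrow> a * b \<in> I \<Longrightarrow> a \<in> I \<or> b \<in> I"
  shows "is_prime I"
  unfolding is_prime_def
proof (intro conjI allI impI I one)
  fix a b assume ab: "a * b \<in> I"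
  show "a \<in> I \<or> b \<in> I"
  proof (rule ccontr)
    assume "\<not> ?thesis"
    then have "a \<notin> I" "b \<notin> I" by auto
    obtain c g where g: "weight_le w c g" "component w c g \<notin> I" "a - g \<in> I"
      using graded_reduce[OF I gr \<open>a \<notin> I\<close>] .
    obtain d h where h: "weight_le w d h" "component w d h \<notin> I" "b - h \<in> I"
      using graded_reduce[OF I gr \<open>b \<notin> I\<close>] .
    have "g * h = a * b - (a - g) * b - (b - h) * g" by (simp add: algebra_simps)
    also have "\<dots> \<in> I"
      by (rule ideal_diff[OF I ideal_diff[OF I ab ideal_mult_right[OF I g(3)]] ideal_mult_right[OF I h(3)]])
    finally have "component w (c + d) (g * h) \<in> I" using gr by (simp add: graded_def)
    then have "component w c g * component w d h \<in> I" by (simp only: component_mult_top[OF g(1) h(1)])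
    from prime[OF weight_homogeneous_component weight_homogeneous_component this] g(2) h(2) show False by blast
  qed
qed

text \<open>
  The form in which primality is established below, for ideals \<open>M\<close> that are maximal with respect to
  a property of Hilbert polynomials: a homogeneous \<open>a \<notin> M\<close> with \<open>(M : a) \<noteq> M\<close> yields two strictly larger
  ideals, \<open>M + a R\<close> and \<open>(M : a)\<close>, which determine the Hilbert function of \<open>M\<close>.
\<close>

lemma maximal_cone_prime:
  fixes M :: "('n::finite, 'k::field) mpoly set"
  assumes M: "cone_ideal M" and one: "1 \<notin> M"
    and step: "\<And>a e. weight_homogeneous (\<lambda>_. 1) e a \<Longrightarrow> a \<notin> M \<Longrightarrow> M \<noteq> colon M {a} \<Longrightarrow> False"
  shows "is_prime M"
proof (rule graded_primeI[of _ "\<lambda>_. 1"])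
  fix a b d e assume a: "weight_homogeneous (\<lambda>_. 1) d a" and "a * b \<in> M"
  then have "b \<in> colon M {a}" by (simp add: colon_def mult.commute)
  then show "a \<in> M \<or> b \<in> M" using step[OF a] by blast
qed (use M one in simp_all)

definition variable :: "'n \<Rightarrow> ('n, 'k::field) mpoly" where
  "variable i = monom_of (Poly_Mapping.single i 1) 1"

lemma weight_single: "weight w (Poly_Mapping.single i k) = w i * (k :: nat)"
proof -
  have "weight w (Poly_Mapping.single i k) = (\<Sum>j\<in>UNIV. if j = i then w i * k else 0)"
    unfolding weight_def by (intro sum.cong) (auto simp: lookup_single)
  then show ?thesis by simp
qed

lemma variable_homogeneous: "weight_homogeneous (\<lambda>_. 1) 1 (variable i)"
  by (simp add: weight_homogeneous_def variable_def weight_single)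

lemma origin_generated:
  assumes I: "is_ideal I" and vars: "\<And>i. variable i \<in> I"
  shows "origin \<subseteq> (I :: ('n::finite, 'k::field) mpoly set)"
proof
  fix g :: "('n, 'k) mpoly" assume g: "g \<in> origin"
  have "monom_of e (coeff_of g e) \<in> I" if "e \<in> Poly_Mapping.keys g" for e
  proof -
    have "e \<noteq> 0" using that g by (auto simp: origin_def in_keys_iff)
    then obtain i where i: "Poly_Mapping.lookup e i \<noteq> 0"
      by (metis lookup_zero poly_mapping_eqI)
    have "(e - Poly_Mapping.single i 1) + Poly_Mapping.single i 1 = e"
      using i by (intro poly_mapping_eqI) (auto simp: lookup_add lookup_minus lookup_single when_def)
    then have "monom_of e (coeff_of g e) = monom_of (e - Poly_Mapping.single i 1) (coeff_of g e) * variable i"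
      by (simp add: variable_def mult_single)
    then show ?thesis using ideal_mult[OF I vars] by simp
  qed
  then have "(\<Sum>e\<in>Poly_Mapping.keys g. monom_of e (coeff_of g e)) \<in> I" by (intro ideal_sum[OF I])
  then show "g \<in> I" by (simp flip: mpoly_eq_sum_monoms)
qed

lemma component_degree_0: "component (\<lambda>_. 1) 0 g = monom_of 0 (coeff_of g 0)"
proof (rule poly_mapping_eqI)
  fix e :: "'a \<Rightarrow>\<^sub>0 nat"
  have "monom_degree e = 0 \<longleftrightarrow> e = 0"
    by (auto simp: weight_def poly_mapping_eq_iff fun_eq_iff)
  then show "coeff_of (component (\<lambda>_. 1) 0 g) e = coeff_of (monom_of 0 (coeff_of g 0)) e"
    by (auto simp: coeff_component lookup_single when_def)
qed

lemma cone_subset_origin: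
  fixes I :: "('n::finite, 'k::field) mpoly set"
  assumes I: "cone_ideal I" "1 \<notin> I"
  shows "I \<subseteq> origin"
proof
  fix g assume "g \<in> I"
  then have "component (\<lambda>_. 1) 0 g \<in> I" using I by (simp add: graded_def)
  then have c: "monom_of 0 (coeff_of g 0) \<in> I" unfolding component_degree_0 .
  have "coeff_of g 0 = 0"
  proof (rule ccontr)
    assume "coeff_of g 0 \<noteq> 0"
    then have "monom_of 0 (inverse (coeff_of g 0)) * monom_of 0 (coeff_of g 0) = (1 :: ('n, 'k) mpoly)"
      by (simp add: mult_single)
    then show False using I ideal_mult[OF _ c] by metis
  qed
  then show "g \<in> origin" by (simp add: origin_def)
qed

lemma origin_prime: "is_prime (origin :: ('n::finite, 'k::field) mpoly set)"
proof -
  have coeff_mult: "coeff_of (a * b) 0 = coeff_of a 0 * coeff_of b 0" for a b :: "('n, 'k) mpoly"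
  proof -
    have "monom_of 0 (coeff_of (a * b) 0) = component (\<lambda>_. 1) 0 (a * b)"
      unfolding component_degree_0 ..
    also have "\<dots> = component (\<lambda>_. 1) 0 a * component (\<lambda>_. 1) 0 b"
      unfolding component_mult by simp
    also have "\<dots> = monom_of 0 (coeff_of a 0 * coeff_of b 0)"
      unfolding component_degree_0 by (simp add: mult_single)
    finally show ?thesis by (metis lookup_single_eq)
  qed
  show ?thesis
    unfolding is_prime_def by (auto simp: origin_def coeff_mult lookup_add intro!: is_idealI)
qed

lemma hilbert_function_zero:
  fixes I :: "('n::finite, 'k::field) mpoly set"
  assumes "forms d \<subseteq> I"
  shows "hilbert_function I d = 0"
proof -
  have "I \<inter> forms d = forms d" using assms by blast
  then show ?thesis by (simp add: hilbert_function_codim codim_def)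
qed

lemma forms_origin: "d > 0 \<Longrightarrow> forms d \<subseteq> origin"
proof
  fix g :: "('n::finite, 'k::field) mpoly" assume "d > 0" "g \<in> forms d"
  then have "0 \<notin> Poly_Mapping.keys g" by (auto simp: forms_def weight_homogeneous_def)
  then show "g \<in> origin" by (simp add: origin_def in_keys_iff)
qed

lemma colon_prime:
  assumes "is_prime P" "x \<notin> P"
  shows "colon P {x} = P"
proof
  show "colon P {x} \<subseteq> P" using assms prime_mult by (auto simp: colon_def)
  show "P \<subseteq> colon P {x}" by (rule colon_superset[OF prime_ideal[OF assms(1)]])
qed

lemma principal_enlarges: "is_ideal M \<Longrightarrow> a \<notin> M \<Longrightarrow> M \<subset> ideal_plus M (principal_ideal a)"
  using ideal_plus_left[OF ideal_principal, of M a] ideal_plus_right[of M "principal_ideal a"]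
    principal_self[of a] by blast

definition is_hilbert_poly :: "('n::finite, 'k::field) mpoly set \<Rightarrow> rat poly \<Rightarrow> bool" where
  "is_hilbert_poly I q \<longleftrightarrow> (\<forall>\<^sub>F d in sequentially. poly q (of_nat d) = of_nat (hilbert_function I d))"

lemma is_hilbert_poly_exact:
  fixes M :: "('n::finite, 'k::{field, finite}) mpoly set"
  assumes M: "cone_ideal M" and a: "weight_homogeneous (\<lambda>_. 1) e a"
    and q: "is_hilbert_poly (ideal_plus M (principal_ideal a)) q" and r: "is_hilbert_poly (colon M {a}) r"
  shows "is_hilbert_poly M (q + pcompose r [:- of_nat e, 1:])"
proof -
  let ?J = "ideal_plus M (principal_ideal a)" and ?C = "colon M {a}"
  obtain N where N: "\<And>d. d \<ge> N \<Longrightarrow> poly q (of_nat d) = of_nat (hilbert_function ?J d)"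
    using q unfolding is_hilbert_poly_def eventually_sequentially by blast
  obtain N' where N': "\<And>d. d \<ge> N' \<Longrightarrow> poly r (of_nat d) = of_nat (hilbert_function ?C d)"
    using r unfolding is_hilbert_poly_def eventually_sequentially by blast
  have "poly (q + pcompose r [:- of_nat e, 1:]) (of_nat d) = of_nat (hilbert_function M d)"
    if "d \<ge> max N (N' + e)" for d
  proof -
    have d: "e \<le> d" "d - e \<ge> N'" "d \<ge> N" using that by auto
    have shift: "- of_nat e + of_nat d = (of_nat (d - e) :: rat)" using d(1) by (simp add: of_nat_diff)
    have "poly (q + pcompose r [:- of_nat e, 1:]) (of_nat d) =
        poly q (of_nat d) + poly r (- of_nat e + of_nat d)"
      by (simp add: poly_pcompose)
    also have "\<dots> = of_nat (hilbert_function ?J d + hilbert_function ?C (d - e))"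
      unfolding shift N[OF d(3)] N'[OF d(2)] by simp
    also have "\<dots> = of_nat (hilbert_function M d)"
      using hilbert_function_exact[OF _ _ a, of M "d - e"] M d(1) by simp
    finally show ?thesis .
  qed
  then show ?thesis unfolding is_hilbert_poly_def eventually_sequentially by blast
qed

text \<open>
  A maximal homogeneous ideal \<open>M\<close> without Hilbert polynomial is prime by \<open>is_hilbert_poly_exact\<close>. It
  does not contain all variables, since otherwise its Hilbert function would be eventually \<open>0\<close>. For a
  variable \<open>x \<notin> M\<close> the difference of the Hilbert function of \<open>M\<close> is the Hilbert function of
  \<open>M + x R\<close>, hence eventually a polynomial, and so is the Hilbert function of \<open>M\<close> itself.
\<close>

lemma hilbert_poly_exists:
  fixes I :: "('n::finite, 'k::{field, finite}) mpoly set"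
  assumes "cone_ideal I"
  shows "\<exists>q. is_hilbert_poly I q"
proof (rule ccontr)
  assume "\<not> ?thesis"
  then have "graded (\<lambda>_. 1) I \<and> (\<nexists>q. is_hilbert_poly I q)" using assms by simp
  from maximal_ideal_exists[of I "\<lambda>I. graded (\<lambda>_. 1) I \<and> (\<nexists>q. is_hilbert_poly I q)", OF _ this] assms
  obtain M :: "('n, 'k) mpoly set" where M: "cone_ideal M" "\<nexists>q. is_hilbert_poly M q"
    and max: "\<forall>J. is_ideal J \<longrightarrow> graded (\<lambda>_. 1) J \<and> (\<nexists>q. is_hilbert_poly J q) \<longrightarrow> M \<subseteq> J \<longrightarrow> J = M"
    by blast
  have bigger: "\<exists>q. is_hilbert_poly J q" if "cone_ideal J" "M \<subset> J" for J using max that by blast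
  have not_all: "\<not> (\<forall>d>0. forms d \<subseteq> M)"
  proof
    assume "\<forall>d>0. forms d \<subseteq> M"
    then have "is_hilbert_poly M 0"
      unfolding is_hilbert_poly_def eventually_sequentially
      by (intro exI[of _ 1]) (simp add: hilbert_function_zero)
    then show False using M(2) by blast
  qed
  have one: "1 \<notin> M" using not_all ideal_one[of M] M(1) by blast
  have prime: "is_prime M"
  proof (rule maximal_cone_prime[OF M(1) one])
    fix a e assume a: "weight_homogeneous (\<lambda>_. 1) e a" "a \<notin> M" "M \<noteq> colon M {a}"
    obtain q where q: "is_hilbert_poly (ideal_plus M (principal_ideal a)) q"
      using bigger[OF cone_plus_principal[OF M(1) a(1)] principal_enlarges[OF _ a(2)]] M(1) by blast
    have "M \<subset> colon M {a}" using colon_superset[of M "{a}"] M(1) a(3) by blast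
    then obtain r where r: "is_hilbert_poly (colon M {a}) r"
      using bigger[OF cone_colon[OF M(1) a(1)]] by blast
    show False using is_hilbert_poly_exact[OF M(1) a(1) q r] M(2) by blast
  qed
  obtain i where i: "variable i \<notin> M"
    using not_all M(1) origin_generated[of M] forms_origin by blast
  let ?x = "variable i :: ('n, 'k) mpoly"
  obtain q where "is_hilbert_poly (ideal_plus M (principal_ideal ?x)) q"
    using bigger[OF cone_plus_principal[OF M(1) variable_homogeneous] principal_enlarges[OF _ i]] M(1) by blast
  then obtain N where
    q: "\<And>d. d \<ge> N \<Longrightarrow> poly q (of_nat d) = of_nat (hilbert_function (ideal_plus M (principal_ideal ?x)) d)"
    unfolding is_hilbert_poly_def eventually_sequentially by blast
  obtain S :: "rat poly" where S: "\<And>x. poly S (x + 1) - poly S x = poly (pcompose q [:1, 1:]) x"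
    using antidifference_exists by blast
  \<comment> \<open>The antidifference is determined up to a constant, which is adjusted at \<open>N\<close>.\<close>
  define c where "c = of_nat (hilbert_function M N) - poly S (of_nat N)"
  have "poly (S + [:c:]) (of_nat d) = of_nat (hilbert_function M d)" if "d \<ge> N" for d
    using that
  proof (induction d rule: dec_induct)
    case base
    then show ?case by (simp add: c_def)
  next
    case (step d)
    have "hilbert_function M (Suc d) = hilbert_function (ideal_plus M (principal_ideal ?x)) (Suc d) + hilbert_function M d"
      using hilbert_function_exact[OF _ _ variable_homogeneous, of M d i] M(1) colon_prime[OF prime i] by simp
    moreover have "poly S (of_nat d + 1) - poly S (of_nat d) = poly q (of_nat (Suc d))"
      unfolding S by (simp add: poly_pcompose)
    ultimately show ?case using step q[of "Suc d"] by (simp add: add.commute)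
  qed
  then have "is_hilbert_poly M (S + [:c:])"
    unfolding is_hilbert_poly_def eventually_sequentially by blast
  then show False using M(2) by blast
qed

lemma hilbert_polyI:
  assumes q: "is_hilbert_poly I q"
  shows "hilbert_poly I = q"
  unfolding hilbert_poly_def
proof (rule the_equality)
  show "\<forall>\<^sub>F d in sequentially. poly q (of_nat d) = of_nat (hilbert_function I d)"
    using q by (simp add: is_hilbert_poly_def)
next
  fix r :: "rat poly" assume "\<forall>\<^sub>F d in sequentially. poly r (of_nat d) = of_nat (hilbert_function I d)"
  with q[unfolded is_hilbert_poly_def] have "\<forall>\<^sub>F d in sequentially. poly r (of_nat d) = poly q (of_nat d)"
    by eventually_elim simp
  then show "r = q" by (rule poly_eq_eventually)
qed

lemma is_hilbert_poly_hilbert_poly: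
  fixes I :: "('n::finite, 'k::{field, finite}) mpoly set"
  assumes "cone_ideal I"
  shows "is_hilbert_poly I (hilbert_poly I)"
  using hilbert_poly_exists[OF assms] hilbert_polyI by blast

lemmas hilbert_poly_eventually = is_hilbert_poly_hilbert_poly[unfolded is_hilbert_poly_def]

definition hilbert_dim :: "('n::finite, 'k::field) mpoly set \<Rightarrow> nat" where
  "hilbert_dim I = poly_dim (hilbert_poly I)"

text \<open>
  By \<open>affine_hilbert_graded\<close> the partial sums are the affine Hilbert function, to be compared with
  chains of primes.
\<close>

lemma hilbert_growth:
  fixes I :: "('n::finite, 'k::{field, finite}) mpoly set"
  assumes I: "cone_ideal I"
  shows "\<exists>C. \<forall>d. (\<Sum>i\<le>d. hilbert_function I i) \<le> C * (d + 1) ^ hilbert_dim I"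
proof -
  let ?q = "hilbert_poly I" and ?H = "hilbert_function I"
  obtain N where N: "\<And>d. d \<ge> N \<Longrightarrow> poly ?q (of_nat d) = of_nat (?H d)"
    using hilbert_poly_eventually[OF I] unfolding eventually_sequentially by blast
  define C where "C = (\<Sum>i\<le>N. ?H i)"
  show ?thesis
  proof (cases "?q = 0")
    case True
    then have zero: "?H i = 0" if "i \<ge> N" for i using N[OF that] by simp
    have "(\<Sum>i\<le>d. ?H i) \<le> C" for d
    proof -
      have "(\<Sum>i\<le>d. ?H i) \<le> (\<Sum>i\<le>max d N. ?H i)" by (intro sum_mono2) auto
      also have "\<dots> = C"
        unfolding C_def using zero by (intro sum.mono_neutral_right) auto
      finally show ?thesis .
    qed
    then show ?thesis using True by (intro exI[of _ C]) (simp add: hilbert_dim_def poly_dim_def)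
  next
    case False
    let ?k = "Polynomial.degree ?q"
    obtain B :: nat where B: "\<And>n. \<bar>poly ?q (of_nat n)\<bar> \<le> of_nat B * (of_nat n + 1) ^ ?k"
      using poly_bounded_by_degree by blast
    have bound: "?H i \<le> (B + C) * (i + 1) ^ ?k" for i
    proof (cases "i \<ge> N")
      case True
      have "(of_nat (?H i) :: rat) \<le> of_nat B * (of_nat i + 1) ^ ?k" using B[of i] N[OF True] by simp
      also have "\<dots> = of_nat (B * (i + 1) ^ ?k)" by (simp add: add.commute)
      finally have "?H i \<le> B * (i + 1) ^ ?k" by (simp only: of_nat_le_iff)
      then show ?thesis by (simp add: add_mult_distrib)
    next
      case False
      then have "?H i \<le> C" unfolding C_def by (intro member_le_sum) auto
      also have "\<dots> \<le> (B + C) * (i + 1) ^ ?k"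
        using mult_le_mono[of C "B + C" 1 "(i + 1) ^ ?k"] by simp
      finally show ?thesis .
    qed
    have "(\<Sum>i\<le>d. ?H i) \<le> (B + C) * (d + 1) ^ hilbert_dim I" for d
    proof -
      have "(\<Sum>i\<le>d. ?H i) \<le> (\<Sum>i\<le>d. (B + C) * (d + 1) ^ ?k)"
        using bound by (intro sum_mono order_trans[OF bound] mult_le_mono2 power_mono) auto
      also have "\<dots> = (B + C) * (d + 1) ^ hilbert_dim I"
        using False by (simp add: hilbert_dim_def poly_dim_def algebra_simps)
      finally show ?thesis .
    qed
    then show ?thesis by blast
  qed
qed

section \<open>Krull dimension\<close>

lemma hilbert_dim_le_growth:
  fixes I :: "('n::finite, 'k::{field, finite}) mpoly set"
  assumes I: "cone_ideal I" and le: "\<And>d. hilbert_function I d \<le> C * (d + 1) ^ k"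
  shows "hilbert_dim I \<le> Suc k"
  unfolding hilbert_dim_def
proof (rule poly_dim_le_growth)
  show "\<forall>\<^sub>F n in sequentially. 0 \<le> poly (hilbert_poly I) (of_nat n)"
    using hilbert_poly_eventually[OF I] by eventually_elim simp
  have "(of_nat (hilbert_function I n) :: rat) \<le> of_nat (C * (n + 1) ^ k)" for n
    using le by (simp only: of_nat_le_iff)
  then have "(of_nat (hilbert_function I n) :: rat) \<le> of_nat C * (of_nat n + 1) ^ k" for n
    by (simp add: add.commute)
  then show "\<forall>\<^sub>F n in sequentially. poly (hilbert_poly I) (of_nat n) \<le> of_nat C * (of_nat n + 1) ^ k"
    using hilbert_poly_eventually[OF I] by (auto elim: eventually_mono)
qed

lemma hilbert_poly_zero:
  assumes zero: "\<And>d. d \<ge> N \<Longrightarrow> hilbert_function I d = 0"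
  shows "hilbert_poly I = 0"
  using zero by (intro hilbert_polyI) (auto simp: is_hilbert_poly_def eventually_sequentially)

lemma hilbert_dim_antimono:
  fixes I J :: "('n::finite, 'k::{field, finite}) mpoly set"
  assumes I: "cone_ideal I" and J: "cone_ideal J" and IJ: "I \<subseteq> J"
  shows "hilbert_dim J \<le> hilbert_dim I"
proof -
  have le: "hilbert_function J d \<le> hilbert_function I d" for d
    using I J IJ by (intro hilbert_function_antimono) auto
  show ?thesis
  proof (cases "hilbert_poly I = 0")
    case True
    obtain N where N: "\<And>d. d \<ge> N \<Longrightarrow> poly (hilbert_poly I) (of_nat d) = of_nat (hilbert_function I d)"
      using hilbert_poly_eventually[OF I] unfolding eventually_sequentially by blast
    have "hilbert_function J d = 0" if "d \<ge> N" for d using N[OF that] le[of d] True by simp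
    then have "hilbert_poly J = 0" by (rule hilbert_poly_zero)
    then show ?thesis by (simp add: hilbert_dim_def poly_dim_def)
  next
    case False
    obtain B :: nat where B: "\<And>n. \<bar>poly (hilbert_poly I) (of_nat n)\<bar> \<le>
        of_nat B * (of_nat n + 1) ^ Polynomial.degree (hilbert_poly I)"
      using poly_bounded_by_degree by blast
    have "poly_dim (hilbert_poly J) \<le> Suc (Polynomial.degree (hilbert_poly I))"
    proof (rule poly_dim_le_growth)
      show "\<forall>\<^sub>F n in sequentially. 0 \<le> poly (hilbert_poly J) (of_nat n)"
        using hilbert_poly_eventually[OF J] by eventually_elim simp
      show "\<forall>\<^sub>F n in sequentially. poly (hilbert_poly J) (of_nat n) \<le>
          of_nat B * (of_nat n + 1) ^ Polynomial.degree (hilbert_poly I)"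
        using hilbert_poly_eventually[OF I] hilbert_poly_eventually[OF J]
      proof eventually_elim
        case (elim n)
        have "poly (hilbert_poly J) (of_nat n) \<le> poly (hilbert_poly I) (of_nat n)"
          unfolding elim using le by simp
        also have "\<dots> \<le> of_nat B * (of_nat n + 1) ^ Polynomial.degree (hilbert_poly I)"
          using B[of n] by simp
        finally show ?case .
      qed
    qed
    then show ?thesis using False by (simp add: hilbert_dim_def poly_dim_def)
  qed
qed

lemma hilbert_poly_exact:
  fixes M :: "('n::finite, 'k::{field, finite}) mpoly set"
  assumes M: "cone_ideal M" and a: "weight_homogeneous (\<lambda>_. 1) e a"
  shows "hilbert_poly M = hilbert_poly (ideal_plus M (principal_ideal a)) +
    pcompose (hilbert_poly (colon M {a})) [:- of_nat e, 1:]"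
  by (intro hilbert_polyI is_hilbert_poly_exact[OF M a] is_hilbert_poly_hilbert_poly
      cone_plus_principal[OF M a] cone_colon[OF M a])

lemma hilbert_dim_UNIV: "hilbert_dim (UNIV :: ('n::finite, 'k::{field, finite}) mpoly set) = 0"
proof -
  have "hilbert_poly (UNIV :: ('n, 'k) mpoly set) = 0"
    by (rule hilbert_poly_zero[of 0]) (simp add: hilbert_function_zero)
  then show ?thesis by (simp add: hilbert_dim_def poly_dim_def)
qed

text \<open>
  An ideal that is maximal among the homogeneous ideals of dimension at least \<open>hilbert_dim I\<close> is
  prime, by additivity of the Hilbert polynomial.
\<close>

lemma cone_prime_above_exists:
  fixes I :: "('n::finite, 'k::{field, finite}) mpoly set"
  assumes I: "cone_ideal I" and dim: "hilbert_dim I > 0"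
  obtains Q where "is_prime Q" "cone_ideal Q" "I \<subseteq> Q" "hilbert_dim Q \<ge> hilbert_dim I"
proof -
  let ?g = "hilbert_dim I"
  obtain M where M: "cone_ideal M" "?g \<le> hilbert_dim M" "I \<subseteq> M"
    and max: "\<forall>J. is_ideal J \<longrightarrow> graded (\<lambda>_. 1) J \<and> ?g \<le> hilbert_dim J \<longrightarrow> M \<subseteq> J \<longrightarrow> J = M"
    using maximal_ideal_exists[of I "\<lambda>J. graded (\<lambda>_. 1) J \<and> ?g \<le> hilbert_dim J"] I by auto
  have smaller: "poly_dim (hilbert_poly J) \<le> ?g - 1" if "cone_ideal J" "M \<subset> J" for J
  proof -
    have "\<not> ?g \<le> hilbert_dim J" using max that by blast
    then show ?thesis by (simp add: hilbert_dim_def)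
  qed
  have one: "1 \<notin> M"
    using ideal_one[of M] M dim hilbert_dim_UNIV[where 'n='n and 'k='k] by fastforce
  have "is_prime M"
  proof (rule maximal_cone_prime[OF M(1) one])
    fix a e assume a: "weight_homogeneous (\<lambda>_. 1) e a" "a \<notin> M" "M \<noteq> colon M {a}"
    have "poly_dim (hilbert_poly (ideal_plus M (principal_ideal a))) \<le> ?g - 1"
      using M(1) a(2) by (intro smaller cone_plus_principal[OF M(1) a(1)] principal_enlarges) simp_all
    moreover have "M \<subset> colon M {a}"
      using M(1) a(3) colon_superset[of M "{a}"] by blast
    then have "poly_dim (pcompose (hilbert_poly (colon M {a})) [:- of_nat e, 1:]) \<le> ?g - 1"
      unfolding poly_dim_shift by (rule smaller[OF cone_colon[OF M(1) a(1)]])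
    ultimately have "poly_dim (hilbert_poly M) \<le> ?g - 1"
      unfolding hilbert_poly_exact[OF M(1) a(1)] by (rule poly_dim_add)
    then show False using M(2) dim by (simp add: hilbert_dim_def)
  qed
  then show thesis using that M by blast
qed

text \<open>
  A hyperplane section drops the dimension by at most \<open>1\<close>, because the Hilbert function of \<open>P\<close> sums up
  that of the section.
\<close>

lemma hilbert_dim_variable_section:
  fixes P :: "('n::finite, 'k::{field, finite}) mpoly set"
  assumes P: "is_prime P" "cone_ideal P" and i: "variable i \<notin> P"
  shows "hilbert_dim P \<le> Suc (hilbert_dim (ideal_plus P (principal_ideal (variable i))))"
proof -
  let ?J = "ideal_plus P (principal_ideal (variable i))"
  have J: "cone_ideal ?J" by (rule cone_plus_principal[OF P(2) variable_homogeneous])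
  have step: "hilbert_function P (Suc d) = hilbert_function ?J (Suc d) + hilbert_function P d" for d
    using hilbert_function_exact[OF _ _ variable_homogeneous, of P d i] P colon_prime[OF P(1) i] by simp
  have sum: "hilbert_function P d \<le> hilbert_function P 0 + (\<Sum>j\<le>d. hilbert_function ?J j)" for d
    by (induction d) (simp_all add: step)
  obtain C where C: "\<And>d. (\<Sum>j\<le>d. hilbert_function ?J j) \<le> C * (d + 1) ^ hilbert_dim ?J"
    using hilbert_growth[OF J] by blast
  show ?thesis
  proof (rule hilbert_dim_le_growth[OF P(2)])
    fix d
    have "hilbert_function P d \<le> hilbert_function P 0 * 1 + C * (d + 1) ^ hilbert_dim ?J"
      using sum[of d] C[of d] by simp
    also have "\<dots> \<le> hilbert_function P 0 * (d + 1) ^ hilbert_dim ?J + C * (d + 1) ^ hilbert_dim ?J"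
      by (intro add_mono mult_le_mono2 one_le_power) auto
    finally show "hilbert_function P d \<le> (hilbert_function P 0 + C) * (d + 1) ^ hilbert_dim ?J"
      by (simp add: add_mult_distrib)
  qed
qed

text \<open>
  The chains whose lengths \<open>variety_dim P\<close> measures.
\<close>

definition prime_chain :: "'r::comm_ring_1 set \<Rightarrow> nat \<Rightarrow> (nat \<Rightarrow> 'r set) \<Rightarrow> bool" where
  "prime_chain P l Z \<longleftrightarrow> (\<forall>i\<le>l. is_prime (Z i) \<and> P \<subseteq> Z i) \<and> (\<forall>i<l. Z i \<subset> Z (Suc i))"

lemma prime_chain_prepend:
  assumes "is_prime P" "P \<subset> Q" "prime_chain Q l Z"
  shows "prime_chain P (Suc l) (case_nat P Z)"
  unfolding prime_chain_def
proof (intro conjI allI impI)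
  fix i assume i: "i \<le> Suc l"
  show "is_prime (case i of 0 \<Rightarrow> P | Suc x \<Rightarrow> Z x)"
    using assms i by (cases i) (simp_all add: prime_chain_def)
  show "P \<subseteq> (case i of 0 \<Rightarrow> P | Suc x \<Rightarrow> Z x)"
  proof (cases i)
    case (Suc j)
    then have "Q \<subseteq> Z j" using assms(3) i by (simp add: prime_chain_def)
    then show ?thesis using Suc assms(2) by auto
  qed simp
next
  fix i assume i: "i < Suc l"
  show "(case i of 0 \<Rightarrow> P | Suc x \<Rightarrow> Z x) \<subset> (case Suc i of 0 \<Rightarrow> P | Suc x \<Rightarrow> Z x)"
  proof (cases i)
    case 0
    have "Q \<subseteq> Z 0" using assms(3) by (simp add: prime_chain_def)
    then show ?thesis using 0 assms(2) by auto
  next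
    case (Suc j)
    then show ?thesis using assms(3) i by (simp add: prime_chain_def)
  qed
qed

text \<open>
  Cut with a variable and pass to a homogeneous prime of the same dimension.
\<close>

lemma prime_chain_exists:
  fixes P :: "('n::finite, 'k::{field, finite}) mpoly set"
  shows "is_prime P \<Longrightarrow> cone_ideal P \<Longrightarrow> k \<le> hilbert_dim P \<Longrightarrow> \<exists>Z. prime_chain P k Z"
proof (induction k arbitrary: P)
  case 0
  then show ?case by (intro exI[of _ "\<lambda>_. P"]) (simp add: prime_chain_def)
next
  case (Suc k)
  have "\<exists>i. variable i \<notin> P"
  proof (rule ccontr)
    assume "\<not> ?thesis"
    then have "origin \<subseteq> P" using Suc.prems by (intro origin_generated) auto
    then have "hilbert_function P d = 0" if "d \<ge> 1" for d
      using forms_origin[of d] that by (intro hilbert_function_zero) auto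
    then have "hilbert_poly P = 0" by (rule hilbert_poly_zero)
    then show False using Suc.prems(3) by (simp add: hilbert_dim_def poly_dim_def)
  qed
  then obtain i where i: "variable i \<notin> P" by blast
  let ?J = "ideal_plus P (principal_ideal (variable i))"
  have J: "cone_ideal ?J" by (rule cone_plus_principal[OF Suc.prems(2) variable_homogeneous])
  have PJ: "P \<subset> ?J" using Suc.prems(2) i by (intro principal_enlarges) auto
  have dim: "k \<le> hilbert_dim ?J"
    using hilbert_dim_variable_section[OF Suc.prems(1,2) i] Suc.prems(3) by simp
  obtain Q where Q: "is_prime Q" "cone_ideal Q" "P \<subset> Q" "k \<le> hilbert_dim Q"
  proof (cases "k = 0")
    case True
    have "P \<subseteq> origin"
      using cone_subset_origin[OF Suc.prems(2) prime_one[OF Suc.prems(1)]] .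
    moreover have "(variable i :: ('n, 'k) mpoly) \<in> origin"
      using forms_origin[of 1] variable_homogeneous[of i] by (auto simp: forms_def)
    ultimately have "P \<subset> origin" using i by blast
    moreover have "graded (\<lambda>_. 1) (origin :: ('n, 'k) mpoly set)"
      by (auto simp: graded_def origin_def coeff_component)
    ultimately show thesis using that[OF origin_prime] True prime_ideal[OF origin_prime] by blast
  next
    case False
    then obtain Q where "is_prime Q" "cone_ideal Q" "?J \<subseteq> Q" "hilbert_dim ?J \<le> hilbert_dim Q"
      using cone_prime_above_exists[OF J] dim by auto
    then show thesis using that[of Q] PJ dim by auto
  qed
  obtain Z where "prime_chain Q k Z" using Suc.IH[OF Q(1,2,4)] by blast
  then show ?case using prime_chain_prepend[OF Suc.prems(1) Q(3)] by blast
qed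

text \<open>
  By \<open>affine_hilbert_step\<close> each step down the chain sums up the affine Hilbert function, so along a
  chain of length \<open>l\<close> it grows at least like the \<open>l\<close>-th power; but it grows at most like the power
  \<open>hilbert_dim P\<close>.
\<close>

lemma prime_chain_length:
  fixes P :: "('n::finite, 'k::{field, finite}) mpoly set"
  assumes P: "cone_ideal P" and Z: "prime_chain P l Z"
  shows "l \<le> hilbert_dim P"
proof -
  let ?B = "bounded_polys :: nat \<Rightarrow> ('n, 'k) mpoly set"
  have prime: "is_prime (Z i)" "P \<subseteq> Z i" if "i \<le> l" for i using Z that by (simp_all add: prime_chain_def)
  have "\<exists>y. fst y \<in> Z (Suc i) \<and> fst y \<notin> Z i \<and> weight_le (\<lambda>_. 1) (snd y) (fst y)" if "i < l" for i
  proof -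
    have "Z i \<subset> Z (Suc i)" using Z that by (simp add: prime_chain_def)
    then obtain x where "x \<in> Z (Suc i)" "x \<notin> Z i" by blast
    moreover obtain e where "weight_le (\<lambda>_. 1) e x" using weight_le_exists by blast
    ultimately show ?thesis by (intro exI[of _ "(x, e)"]) simp
  qed
  then have "\<forall>i\<in>{..<l}. \<exists>y. fst y \<in> Z (Suc i) \<and> fst y \<notin> Z i \<and> weight_le (\<lambda>_. 1) (snd y) (fst y)"
    by simp
  from bchoice[OF this] obtain y where
    y: "\<forall>i\<in>{..<l}. fst (y i) \<in> Z (Suc i) \<and> fst (y i) \<notin> Z i \<and> weight_le (\<lambda>_. 1) (snd (y i)) (fst (y i))" ..
  define x where "x i = fst (y i)" for i
  define e where "e i = snd (y i)" for i
  have x: "x i \<in> Z (Suc i) \<and> x i \<notin> Z i \<and> weight_le (\<lambda>_. 1) (e i) (x i)" if "i < l" for i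
    unfolding x_def e_def by (rule bspec[OF y]) (use that in simp)
  \<comment> \<open>A common bound for the degrees of the elements separating consecutive primes.\<close>
  define E where "E = (\<Sum>i<l. e i)"
  have xE: "weight_le (\<lambda>_. 1) E (x i)" if "i < l" for i
  proof -
    have "e i \<le> E" unfolding E_def by (rule member_le_sum) (use that in simp_all)
    moreover have "weight_le (\<lambda>_. 1) (e i) (x i)" using x[OF that] by simp
    ultimately show ?thesis using weight_le_mono by blast
  qed
  define A where "A i d = codim (?B d) (Z i)" for i d
  have step: "A (Suc i) (E + d) + A i d \<le> A i (E + d)" if "i < l" for i d
    unfolding A_def
  proof (rule affine_hilbert_step)
    show "is_prime (Z i)" using prime that by simp
    show "is_ideal (Z (Suc i))" by (rule prime_ideal[OF prime(1)]) (use that in simp)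
    show "Z i \<subseteq> Z (Suc i)" using Z that by (auto simp: prime_chain_def)
    show "x i \<in> Z (Suc i)" "x i \<notin> Z i" using x[OF that] by simp_all
    show "weight_le (\<lambda>_. 1) E (x i)" by (rule xE[OF that])
  qed
  have positive: "A l d \<ge> 1" for d
  proof (rule ccontr)
    assume "\<not> ?thesis"
    then have "codim (?B d) (Z l) = 0" by (simp add: A_def)
    then have "card (?B d) = card (Z l \<inter> ?B d)"
      using card_codim[OF subspace_bounded finite_bounded prime_ideal[OF prime(1)], of l d] by simp
    then have "Z l \<inter> ?B d = ?B d"
      using finite_bounded by (intro card_subset_eq) auto
    moreover have "1 \<in> ?B d" by (simp add: bounded_polys_def)
    ultimately have "1 \<in> Z l" by blast
    then show False using prime_one[OF prime(1)[of l]] by simp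
  qed
  have grow: "k \<le> l \<Longrightarrow> M \<ge> k * m \<Longrightarrow> A (l - k) (M * E) \<ge> m ^ k" for k M m
  proof (induction k arbitrary: M)
    case 0
    then show ?case using positive by simp
  next
    case (Suc k)
    define i where "i = l - Suc k"
    have i: "i < l" "Suc i = l - k" using Suc.prems by (auto simp: i_def)
    have lower: "m ^ k \<le> A (Suc i) (M * E)" if "k * m \<le> M" for M
      unfolding i(2) using Suc.IH[of M] Suc.prems that by simp
    have "A i ((k * m + j) * E) \<ge> j * m ^ k" for j
    proof (induction j)
      case (Suc j)
      have "m ^ k \<le> A (Suc i) ((k * m + Suc j) * E)"
        by (rule lower) simp
      then show ?case
        using Suc.IH step[OF i(1), of "(k * m + j) * E"] by (simp add: add.commute add.left_commute)
    qed simp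
    from this[of "M - k * m"] have "(M - k * m) * m ^ k \<le> A i (M * E)"
      using Suc.prems by simp
    moreover have "m ^ Suc k \<le> (M - k * m) * m ^ k"
      unfolding power_Suc using Suc.prems by (intro mult_le_mono1) simp
    ultimately show ?case unfolding i_def by (rule order_trans[rotated])
  qed
  obtain C where C: "\<And>d. (\<Sum>i\<le>d. hilbert_function P i) \<le> C * (d + 1) ^ hilbert_dim P"
    using hilbert_growth[OF P] by blast
  have upper: "A 0 d \<le> C * (d + 1) ^ hilbert_dim P" for d
  proof -
    have idZ: "is_ideal (Z 0)" using prime[of 0] prime_ideal by blast
    have "A 0 d \<le> codim (?B d) P"
      unfolding A_def using P prime[of 0] idZ by (intro codim_antimono subspace_bounded finite_bounded) auto
    also have "\<dots> \<le> C * (d + 1) ^ hilbert_dim P"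
      using affine_hilbert_graded[of P d] P C by simp
    finally show ?thesis .
  qed
  show "l \<le> hilbert_dim P"
  proof (rule ccontr)
    assume "\<not> ?thesis"
    then obtain r where r: "l = Suc (hilbert_dim P + r)" using less_imp_Suc_add not_le by metis
    let ?g = "hilbert_dim P"
    \<comment> \<open>Large enough for \<open>m\<close> to exceed the constant in the upper bound at \<open>d = l m E\<close>.\<close>
    define m where "m = Suc (C * (l * E + 1) ^ ?g)"
    have "m > 0" by (simp add: m_def)
    have "m ^ l \<le> A 0 (l * m * E)" using grow[of l m "l * m"] by simp
    also have "\<dots> \<le> C * (l * m * E + 1) ^ ?g" by (rule upper)
    also have "\<dots> \<le> C * (m * (l * E + 1)) ^ ?g"
      using \<open>m > 0\<close> by (intro mult_le_mono2 power_mono) (auto simp: algebra_simps)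
    also have "\<dots> = (C * (l * E + 1) ^ ?g) * m ^ ?g"
      by (simp only: power_mult_distrib mult.assoc mult.commute[of "m ^ ?g" "(l * E + 1) ^ ?g"])
    also have "\<dots> < m * m ^ ?g" using \<open>m > 0\<close> by (intro mult_strict_right_mono) (auto simp: m_def)
    also have "\<dots> \<le> m ^ l" using \<open>m > 0\<close> unfolding r power_Suc[symmetric] by (intro power_increasing) auto
    finally show False by simp
  qed
qed

lemma variety_dim_cone:
  fixes P :: "('n::finite, 'k::{field, finite}) mpoly set"
  assumes P: "is_prime P" "cone_ideal P"
  shows "variety_dim P = enat (hilbert_dim P)"
proof -
  have iff: "((\<forall>i\<le>l. irreducible_variety (Z i) \<and> Z i \<sqsubseteq>\<^sub>s P) \<and>
      (\<forall>i<l. Z (Suc i) \<sqsubseteq>\<^sub>s Z i \<and> Z (Suc i) \<noteq> Z i)) \<longleftrightarrow> prime_chain P l Z" for l Z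
    by (auto simp: prime_chain_def irreducible_variety_def primeideal_iff_is_prime subscheme_le_def)
  have "{l. \<exists>Z. prime_chain P l Z} = {..hilbert_dim P}"
    using prime_chain_length[OF P(2)] prime_chain_exists[OF P] by auto
  then have "variety_dim P = (SUP l\<in>{..hilbert_dim P}. enat l)"
    unfolding variety_dim_def iff by simp
  also have "\<dots> = enat (hilbert_dim P)"
    by (rule antisym) (auto intro: SUP_least SUP_upper)
  finally show ?thesis .
qed

text \<open>
  Prepending \<open>P\<close> to a chain of maximal length above \<open>Q\<close>.
\<close>

lemma hilbert_dim_strict:
  fixes P Q :: "('n::finite, 'k::{field, finite}) mpoly set"
  assumes P: "is_prime P" "cone_ideal P" and Q: "is_prime Q" "cone_ideal Q" and PQ: "P \<subset> Q"
  shows "hilbert_dim Q < hilbert_dim P"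
proof -
  obtain Z where "prime_chain Q (hilbert_dim Q) Z" using prime_chain_exists[OF Q order_refl] by blast
  from prime_chain_length[OF P(2) prime_chain_prepend[OF P(1) PQ this]] show ?thesis by simp
qed

lemma hilbert_dim_0_iff:
  fixes P :: "('n::finite, 'k::{field, finite}) mpoly set"
  assumes P: "is_prime P" "cone_ideal P"
  shows "hilbert_dim P = 0 \<longleftrightarrow> P = origin"
proof
  have sub: "P \<subseteq> origin" by (rule cone_subset_origin[OF P(2) prime_one[OF P(1)]])
  have origin: "cone_ideal (origin :: ('n, 'k) mpoly set)"
    using prime_ideal[OF origin_prime] by (auto simp: graded_def origin_def coeff_component)
  assume "hilbert_dim P = 0"
  then show "P = origin" using sub hilbert_dim_strict[OF P origin_prime origin] by auto
next
  assume "P = origin"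
  then have "hilbert_function P d = 0" if "d \<ge> 1" for d
    using that forms_origin[of d] by (intro hilbert_function_zero) auto
  then have "hilbert_poly P = 0" by (rule hilbert_poly_zero)
  then show "hilbert_dim P = 0" by (simp add: hilbert_dim_def poly_dim_def)
qed

section \<open>Degrees\<close>

lemma hilbert_poly_Int_plus:
  fixes I J :: "('n::finite, 'k::{field, finite}) mpoly set"
  assumes I: "cone_ideal I" and J: "cone_ideal J"
  shows "hilbert_poly (I \<inter> J) + hilbert_poly (ideal_plus I J) = hilbert_poly I + hilbert_poly J"
proof (rule poly_eq_eventually)
  have "cone_ideal (I \<inter> J)" "cone_ideal (ideal_plus I J)"
    using I J by (auto simp: ideal_Int ideal_ideal_plus graded_Int graded_plus)
  note ev = this[THEN hilbert_poly_eventually] hilbert_poly_eventually[OF I] hilbert_poly_eventually[OF J]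
  have hf: "hilbert_function (I \<inter> J) d + hilbert_function (ideal_plus I J) d =
      hilbert_function I d + hilbert_function J d" for d
    using I J by (intro hilbert_function_Int_plus) auto
  show "\<forall>\<^sub>F d in sequentially. poly (hilbert_poly (I \<inter> J) + hilbert_poly (ideal_plus I J)) (of_nat d) =
      poly (hilbert_poly I + hilbert_poly J) (of_nat d)"
    using ev
  proof eventually_elim
    case (elim d)
    show ?case unfolding poly_add elim by (simp only: of_nat_add[symmetric] hf)
  qed
qed

text \<open>
  The top coefficient is additive over components. When \<open>Q\<close> is added to the primes with intersection
  \<open>I\<close>, the correction term belongs to \<open>I + Q\<close>. This ideal is strictly larger than the prime \<open>Q\<close>, since
  otherwise \<open>Q\<close> would contain one of the other primes; so its dimension is smaller and it does not
  contribute to the coefficient.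
\<close>

lemma hilbert_poly_Inter_primes:
  fixes \<Q> :: "('n::finite, 'k::{field, finite}) mpoly set set"
  assumes "finite \<Q>" "\<And>Q. Q \<in> \<Q> \<Longrightarrow> is_prime Q \<and> cone_ideal Q \<and> hilbert_dim Q \<le> Suc r"
    "\<And>Q Q'. Q \<in> \<Q> \<Longrightarrow> Q' \<in> \<Q> \<Longrightarrow> Q \<subseteq> Q' \<Longrightarrow> Q = Q'"
  shows "cone_ideal (\<Inter>\<Q>) \<and> hilbert_dim (\<Inter>\<Q>) \<le> Suc r \<and>
    Polynomial.coeff (hilbert_poly (\<Inter>\<Q>)) r = (\<Sum>Q\<in>\<Q>. Polynomial.coeff (hilbert_poly Q) r)"
  using assms
proof (induction \<Q>)
  case empty
  have "hilbert_poly (UNIV :: ('n, 'k) mpoly set) = 0"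
    using hilbert_dim_UNIV[where 'n='n and 'k='k] by (simp add: hilbert_dim_def poly_dim_0_iff)
  then show ?case by (simp add: ideal_UNIV graded_def hilbert_dim_UNIV)
next
  case (insert Q \<Q>)
  let ?I = "\<Inter>\<Q>"
  have IH: "cone_ideal ?I" "hilbert_dim ?I \<le> Suc r"
    "Polynomial.coeff (hilbert_poly ?I) r = (\<Sum>Q\<in>\<Q>. Polynomial.coeff (hilbert_poly Q) r)"
    using insert.IH insert.prems by auto
  have Q: "is_prime Q" "cone_ideal Q" "hilbert_dim Q \<le> Suc r" using insert.prems(1) by auto
  let ?S = "ideal_plus ?I Q"
  have S: "cone_ideal ?S" using IH(1) Q(2) by (simp add: ideal_ideal_plus graded_plus)
  have "hilbert_dim ?S \<le> r"
  proof (cases "hilbert_dim ?S = 0")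
    case False
    then obtain Q' where Q': "is_prime Q'" "cone_ideal Q'" "?S \<subseteq> Q'" "hilbert_dim ?S \<le> hilbert_dim Q'"
      using cone_prime_above_exists[OF S] by auto
    have "\<not> ?I \<subseteq> Q"
    proof
      assume "?I \<subseteq> Q"
      then obtain Q0 where "Q0 \<in> \<Q>" "Q0 \<subseteq> Q"
        using prime_Inter_subset[OF Q(1) insert.hyps(1)] insert.prems(1) by blast
      then have "Q0 = Q" using insert.prems(2) by blast
      then show False using \<open>Q0 \<in> \<Q>\<close> insert.hyps(2) by simp
    qed
    then have "Q \<subset> Q'"
      using Q'(3) ideal_plus_left[of Q ?I] ideal_plus_right[of ?I Q] Q(2) IH(1) by blast
    from hilbert_dim_strict[OF Q(1,2) Q'(1,2) this] Q'(4) Q(3) show ?thesis by simp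
  qed simp
  then have S0: "Polynomial.coeff (hilbert_poly ?S) r = 0" and
    S1: "poly_dim (hilbert_poly ?S) \<le> Suc r"
    using poly_dim_le_iff[of "hilbert_poly ?S" r] by (auto simp: hilbert_dim_def)
  have eq: "hilbert_poly (?I \<inter> Q) = hilbert_poly ?I + hilbert_poly Q - hilbert_poly ?S"
    using hilbert_poly_Int_plus[OF IH(1) Q(2)] by (simp add: algebra_simps)
  have "cone_ideal (?I \<inter> Q)" using IH(1) Q(2) by (simp add: ideal_Int graded_Int)
  moreover have "hilbert_dim (?I \<inter> Q) \<le> Suc r"
    using IH(2) Q(3) S1 unfolding hilbert_dim_def eq poly_dim_le_iff by simp
  moreover have "Polynomial.coeff (hilbert_poly (?I \<inter> Q)) r =
      (\<Sum>Q\<in>\<Q>. Polynomial.coeff (hilbert_poly Q) r) + Polynomial.coeff (hilbert_poly Q) r"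
    unfolding eq using IH(3) S0 by simp
  ultimately show ?case using insert.hyps by (simp add: Int_commute add.commute)
qed

lemma cone_degree_eq:
  fixes P :: "('n::finite, 'k::{field, finite}) mpoly set"
  assumes "hilbert_dim P = Suc r" "P \<noteq> origin"
  shows "cone_degree P = fact r * Polynomial.coeff (hilbert_poly P) r"
  using assms by (auto simp: cone_degree_def hilbert_dim_def poly_dim_def split: if_splits)

section \<open>The trace\<close>

text \<open>
  The unique exponent vector whose monomial \<open>Tr\<close> sends to the monomial with exponents \<open>u\<close>: the product
  with all variables has exponents \<open>p (u\<^sub>i + 1)\<close>.
\<close>

definition trace_exponent :: "nat \<Rightarrow> ('n::finite \<Rightarrow>\<^sub>0 nat) \<Rightarrow> ('n \<Rightarrow>\<^sub>0 nat)" where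
  "trace_exponent p u = Abs_poly_mapping (\<lambda>i. p * Poly_Mapping.lookup u i + (p - 1))"

lemma lookup_trace_exponent:
  "Poly_Mapping.lookup (trace_exponent p u) i = p * Poly_Mapping.lookup u i + (p - 1)"
  by (simp add: trace_exponent_def)

lemma lookup_ones: "Poly_Mapping.lookup ones i = 1"
  by (simp add: ones_def)

lemma weight_trace_exponent: "weight w (trace_exponent p u) = p * weight w u + (p - 1) * weight w ones"
  by (simp add: weight_def lookup_trace_exponent lookup_ones distrib_left sum.distrib
      sum_distrib_left mult_ac del: One_nat_def)

lemma Tr_spec:
  "near_splitting CARD('p) (Tr :: ('n::finite, 'p::prime_card mod_ring) mpoly \<Rightarrow> _)"
  "Tr (monom_of e (1 :: 'p mod_ring)) = trace_monomial CARD('p) e"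
  using theI'[OF ex1_Tr] unfolding Tr_def by blast+

lemma Tr_add: "Tr (g + h) = Tr g + (Tr h :: ('n::finite, 'p::prime_card mod_ring) mpoly)"
  using Tr_spec(1)[where 'p='p and 'n='n] by (simp add: near_splitting_def)

lemma Tr_pull_out: "Tr (a ^ CARD('p) * b) = a * (Tr b :: ('n::finite, 'p::prime_card mod_ring) mpoly)"
  using Tr_spec(1)[where 'p='p and 'n='n] by (simp add: near_splitting_def)

lemma Tr_zero [simp]: "Tr (0 :: ('n::finite, 'p::prime_card mod_ring) mpoly) = 0"
  using Tr_add[of 0 0] by simp

lemma coeff_trace_monomial:
  fixes e u :: "'n::finite \<Rightarrow>\<^sub>0 nat"
  assumes p: "p > 0"
  shows "coeff_of (trace_monomial p e) u = (if e = trace_exponent p u then 1 else (0 :: 'k::comm_ring_1))"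
proof (cases "\<forall>i. p dvd Poly_Mapping.lookup e i + 1")
  case True
  define v where "v = Abs_poly_mapping (\<lambda>i. (Poly_Mapping.lookup e i + 1) div p - 1)"
  have v: "Poly_Mapping.lookup v i = (Poly_Mapping.lookup e i + 1) div p - 1" for i
    by (simp add: v_def)
  have "p * Poly_Mapping.lookup v i + (p - 1) = Poly_Mapping.lookup e i" for i
  proof -
    obtain k where k: "Poly_Mapping.lookup e i + 1 = p * k" using True by (meson dvdE)
    then have "k > 0" by (cases k) auto
    then have "p * (k - 1) + p = p * k" by (cases k) auto
    moreover have "Poly_Mapping.lookup v i = k - 1" using p k v by simp
    ultimately show ?thesis using k p by simp
  qed
  then have e: "e = trace_exponent p v"
    by (intro poly_mapping_eqI) (simp add: lookup_trace_exponent)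
  have "e = trace_exponent p u \<longleftrightarrow> v = u"
  proof
    assume "e = trace_exponent p u"
    then have "trace_exponent p v = trace_exponent p u" using e by simp
    then have "p * Poly_Mapping.lookup v i + (p - 1) = p * Poly_Mapping.lookup u i + (p - 1)" for i
      by (simp only: lookup_trace_exponent[symmetric])
    then have "p * Poly_Mapping.lookup v i = p * Poly_Mapping.lookup u i" for i
      by (rule add_right_imp_eq)
    then show "v = u" using p by (intro poly_mapping_eqI) simp
  qed (use e in simp)
  moreover have "trace_monomial p e = monom_of v (1 :: 'k)"
    unfolding trace_monomial_def v_def using True by simp
  ultimately show ?thesis by (simp add: lookup_single when_def)
next
  case False
  have "e \<noteq> trace_exponent p u"
  proof
    assume e: "e = trace_exponent p u"
    have "Poly_Mapping.lookup e i + 1 = p * (Poly_Mapping.lookup u i + 1)" for i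
      unfolding e lookup_trace_exponent using p by simp
    then show False using False by simp
  qed
  moreover have "trace_monomial p e = (0 :: ('n, 'k) mpoly)"
    unfolding trace_monomial_def using False by (simp only: if_False)
  ultimately show ?thesis by simp
qed

text \<open>
  No roots of coefficients occur, because the Frobenius map of the prime field is the identity.
\<close>

lemma coeff_Tr:
  fixes g :: "('n::finite, 'p::prime_card mod_ring) mpoly"
  shows "coeff_of (Tr g) u = coeff_of g (trace_exponent CARD('p) u)"
proof (induction g rule: mpoly_induct)
  case 1
  then show ?case by simp
next
  case (2 e c)
  have "monom_of e c = monom_of 0 c ^ CARD('p) * monom_of e 1"
    by (simp add: monom_of_power mult_single mod_ring_power_card)
  then have "Tr (monom_of e c) = scalar_mult c (trace_monomial CARD('p) e)"
    by (simp only: Tr_pull_out Tr_spec(2) scalar_mult_def)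
  moreover have "coeff_of (scalar_mult c g) u = c * coeff_of g u" for g :: "('n, 'p mod_ring) mpoly"
    unfolding scalar_mult_def by (simp add: mult_map_scale_conv_mult[symmetric] Poly_Mapping.map.rep_eq when_def)
  moreover have "CARD('p) > 0" by simp
  ultimately show ?case
    by (simp add: coeff_trace_monomial lookup_single when_def)
next
  case (3 g h)
  then show ?case by (simp add: Tr_add lookup_add)
qed

text \<open>
  Weights are divided by \<open>p\<close> up to a shift by the weight of the product of all variables; the shift is
  absorbed by the \<open>(p - 1)\<close>-st power of a polynomial of that weight.
\<close>

lemma component_Tr:
  fixes g :: "('n::finite, 'p::prime_card mod_ring) mpoly"
  shows "component w d (Tr g) = Tr (component w ((CARD('p) - 1) * weight w ones + CARD('p) * d) g)"
proof (rule poly_mapping_eqI)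
  fix u
  have "weight w u = d \<longleftrightarrow> weight w (trace_exponent CARD('p) u) = (CARD('p) - 1) * weight w ones + CARD('p) * d"
    by (auto simp: weight_trace_exponent)
  then show "coeff_of (component w d (Tr g)) u =
      coeff_of (Tr (component w ((CARD('p) - 1) * weight w ones + CARD('p) * d) g)) u"
    by (simp only: coeff_component coeff_Tr)
qed

lemma weight_Tr_mult_power:
  fixes f g :: "('n::finite, 'p::prime_card mod_ring) mpoly"
  assumes f: "weight_le w (weight w ones) f" and g: "weight_le w c g"
    and e: "e \<in> Poly_Mapping.keys (Tr (f ^ (CARD('p) - 1) * g))"
  shows "CARD('p) * weight w e \<le> c"
proof -
  have "trace_exponent CARD('p) e \<in> Poly_Mapping.keys (f ^ (CARD('p) - 1) * g)"
    using e by (simp add: in_keys_iff coeff_Tr)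
  moreover have "weight_le w ((CARD('p) - 1) * weight w ones + c) (f ^ (CARD('p) - 1) * g)"
    by (intro weight_le_mult weight_le_power f g)
  ultimately show ?thesis unfolding weight_le_def by (fastforce simp: weight_trace_exponent)
qed

lemma component_Tr_mult_power:
  fixes f g :: "('n::finite, 'p::prime_card mod_ring) mpoly"
  assumes f: "weight_le w (weight w ones) f" and g: "weight_le w (CARD('p) * c) g"
  shows "component w c (Tr (f ^ (CARD('p) - 1) * g)) =
    Tr (component w (weight w ones) f ^ (CARD('p) - 1) * component w (CARD('p) * c) g)"
  unfolding component_Tr component_mult_top[OF weight_le_power[OF f] g] component_power_top[OF f] ..

lemma graded_map_Tr_mult_power:
  fixes f :: "('n::finite, 'p::prime_card mod_ring) mpoly"
  assumes f: "weight_homogeneous w (weight w ones) f"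
  shows "graded_map CARD('p) w (\<lambda>g. Tr (f ^ (CARD('p) - 1) * g))"
  unfolding graded_map_def component_Tr
    component_mult_homogeneous[OF weight_homogeneous_power[OF f]] by simp

lemma component_scaled:
  "component w d (Tr_multiple c h g) = scalar_mult c (component w d (Tr (h * g)))"
  by (simp add: Tr_multiple_def component_scalar_mult)

lemma graded_map_Tr_multiple:
  fixes f :: "('n::finite, 'p::prime_card mod_ring) mpoly"
  assumes f: "weight_homogeneous w (weight w ones) f"
  shows "graded_map CARD('p) w (Tr_multiple c (f ^ (CARD('p) - 1)))"
  using graded_map_Tr_mult_power[OF f]
  unfolding graded_map_def component_scaled by (simp add: Tr_multiple_def)

lemma weight_Tr_multiple:
  fixes f g :: "('n::finite, 'p::prime_card mod_ring) mpoly"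
  assumes f: "weight_le w (weight w ones) f" and g: "weight_le w c g"
    and e: "e \<in> Poly_Mapping.keys (Tr_multiple a (f ^ (CARD('p) - 1)) g)"
  shows "CARD('p) * weight w e \<le> c"
proof -
  have "Poly_Mapping.keys (scalar_mult a h) \<subseteq> Poly_Mapping.keys h" for h :: "('n, 'p mod_ring) mpoly"
    unfolding scalar_mult_def by (auto simp: in_keys_iff mult_map_scale_conv_mult[symmetric]
      Poly_Mapping.map.rep_eq when_def)
  then have "e \<in> Poly_Mapping.keys (Tr (f ^ (CARD('p) - 1) * g))"
    using e unfolding Tr_multiple_def by blast
  then show ?thesis by (rule weight_Tr_mult_power[OF f g])
qed

lemma monom_degree_ones: "monom_degree (ones :: 'n::finite \<Rightarrow>\<^sub>0 nat) = CARD('n)"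
  by (simp add: weight_def lookup_ones)

lemma weight_le_total_degree:
  assumes "total_degree f \<le> d"
  shows "weight_le (\<lambda>_. 1) d f"
  unfolding weight_le_def
proof
  fix e assume "e \<in> Poly_Mapping.keys f"
  then have "monom_degree e \<le> total_degree f" unfolding total_degree_def by (intro Max_ge) auto
  then show "monom_degree e \<le> d" using assms by simp
qed

text \<open>
  The power has degree at most \<open>n (p - 1)\<close>, which leaves degree \<open>0\<close> for its trace.
\<close>

lemma Tr_power_constant:
  fixes f :: "('n::finite, 'p::prime_card mod_ring) mpoly"
  assumes f: "weight_le (\<lambda>_. 1) CARD('n) f"
  shows "Tr (f ^ (CARD('p) - 1)) = monom_of 0 (coeff_of (f ^ (CARD('p) - 1)) (trace_exponent CARD('p) 0))"
proof (rule poly_mapping_eqI)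
  fix u :: "'n \<Rightarrow>\<^sub>0 nat"
  show "coeff_of (Tr (f ^ (CARD('p) - 1))) u =
      coeff_of (monom_of 0 (coeff_of (f ^ (CARD('p) - 1)) (trace_exponent CARD('p) 0))) u"
  proof (cases "u = 0")
    case True
    then show ?thesis by (simp add: coeff_Tr)
  next
    case False
    have "u \<notin> Poly_Mapping.keys (Tr (f ^ (CARD('p) - 1) * 1))"
    proof
      assume "u \<in> Poly_Mapping.keys (Tr (f ^ (CARD('p) - 1) * 1))"
      then have "CARD('p) * monom_degree u \<le> 0"
        by (intro weight_Tr_mult_power[of "\<lambda>_. 1" f 0 1]) (simp_all only: monom_degree_ones f weight_le_one)
      then have "Poly_Mapping.lookup u i = 0" for i by (simp add: weight_def)
      then have "u = 0" by (intro poly_mapping_eqI) simp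
      then show False using False by simp
    qed
    then show ?thesis using False by (simp add: in_keys_iff lookup_single when_def)
  qed
qed

section \<open>The Newton polytope\<close>

lemma degree_newton_polytope:
  assumes "total_degree f < CARD('n)"
  shows "exponent_vector (ones :: 'n::finite \<Rightarrow>\<^sub>0 nat) \<notin> newton_polytope f"
proof
  let ?one = "(\<chi> i. 1) :: real ^ 'n"
  have inner: "inner ?one (exponent_vector e) = real (monom_degree e)" for e :: "'n \<Rightarrow>\<^sub>0 nat"
    by (simp add: inner_vec_def exponent_vector_def weight_def)
  have "newton_polytope f \<subseteq> {x. inner ?one x \<le> real (total_degree f)}"
    unfolding newton_polytope_def
  proof (rule hull_minimal)
    show "exponent_vector ` Poly_Mapping.keys f \<subseteq> {x. inner ?one x \<le> real (total_degree f)}"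
      using weight_le_total_degree[OF order_refl, of f] by (auto simp: inner weight_le_def simp del: One_nat_def)
    show "convex {x. inner ?one x \<le> real (total_degree f)}" by (rule convex_halfspace_le)
  qed
  moreover assume "exponent_vector (ones :: 'n \<Rightarrow>\<^sub>0 nat) \<in> newton_polytope f"
  ultimately have "inner ?one (exponent_vector (ones :: 'n \<Rightarrow>\<^sub>0 nat)) \<le> real (total_degree f)" by blast
  then show False using assms unfolding inner monom_degree_ones by simp
qed

text \<open>
  An exponent vector of \<open>f\<^bsup>k+1\<^esup>\<close> is a sum of \<open>k + 1\<close> exponent vectors of \<open>f\<close>; divided by
  \<open>k + 1\<close> it becomes a convex combination of them.
\<close>

lemma keys_power_newton_polytope:
  fixes f :: "('n::finite, 'k::comm_ring_1) mpoly"
  assumes "e \<in> Poly_Mapping.keys (f ^ Suc k)"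
  shows "exponent_vector e /\<^sub>R real (Suc k) \<in> newton_polytope f"
  using assms
proof (induction k arbitrary: e)
  case 0
  then show ?case by (auto simp: newton_polytope_def intro: hull_inc)
next
  case (Suc k)
  then have "e \<in> Poly_Mapping.keys (f * f ^ Suc k)" by simp
  then obtain a b where e: "e = a + b" "a \<in> Poly_Mapping.keys f" "b \<in> Poly_Mapping.keys (f ^ Suc k)"
    using keys_mult[of f "f ^ Suc k"] by blast
  have "exponent_vector a \<in> newton_polytope f"
    unfolding newton_polytope_def using e(2) by (intro hull_inc) auto
  moreover have "exponent_vector b /\<^sub>R real (Suc k) \<in> newton_polytope f" by (rule Suc.IH[OF e(3)])
  moreover have "convex (newton_polytope f)" by (simp add: newton_polytope_def)
  moreover have "1 / real (Suc (Suc k)) + real (Suc k) / real (Suc (Suc k)) = 1"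
    by (simp add: field_simps)
  ultimately have "(1 / real (Suc (Suc k))) *\<^sub>R exponent_vector a +
      (real (Suc k) / real (Suc (Suc k))) *\<^sub>R (exponent_vector b /\<^sub>R real (Suc k)) \<in> newton_polytope f"
    by (intro convexD) (simp_all del: of_nat_Suc)
  also have "(1 / real (Suc (Suc k))) *\<^sub>R exponent_vector a +
      (real (Suc k) / real (Suc (Suc k))) *\<^sub>R (exponent_vector b /\<^sub>R real (Suc k)) =
      exponent_vector e /\<^sub>R real (Suc (Suc k))"
    unfolding e(1) by (simp add: vec_eq_iff exponent_vector_def lookup_add field_simps del: of_nat_Suc)
  finally show ?case .
qed

lemma Tr_power_zero:
  fixes f :: "('n::finite, 'p::prime_card mod_ring) mpoly"
  assumes f: "weight_le (\<lambda>_. 1) CARD('n) f" and ones: "exponent_vector ones \<notin> newton_polytope f"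
  shows "Tr (f ^ (CARD('p) - 1)) = 0"
proof -
  have p: "CARD('p) \<ge> 2" using prime_card[where 'a='p] by (rule prime_ge_2_nat)
  then obtain k where k: "CARD('p) - 1 = Suc k" by (cases "CARD('p) - 1") auto
  have "trace_exponent CARD('p) 0 \<notin> Poly_Mapping.keys (f ^ Suc k)"
  proof
    assume "trace_exponent CARD('p) 0 \<in> Poly_Mapping.keys (f ^ Suc k)"
    then have "exponent_vector (trace_exponent CARD('p) 0) /\<^sub>R real (Suc k) \<in> newton_polytope f"
      by (rule keys_power_newton_polytope)
    moreover have "Poly_Mapping.lookup (trace_exponent CARD('p) (0 :: 'n \<Rightarrow>\<^sub>0 nat)) i = Suc k" for i
      unfolding lookup_trace_exponent k by simp
    then have "exponent_vector (trace_exponent CARD('p) (0 :: 'n \<Rightarrow>\<^sub>0 nat)) /\<^sub>R real (Suc k) = exponent_vector ones"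
      by (simp add: vec_eq_iff exponent_vector_def lookup_ones del: of_nat_Suc)
    ultimately show False using ones by simp
  qed
  then have "coeff_of (f ^ (CARD('p) - 1)) (trace_exponent CARD('p) 0) = 0"
    unfolding k by (simp add: in_keys_iff del: power_Suc)
  then show ?thesis unfolding Tr_power_constant[OF f] by simp
qed

lemma near_splitting_Tr_multiple:
  fixes h :: "('n::finite, 'p::prime_card mod_ring) mpoly"
  shows "near_splitting CARD('p) (Tr_multiple c h)"
proof -
  have "Tr_multiple c h (a ^ CARD('p) * b) = a * Tr_multiple c h b" for a b
  proof -
    have swap: "h * (a ^ CARD('p) * b) = a ^ CARD('p) * (h * b)" by (simp add: mult_ac)
    show ?thesis unfolding Tr_multiple_def swap Tr_pull_out scalar_mult_def by (simp add: mult_ac)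
  qed
  then show ?thesis
    by (simp add: near_splitting_def Tr_multiple_def distrib_left Tr_add mpoly_vs.scale_right_distrib)
qed

lemma frobenius_splitting_Tr_multiple:
  fixes h :: "('n::finite, 'p::prime_card mod_ring) mpoly"
  shows "frobenius_splitting CARD('p) (Tr_multiple c h) \<longleftrightarrow> scalar_mult c (Tr h) = 1"
  unfolding frobenius_splitting_def using near_splitting_Tr_multiple[of c h] by (simp add: Tr_multiple_def)

section \<open>Degrees in the degeneration\<close>

locale cone_degeneration = degeneration p w \<phi> \<phi>'
  for p and w :: "'n::finite \<Rightarrow> nat" and \<phi> \<phi>' :: "('n, 'k::{field, finite}) mpoly \<Rightarrow> ('n, 'k) mpoly" +
  assumes degree_generic: "graded_map p (\<lambda>_. 1) \<phi>"
    and degree_special: "graded_map p (\<lambda>_. 1) \<phi>'"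
begin

lemma generic_cone: "compatibly_split \<phi> I \<Longrightarrow> cone_ideal I"
  using compatibly_split_ideal generic.graded_compatibly_split[OF degree_generic] by blast

lemma special_cone: "compatibly_split \<phi>' I \<Longrightarrow> cone_ideal I"
  using compatibly_split_ideal special.graded_compatibly_split[OF degree_special] by blast

lemma hilbert_poly_init:
  fixes I :: "('n, 'k) mpoly set"
  assumes "cone_ideal I"
  shows "hilbert_poly (init_ideal w I) = hilbert_poly I"
proof -
  have "hilbert_function (init_ideal w I) = hilbert_function I"
    by (rule ext) (rule hilbert_function_init[OF conjunct1[OF assms] conjunct2[OF assms]])
  then show ?thesis by (simp add: hilbert_poly_def)
qed

definition top_fiber :: "('n, 'k) mpoly set \<Rightarrow> ('n, 'k) mpoly set set" where
  "top_fiber Y = {Q. is_prime Q \<and> compatibly_split \<phi>' Q \<and> lift Q = Y \<and> hilbert_dim Q = hilbert_dim Y}"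

text \<open>
  If \<open>init Y \<subseteq> Q\<close>, then \<open>Y \<subseteq> lift Q\<close>. Were this inclusion strict, \<open>lift Q\<close> and hence
  \<open>init (lift Q) \<subseteq> Q\<close> would have smaller dimension than \<open>Y\<close>, contradicting \<open>dim Q = dim Y\<close>.
\<close>

lemma top_fiber_eq:
  assumes Y: "is_prime Y" "compatibly_split \<phi> Y"
  shows "top_fiber Y = {Q. is_prime Q \<and> compatibly_split \<phi>' Q \<and> init_ideal w Y \<subseteq> Q \<and>
    hilbert_dim Q = hilbert_dim Y}"
proof (intro equalityI subsetI)
  fix Q assume "Q \<in> top_fiber Y"
  then have Q: "is_prime Q" "compatibly_split \<phi>' Q" "lift Q = Y" "hilbert_dim Q = hilbert_dim Y"
    by (simp_all add: top_fiber_def)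
  have "init_ideal w Y \<subseteq> Q" using init_lift_subset[OF prime_ideal[OF Q(1)]] Q(3) by simp
  with Q show "Q \<in> {Q. is_prime Q \<and> compatibly_split \<phi>' Q \<and> init_ideal w Y \<subseteq> Q \<and>
    hilbert_dim Q = hilbert_dim Y}" by simp
next
  fix Q assume "Q \<in> {Q. is_prime Q \<and> compatibly_split \<phi>' Q \<and> init_ideal w Y \<subseteq> Q \<and>
    hilbert_dim Q = hilbert_dim Y}"
  then have Q: "is_prime Q" "compatibly_split \<phi>' Q" "init_ideal w Y \<subseteq> Q" "hilbert_dim Q = hilbert_dim Y"
    by simp_all
  have split: "compatibly_split \<phi> (lift Q)" by (rule lift_compatibly_split[OF prime_ideal[OF Q(1)]])
  have sub: "Y \<subseteq> lift Q" by (rule lift_greatest[OF Y(2) Q(3)])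
  have "hilbert_dim Q \<le> hilbert_dim (init_ideal w (lift Q))"
    by (rule hilbert_dim_antimono[OF special_cone[OF init_compatibly_split[OF split]] special_cone[OF Q(2)]
        init_lift_subset[OF prime_ideal[OF Q(1)]]])
  also have "\<dots> = hilbert_dim (lift Q)"
    unfolding hilbert_dim_def hilbert_poly_init[OF generic_cone[OF split]] ..
  finally have "\<not> hilbert_dim (lift Q) < hilbert_dim Y" using Q(4) by simp
  then have "lift Q = Y"
    using hilbert_dim_strict[OF Y(1) generic_cone[OF Y(2)] lift_prime[OF Q(1)] generic_cone[OF split]] sub by blast
  with Q show "Q \<in> top_fiber Y" by (simp add: top_fiber_def)
qed

lemma finite_top_fiber: "finite (top_fiber Y)"
  using finite_special by (rule finite_subset[rotated]) (auto simp: top_fiber_def)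

text \<open>
  Compare the coefficients in degree \<open>dim Y - 1\<close> of the Hilbert polynomials of \<open>Y\<close> and of \<open>init Y\<close>, the
  intersection of its minimal primes. A prime of full dimension above \<open>init Y\<close> is automatically minimal,
  and the other minimal primes have smaller dimension and contribute \<open>0\<close>. The origin is treated
  separately because its Hilbert polynomial is \<open>0\<close> whereas its degree is \<open>1\<close> by convention.
\<close>

theorem sum_cone_degree:
  assumes Y: "is_prime Y" "compatibly_split \<phi> Y"
  shows "(\<Sum>Q\<in>top_fiber Y. cone_degree Q) = cone_degree Y"
proof -
  let ?I = "init_ideal w Y"
  have cone_Y: "cone_ideal Y" by (rule generic_cone[OF Y(2)])
  have split_I: "compatibly_split \<phi>' ?I" by (rule init_compatibly_split[OF Y(2)])
  have cone_I: "cone_ideal ?I" by (rule special_cone[OF split_I])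
  have hp: "hilbert_poly ?I = hilbert_poly Y" by (rule hilbert_poly_init[OF cone_Y])
  define \<P> where "\<P> = {Q. is_prime Q \<and> compatibly_split \<phi>' Q \<and> ?I \<subseteq> Q}"
  have finite_P: "finite \<P>" using finite_special by (rule finite_subset[rotated]) (auto simp: \<P>_def)
  have P: "is_prime Q" "cone_ideal Q" "?I \<subseteq> Q" if "Q \<in> \<P>" for Q
    using that special_cone by (auto simp: \<P>_def)
  have P_dim: "hilbert_dim Q \<le> hilbert_dim Y" if "Q \<in> \<P>" for Q
    using hilbert_dim_antimono[OF cone_I P(2,3)[OF that]] by (simp add: hilbert_dim_def hp)
  have top: "top_fiber Y = {Q \<in> \<P>. hilbert_dim Q = hilbert_dim Y}"
    unfolding top_fiber_eq[OF Y] \<P>_def by blast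
  show ?thesis
  proof (cases "hilbert_dim Y")
    case 0
    have "Y = origin" using 0 hilbert_dim_0_iff[OF Y(1) cone_Y] by simp
    have only: "Q = origin" if "Q \<in> \<P>" for Q
      using P_dim[OF that] 0 hilbert_dim_0_iff[OF P(1,2)[OF that]] by simp
    obtain Q where Q: "is_prime Q" "compatibly_split \<phi>' Q" "lift Q = Y" by (rule lift_surjective[OF Y])
    have "Q \<in> \<P>"
      using Q init_lift_subset[OF prime_ideal[OF Q(1)]] by (simp add: \<P>_def)
    then have "top_fiber Y = {origin}"
      unfolding top using only P_dim 0 by auto
    then show ?thesis by (simp add: \<open>Y = origin\<close>)
  next
    case (Suc r)
    \<comment> \<open>The minimal primes of \<open>init Y\<close>.\<close>
    define \<Q> where "\<Q> = {Q \<in> \<P>. \<forall>Q'\<in>\<P>. Q' \<subseteq> Q \<longrightarrow> Q' = Q}"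
    have finite_Q: "finite \<Q>" using finite_P by (simp add: \<Q>_def)
    have "\<Inter>\<Q> = ?I"
    proof
      show "\<Inter>\<Q> \<subseteq> ?I"
      proof (rule ccontr)
        assume "\<not> ?thesis"
        then obtain x where x: "x \<in> \<Inter>\<Q>" "x \<notin> ?I" by blast
        obtain Q where Q: "is_prime Q" "compatibly_split \<phi>' Q" "?I \<subseteq> Q" "x \<notin> Q"
          by (rule special.prime_separating_exists[OF finite_special split_I x(2)])
        then have "Q \<in> \<P>" by (simp add: \<P>_def)
        then obtain Q0 where Q0: "Q0 \<in> \<P>" "Q0 \<subseteq> Q" "\<forall>Q'\<in>\<P>. Q' \<subseteq> Q0 \<longrightarrow> Q0 = Q'"
          using finite_has_minimal2[OF finite_P] by metis
        then have "Q0 \<in> \<Q>" by (auto simp: \<Q>_def)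
        then show False using x(1) Q(4) Q0(2) by blast
      qed
      show "?I \<subseteq> \<Inter>\<Q>" using P(3) by (auto simp: \<Q>_def)
    qed
    moreover have "Polynomial.coeff (hilbert_poly (\<Inter>\<Q>)) r = (\<Sum>Q\<in>\<Q>. Polynomial.coeff (hilbert_poly Q) r)"
    proof -
      have primes: "is_prime Q \<and> cone_ideal Q \<and> hilbert_dim Q \<le> Suc r" if "Q \<in> \<Q>" for Q
        using that P P_dim Suc by (auto simp: \<Q>_def)
      have incomparable: "Q = Q'" if "Q \<in> \<Q>" "Q' \<in> \<Q>" "Q \<subseteq> Q'" for Q Q'
        using that by (auto simp: \<Q>_def)
      show ?thesis
        by (rule hilbert_poly_Inter_primes[OF finite_Q primes incomparable, THEN conjunct2, THEN conjunct2])
    qed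
    ultimately have "Polynomial.coeff (hilbert_poly Y) r = (\<Sum>Q\<in>\<Q>. Polynomial.coeff (hilbert_poly Q) r)"
      by (simp add: hp)
    also have "\<dots> = (\<Sum>Q\<in>top_fiber Y. Polynomial.coeff (hilbert_poly Q) r)"
    proof (rule sum.mono_neutral_right[OF finite_Q])
      show "top_fiber Y \<subseteq> \<Q>"
      proof
        fix Q assume "Q \<in> top_fiber Y"
        then have Q: "Q \<in> \<P>" "hilbert_dim Q = hilbert_dim Y" by (simp_all add: top)
        have "Q' = Q" if Q': "Q' \<in> \<P>" "Q' \<subseteq> Q" for Q'
        proof (rule ccontr)
          assume "Q' \<noteq> Q"
          then have "hilbert_dim Q < hilbert_dim Q'"
            using Q' by (intro hilbert_dim_strict P Q) auto
          then show False using P_dim[OF Q'(1)] Q(2) by simp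
        qed
        then show "Q \<in> \<Q>" using Q(1) by (simp add: \<Q>_def)
      qed
      show "\<forall>Q\<in>\<Q> - top_fiber Y. Polynomial.coeff (hilbert_poly Q) r = 0"
      proof
        fix Q assume "Q \<in> \<Q> - top_fiber Y"
        then have "Q \<in> \<P>" "hilbert_dim Q \<noteq> hilbert_dim Y" by (auto simp: \<Q>_def top)
        then have "poly_dim (hilbert_poly Q) \<le> r" using P_dim[of Q] Suc by (simp add: hilbert_dim_def)
        then show "Polynomial.coeff (hilbert_poly Q) r = 0" by (simp add: poly_dim_le_iff)
      qed
    qed
    finally have coeff: "Polynomial.coeff (hilbert_poly Y) r =
        (\<Sum>Q\<in>top_fiber Y. Polynomial.coeff (hilbert_poly Q) r)" .
    have degree: "cone_degree Q = fact r * Polynomial.coeff (hilbert_poly Q) r"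
      if "is_prime Q" "cone_ideal Q" "hilbert_dim Q = Suc r" for Q :: "('n, 'k) mpoly set"
      using that hilbert_dim_0_iff[OF that(1,2)] by (intro cone_degree_eq) auto
    have "(\<Sum>Q\<in>top_fiber Y. cone_degree Q) = (\<Sum>Q\<in>top_fiber Y. fact r * Polynomial.coeff (hilbert_poly Q) r)"
      using P Suc by (intro sum.cong degree) (auto simp: top)
    also have "\<dots> = fact r * Polynomial.coeff (hilbert_poly Y) r"
      unfolding coeff sum_distrib_left ..
    also have "\<dots> = cone_degree Y" using degree[OF Y(1) cone_Y Suc] by simp
    finally show ?thesis .
  qed
qed

end

section \<open>Splittings from a polynomial\<close>

locale degenerating_polynomial =
  fixes f :: "('n::finite, 'p::prime_card mod_ring) mpoly" and w :: "'n \<Rightarrow> nat"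
  assumes degree: "total_degree f \<le> CARD('n)"
    and ones: "ones \<in> Poly_Mapping.keys (leading_form w f)"
begin

abbreviation F :: "('n, 'p mod_ring) mpoly" where "F \<equiv> f ^ (CARD('p) - 1)"

abbreviation F' :: "('n, 'p mod_ring) mpoly" where "F' \<equiv> leading_form w f ^ (CARD('p) - 1)"

lemma weight_f: "weight_le w (weight w ones) f"
  and leading_f: "leading_form w f = component w (weight w ones) f"
proof -
  obtain d where d: "weight_le w d f" "leading_form w f = component w d f"
    by (rule leading_form_component)
  with ones have "weight w ones = d" by (simp add: keys_component)
  with d show "weight_le w (weight w ones) f" "leading_form w f = component w (weight w ones) f"
    by simp_all
qed

lemma degree_f: "weight_le (\<lambda>_. 1) CARD('n) f"
  using weight_le_total_degree[OF degree] .

lemma degree_leading: "weight_le (\<lambda>_. 1) CARD('n) (leading_form w f)"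
  unfolding leading_f using degree_f by (rule weight_le_component')

lemma leading_homogeneous: "weight_homogeneous w (weight w ones) (leading_form w f)"
  unfolding leading_f by simp

lemma Tr_leading: "Tr F = Tr F'"
proof -
  have "component w 0 (Tr F) = Tr F'"
    using component_Tr[of w 0 F] component_power_top[OF weight_f, of "CARD('p) - 1"] by (simp add: leading_f)
  moreover have "component w 0 (Tr F) = Tr F"
    unfolding Tr_power_constant[OF degree_f] by (simp add: component_monom)
  ultimately show ?thesis by simp
qed

lemma splitting_iff:
  "frobenius_splitting CARD('p) (Tr_multiple c F) \<longleftrightarrow> frobenius_splitting CARD('p) (Tr_multiple c F')"
  unfolding frobenius_splitting_Tr_multiple Tr_leading ..

text \<open>
  Both traces are the same constant \<open>t\<close>, and \<open>a\<close> and \<open>b\<close> are its inverse.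
\<close>

lemma splitting_scalar_unique:
  assumes "frobenius_splitting CARD('p) (Tr_multiple a F)" "frobenius_splitting CARD('p) (Tr_multiple b F')"
  shows "a = b"
proof -
  define t where "t = coeff_of F (trace_exponent CARD('p) 0)"
  have t: "Tr F = monom_of 0 t" unfolding t_def by (rule Tr_power_constant[OF degree_f])
  have "monom_of 0 (a * t) = (1 :: ('n, 'p mod_ring) mpoly)" "monom_of 0 (b * t) = (1 :: ('n, 'p mod_ring) mpoly)"
    using assms unfolding frobenius_splitting_Tr_multiple Tr_leading[symmetric] t
    by (simp_all add: scalar_mult_def mult_single)
  then have "a * t = 1" "b * t = 1" by (metis lookup_one_zero lookup_single_eq)+
  then show "a = b" by (metis mult_cancel_right mult_zero_right zero_neq_one)
qed

lemma mpoly_splitting_Tr_multiple: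
  assumes "frobenius_splitting CARD('p) (Tr_multiple a h)"
  shows "mpoly_splitting CARD('p) (Tr_multiple a (h :: ('n, 'p mod_ring) mpoly))"
proof
  show "2 \<le> CARD('p)" using prime_card[where 'a='p] by (rule prime_ge_2_nat)
  show "frobenius_splitting CARD('p) (Tr_multiple a h)" by (rule assms)
  show "c ^ CARD('p) = c" for c :: "'p mod_ring" by (rule mod_ring_power_card)
qed

lemma finite_compatibly_split:
  fixes g :: "('n, 'p mod_ring) mpoly"
  assumes "frobenius_splitting CARD('p) (Tr_multiple a (g ^ (CARD('p) - 1)))" "weight_le (\<lambda>_. 1) CARD('n) g"
  shows "finite {I. compatibly_split (Tr_multiple a (g ^ (CARD('p) - 1))) I}"
proof (rule mpoly_splitting.finite_compatibly_split[OF mpoly_splitting_Tr_multiple[OF assms(1)]])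
  fix h c e assume "weight_le (\<lambda>_. 1) c h" "e \<in> Poly_Mapping.keys (Tr_multiple a (g ^ (CARD('p) - 1)) h)"
  then show "CARD('p) * monom_degree e \<le> c"
    by (intro weight_Tr_multiple[of "\<lambda>_. 1" g]) (simp_all only: monom_degree_ones assms(2))
qed (rule finite_bounded_degree)

lemma degeneration:
  assumes "frobenius_splitting CARD('p) (Tr_multiple a F)"
  shows "degeneration CARD('p) w (Tr_multiple a F) (Tr_multiple a F')"
proof -
  have split': "frobenius_splitting CARD('p) (Tr_multiple a F')" using assms splitting_iff by simp
  interpret generic: mpoly_splitting "CARD('p)" "Tr_multiple a F" by (rule mpoly_splitting_Tr_multiple[OF assms])
  interpret special: mpoly_splitting "CARD('p)" "Tr_multiple a F'" by (rule mpoly_splitting_Tr_multiple[OF split'])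
  show ?thesis
  proof
    fix c and g :: "('n, 'p mod_ring) mpoly" assume g: "weight_le w (CARD('p) * c) g"
    show "weight_le w c (Tr_multiple a F g)"
      unfolding weight_le_def
    proof
      fix e assume "e \<in> Poly_Mapping.keys (Tr_multiple a F g)"
      then have "CARD('p) * weight w e \<le> CARD('p) * c" by (rule weight_Tr_multiple[OF weight_f g])
      then show "weight w e \<le> c" by simp
    qed
    show "component w c (Tr_multiple a F g) = Tr_multiple a F' (component w (CARD('p) * c) g)"
      unfolding component_scaled component_Tr_mult_power[OF weight_f g] by (simp add: Tr_multiple_def leading_f)
  next
    show "graded_map CARD('p) w (Tr_multiple a F')" by (rule graded_map_Tr_multiple[OF leading_homogeneous])
    show "finite {I. compatibly_split (Tr_multiple a F) I}" by (rule finite_compatibly_split[OF assms degree_f])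
    show "finite {I. compatibly_split (Tr_multiple a F') I}"
      by (rule finite_compatibly_split[OF split' degree_leading])
  qed
qed

lemma cone_degeneration:
  assumes "frobenius_splitting CARD('p) (Tr_multiple a F)" and "homogeneous f"
  shows "cone_degeneration CARD('p) w (Tr_multiple a F) (Tr_multiple a F')"
proof -
  interpret degeneration "CARD('p)" w "Tr_multiple a F" "Tr_multiple a F'" by (rule degeneration[OF assms(1)])
  obtain d where d: "weight_homogeneous (\<lambda>_. 1) d f"
    using assms(2) by (auto simp: homogeneous_def homogeneous_of_degree_eq)
  have "ones \<in> Poly_Mapping.keys f" using ones by (simp add: leading_f keys_component)
  with d have "monom_degree (ones :: 'n \<Rightarrow>\<^sub>0 nat) = d" by (simp only: weight_homogeneous_def)
  with d have f: "weight_homogeneous (\<lambda>_. 1) (monom_degree (ones :: 'n \<Rightarrow>\<^sub>0 nat)) f" by simp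
  then have lf: "weight_homogeneous (\<lambda>_. 1) (monom_degree (ones :: 'n \<Rightarrow>\<^sub>0 nat)) (leading_form w f)"
    unfolding leading_f weight_homogeneous_def keys_component by blast
  show ?thesis
    by unfold_locales (rule graded_map_Tr_multiple[OF f] graded_map_Tr_multiple[OF lf])+
qed

end

theorem theorem2:
  fixes f :: "('n::finite, 'p::prime_card mod_ring) mpoly"
  assumes "total_degree f \<le> CARD('n)"
  shows
    "(total_degree f < CARD('n) \<longrightarrow> exponent_vector ones \<notin> newton_polytope f) \<and>
     (exponent_vector ones \<notin> newton_polytope f \<longrightarrow>
        Tr (f ^ (CARD('p) - 1)) = 0 \<and>
        (\<forall>c. \<not> frobenius_splitting CARD('p) (Tr_multiple c (f ^ (CARD('p) - 1))))) \<and>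
     (\<forall>w :: 'n \<Rightarrow> nat. ones \<in> Poly_Mapping.keys (leading_form w f) \<longrightarrow>
        (let F = f ^ (CARD('p) - 1); F' = leading_form w f ^ (CARD('p) - 1) in
          Tr F = Tr F' \<and>
          (\<forall>c. frobenius_splitting CARD('p) (Tr_multiple c F) \<longleftrightarrow>
               frobenius_splitting CARD('p) (Tr_multiple c F')) \<and>
          (\<forall>a b. frobenius_splitting CARD('p) (Tr_multiple a F) \<and>
                 frobenius_splitting CARD('p) (Tr_multiple b F') \<longrightarrow>
             (\<forall>I. compatibly_split (Tr_multiple a F) I \<longrightarrow>
                  compatibly_split (Tr_multiple b F') (init_ideal w I)) \<and>
             (let \<Y> = split_varieties (Tr_multiple a F);
                  \<Y>' = split_varieties (Tr_multiple b F');
                  \<pi> = degeneration_map w \<Y>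
              in
               (\<forall>Y'\<in>\<Y>'. \<exists>!Y. minimal_degenerating_to w \<Y> Y' Y) \<and>
               monotone_on \<Y>' (\<sqsubseteq>\<^sub>s) (\<sqsubseteq>\<^sub>s) \<pi> \<and>
               \<pi> ` \<Y>' = \<Y> \<and>
               (\<forall>Y\<^sub>1'\<in>\<Y>'. \<forall>Y\<^sub>2\<in>\<Y>.
                  \<pi> Y\<^sub>1' \<sqsubseteq>\<^sub>s Y\<^sub>2 \<longleftrightarrow> (\<exists>Y\<^sub>2'\<in>\<Y>'. Y\<^sub>1' \<sqsubseteq>\<^sub>s Y\<^sub>2' \<and> \<pi> Y\<^sub>2' = Y\<^sub>2)) \<and>
               (homogeneous f \<longrightarrow>
                  (\<forall>Y\<in>\<Y> \<union> \<Y>'. is_cone Y) \<and>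
                  (\<forall>Y\<in>\<Y>.
                     finite {Y'\<in>\<Y>'. \<pi> Y' = Y \<and> variety_dim (\<pi> Y') = variety_dim Y'} \<and>
                     (\<Sum>Y' | Y' \<in> \<Y>' \<and> \<pi> Y' = Y \<and> variety_dim (\<pi> Y') = variety_dim Y'.
                        cone_degree Y') = cone_degree Y))))))"
    (is "_ \<and> _ \<and> (\<forall>w. _ \<longrightarrow> ?claims w)")
proof (intro conjI impI allI)
  have deg: "weight_le (\<lambda>_. 1) CARD('n) f" by (rule weight_le_total_degree[OF assms])
  show "exponent_vector ones \<notin> newton_polytope f" if "total_degree f < CARD('n)"
    by (rule degree_newton_polytope[OF that])
  assume "exponent_vector ones \<notin> newton_polytope f"
  then show zero: "Tr (f ^ (CARD('p) - 1)) = 0" by (rule Tr_power_zero[OF deg])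
  show "\<not> frobenius_splitting CARD('p) (Tr_multiple c (f ^ (CARD('p) - 1)))" for c
    unfolding frobenius_splitting_Tr_multiple zero by simp
next
  fix w :: "'n \<Rightarrow> nat" assume ones: "ones \<in> Poly_Mapping.keys (leading_form w f)"
  interpret degenerating_polynomial f w by unfold_locales (use assms ones in simp_all)
  show "?claims w"
    unfolding Let_def
  proof (intro conjI allI impI)
    show "Tr F = Tr F'" by (rule Tr_leading)
    show "frobenius_splitting CARD('p) (Tr_multiple c F) \<longleftrightarrow> frobenius_splitting CARD('p) (Tr_multiple c F')" for c
      by (rule splitting_iff)
  next
    fix a b assume "frobenius_splitting CARD('p) (Tr_multiple a F) \<and>
      frobenius_splitting CARD('p) (Tr_multiple b F')"
    then have split: "frobenius_splitting CARD('p) (Tr_multiple a F)" and b: "b = a"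
      using splitting_scalar_unique by auto
    interpret D: degeneration "CARD('p)" w "Tr_multiple a F" "Tr_multiple a F'" by (rule degeneration[OF split])
    let ?Y = "split_varieties (Tr_multiple a F)" and ?Y' = "split_varieties (Tr_multiple b F')"
    let ?\<pi> = "degeneration_map w ?Y"
    have Y: "Y \<in> ?Y \<longleftrightarrow> is_prime Y \<and> compatibly_split (Tr_multiple a F) Y" for Y
      by (rule D.split_varieties_iff)
    have Y': "Y \<in> ?Y' \<longleftrightarrow> is_prime Y \<and> compatibly_split (Tr_multiple a F') Y" for Y
      unfolding b by (rule D.split_varieties_iff)
    have \<pi>: "?\<pi> Q = D.lift Q" if "Q \<in> ?Y'" for Q
      using that Y' D.degeneration_map_eq by blast
    have lift_mem: "D.lift Q \<in> ?Y" if "Q \<in> ?Y'" for Q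
      using that Y Y' D.lift_prime D.lift_compatibly_split prime_ideal by blast
    show "compatibly_split (Tr_multiple b F') (init_ideal w I)" if "compatibly_split (Tr_multiple a F) I" for I
      unfolding b by (rule D.init_compatibly_split[OF that])
    show "\<forall>Q\<in>?Y'. \<exists>!Y. minimal_degenerating_to w ?Y Q Y"
      using Y' D.minimal_degenerating_to_iff by auto
    show "monotone_on ?Y' (\<sqsubseteq>\<^sub>s) (\<sqsubseteq>\<^sub>s) ?\<pi>"
      by (rule monotone_onI) (simp add: \<pi> subscheme_le_def D.lift_mono del: One_nat_def)
    show "?\<pi> ` ?Y' = ?Y"
    proof
      show "?\<pi> ` ?Y' \<subseteq> ?Y" using \<pi> lift_mem by auto
      show "?Y \<subseteq> ?\<pi> ` ?Y'"
      proof
        fix Z assume "Z \<in> ?Y"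
        then obtain Q where "is_prime Q" "compatibly_split (Tr_multiple a F') Q" "D.lift Q = Z"
          using Y D.lift_surjective by metis
        then have "Q \<in> ?Y'" "Z = ?\<pi> Q" using Y' \<pi> by auto
        then show "Z \<in> ?\<pi> ` ?Y'" by blast
      qed
    qed
    show "\<forall>Y\<^sub>1'\<in>?Y'. \<forall>Y\<^sub>2\<in>?Y.
        ?\<pi> Y\<^sub>1' \<sqsubseteq>\<^sub>s Y\<^sub>2 \<longleftrightarrow> (\<exists>Y\<^sub>2'\<in>?Y'. Y\<^sub>1' \<sqsubseteq>\<^sub>s Y\<^sub>2' \<and> ?\<pi> Y\<^sub>2' = Y\<^sub>2)"
    proof (intro ballI iffI)
      fix P Z assume P: "P \<in> ?Y'" and Z: "Z \<in> ?Y" and "?\<pi> P \<sqsubseteq>\<^sub>s Z"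
      then have "Z \<subseteq> D.lift P" by (simp add: \<pi> subscheme_le_def del: One_nat_def)
      have prime_P: "is_prime P" using P Y' by blast
      have "init_ideal w Z \<subseteq> P"
        using init_ideal_mono[OF \<open>Z \<subseteq> D.lift P\<close>] D.init_lift_subset[OF prime_ideal[OF prime_P]]
        by (rule subset_trans)
      then obtain Q where "is_prime Q" "compatibly_split (Tr_multiple a F') Q" "Q \<subseteq> P" "D.lift Q = Z"
        using D.prime_between_exists[of Z P] Z Y prime_P by metis
      then show "\<exists>Y\<^sub>2'\<in>?Y'. P \<sqsubseteq>\<^sub>s Y\<^sub>2' \<and> ?\<pi> Y\<^sub>2' = Z"
        using Y' \<pi> by (intro bexI[of _ Q]) (auto simp: subscheme_le_def)
    next
      fix P Z assume P: "P \<in> ?Y'" and "\<exists>Y\<^sub>2'\<in>?Y'. P \<sqsubseteq>\<^sub>s Y\<^sub>2' \<and> ?\<pi> Y\<^sub>2' = Z"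
      then obtain Q where Q: "Q \<in> ?Y'" "Q \<subseteq> P" "?\<pi> Q = Z" by (auto simp: subscheme_le_def)
      have "D.lift Q \<subseteq> D.lift P" by (rule D.lift_mono[OF Q(2)])
      moreover have "Z = D.lift Q" unfolding Q(3)[symmetric] by (rule \<pi>[OF Q(1)])
      ultimately have "Z \<subseteq> D.lift P" by simp
      then show "?\<pi> P \<sqsubseteq>\<^sub>s Z" unfolding subscheme_le_def \<pi>[OF P] by simp
    qed
    assume hom: "homogeneous f"
    interpret C: cone_degeneration "CARD('p)" w "Tr_multiple a F" "Tr_multiple a F'"
      by (rule cone_degeneration[OF split hom])
    show "\<forall>Z\<in>?Y \<union> ?Y'. is_cone Z"
      using Y Y' C.generic_cone C.special_cone by (auto simp: is_cone_iff_graded simp del: One_nat_def)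
    have fiber: "{Y'\<in>?Y'. ?\<pi> Y' = Z \<and> variety_dim (?\<pi> Y') = variety_dim Y'} = C.top_fiber Z" if "Z \<in> ?Y" for Z
    proof -
      have Z: "variety_dim Z = enat (hilbert_dim Z)"
        using that Y C.generic_cone by (intro variety_dim_cone) auto
      have Q: "variety_dim Q = enat (hilbert_dim Q)" if "Q \<in> ?Y'" for Q
        using that Y' C.special_cone by (intro variety_dim_cone) auto
      show ?thesis
        unfolding C.top_fiber_def using Y' Q Z \<pi> by (auto simp: eq_commute)
    qed
    show "\<forall>Y\<in>?Y. finite {Y'\<in>?Y'. ?\<pi> Y' = Y \<and> variety_dim (?\<pi> Y') = variety_dim Y'} \<and>
       (\<Sum>Y' | Y' \<in> ?Y' \<and> ?\<pi> Y' = Y \<and> variety_dim (?\<pi> Y') = variety_dim Y'. cone_degree Y') = cone_degree Y"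
      using fiber C.finite_top_fiber C.sum_cone_degree Y by simp
  qed
qed

end
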